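(* Let $(X,L_X)$ and $(Y,L_Y)$ be Lip-normed operator systems. (i) If $n\in\mathbb{N}$ then $\mathrm{dist}^n_s(X,Y)=0$ if and only if there is a bi-Lip-isometric unital $n$-order isomorphism between $X$ and $Y$. (ii) We have $\mathrm{dist}_s(X,Y)=0$ if and only if there is a bi-Lip-isometric unital complete order isomorphism between $X$ and $Y$.
   Context: An operator system is a closed unital self-adjoint linear subspace $X$ of a unital $C^*$-algebra; $1$ is its unit, $X_{\mathrm{sa}}$ its real subspace of self-adjoint elements. $M_n$ is the algebra of complex $n\times n$ matrices. A linear map $\varphi:X\to Y$ between operator systems is $n$-positive if $\mathrm{id}_n\otimes\varphi:M_n\otimes X\to M_n\otimes Y$ is positive, and completely positive if it is $n$-positive for all $n$; u.c.p. means unital completely positive. $UCP_n(X)$ is the set of u.c.p. maps $X\to M_n$. A unital linear bijection $\varphi:X\to Y$ such that $\varphi$ and $\varphi^{-1}$ are $m$-positive for $m=1,\dots,n$ is a unital $n$-order isomorphism; a u.c.p. bijection with completely positive inverse is a unital complete order isomorphism. Let $A\subseteq X_{\mathrm{sa}}$ be a real linear subspace containing $1$, with state space $S(A)$ (unital positive real-linear functionals). A Lip-norm on $A$ is a semi-norm $L:A\to[0,\infty)$ such that (1) $L(a)=0$ iff $a\in\mathbb{R}1$, and (2) the metric $\rho_L(\mu,\nu)=\sup\{|\mu(a)-\nu(a)|:a\in A,\ L(a)\le 1\}$ on $S(A)$ induces the weak$^*$ topology. Write $\mathcal{D}(L)=A$ for the domain and $\mathcal{D}_1(L)=\{a\in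 A:L(a)\le 1\}$. A Lip-normed operator system is a pair $(X,L)$ with $X$ an operator system and $L$ a Lip-norm on a dense real linear subspace $\mathcal{D}(L)\ni 1$ of $X_{\mathrm{sa}}$ such that $\mathcal{D}_1(L)$ is closed in $X_{\mathrm{sa}}$. On $UCP_n(X)$ put the metric $\rho_{L,n}(\varphi,\psi)=\sup_{x\in\mathcal{D}_1(L)}\|\varphi(x)-\psi(x)\|$. For Lip-normed operator systems $(X,L_X)$, $(Y,L_Y)$, let $X\oplus Y$ be the direct sum operator system (maximum norm, coordinatewise structure) and let $\mathcal{M}(L_X,L_Y)$ be the set of Lip-norms $L$ on $\mathcal{D}(L_X)\oplus\mathcal{D}(L_Y)$ with $\mathcal{D}_1(L)$ closed in $(X\oplus Y)_{\mathrm{sa}}$ and with $L_X(x)=\inf_{y\in\mathcal{D}(L_Y)}L(x,y)$ for all $x\in\mathcal{D}(L_X)$ and $L_Y(y)=\inf_{x\in\mathcal{D}(L_X)}L(x,y)$ for all $y\in\mathcal{D}(L_Y)$. Regard $UCP_n(X)$ and $UCP_n(Y)$ as subsets of $UCP_n(X\oplus Y)$ by composing with the coordinate projections. With $\mathrm{dist}_H^{\rho}$ denoting Hausdorff distance for the metric $\rho$, $$\mathrm{dist}^n_s(X,Y)=\inf_{L\in\mathcal{M}(L_X,L_Y)}\mathrm{dist}_H^{\rho_{L,n}}(UCP_n(X),UCP_n(Y)),$$ $$\mathrm{dist}_s(X,Y)=\inf_{L\in\mathcal{M}(L_X,L_Y)}\ \sup_{n\in\mathbb{N}}\ \mathrm{dist}_H^{\rho_{L,n}}(UCP_n(X),UCP_n(Y)).$$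 A positive unital linear map $\Phi:X\to Y$ is Lip-isometric if $\Phi(\mathcal{D}(L_X))\subset\mathcal{D}(L_Y)$ and $L_Y(\Phi(x))=L_X(x)$ for all $x\in\mathcal{D}(L_X)$; if $\Phi$ has a positive inverse, $\Phi$ is bi-Lip-isometric if both $\Phi$ and $\Phi^{-1}$ are Lip-isometric. *)

theory Defs
  imports "HOL-Analysis.Analysis" "Jordan_Normal_Form.Matrix"
begin

section \<open>Unital C*-algebras\<close>

text \<open>As \<open>real_normed_algebra_1\<close> demands \<open>norm 1 = 1\<close>, the zero algebra is excluded.\<close>

class unital_cstar_algebra = real_normed_algebra_1 + banach +
  fixes scaleC :: "complex \<Rightarrow> 'a \<Rightarrow> 'a"  (infixr \<open>*\<^sub>C\<close> 75)
    and star :: "'a \<Rightarrow> 'a"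
  assumes scaleC_add_right: "c *\<^sub>C (x + y) = c *\<^sub>C x + c *\<^sub>C y"
    and scaleC_add_left: "(c + d) *\<^sub>C x = c *\<^sub>C x + d *\<^sub>C x"
    and scaleC_scaleC: "c *\<^sub>C d *\<^sub>C x = (c * d) *\<^sub>C x"
    and scaleC_of_real: "complex_of_real r *\<^sub>C x = r *\<^sub>R x"
    and mult_scaleC_left: "(c *\<^sub>C x) * y = c *\<^sub>C (x * y)"
    and mult_scaleC_right: "x * (c *\<^sub>C y) = c *\<^sub>C (x * y)"
    and norm_scaleC: "norm (c *\<^sub>C x) = cmod c * norm x"
    and star_star: "star (star x) = x"
    and star_add: "star (x + y) = star x + star y"
    and star_scaleC: "star (c *\<^sub>C x) = cnj c *\<^sub>C star x"
    and star_mult: "star (x * y) = star y * star x"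
    and cstar_identity: "norm (star x * x) = (norm x)\<^sup>2"

instantiation complex :: unital_cstar_algebra
begin

definition scaleC_complex :: "complex \<Rightarrow> complex \<Rightarrow> complex"
  where "scaleC_complex c x = c * x"

definition star_complex :: "complex \<Rightarrow> complex"
  where "star_complex = cnj"

instance
  by standard
    (simp_all add: scaleC_complex_def star_complex_def algebra_simps norm_mult
      power2_eq_square scaleR_conv_of_real)

end


section \<open>The direct sum of two C*-algebras\<close>

text \<open>The product type carries the Euclidean norm in the library, whereas the direct sum of
  C*-algebras needs the maximum norm; hence a separate type.\<close>

datatype ('a, 'b) dsum = DSum (dfst: 'a) (dsnd: 'b)

instantiation dsum :: (real_normed_vector, real_normed_vector) real_normed_vector
begin

definition zero_dsum :: "('a, 'b) dsum" where "0 = DSum 0 0"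
definition plus_dsum :: "('a, 'b) dsum \<Rightarrow> ('a, 'b) dsum \<Rightarrow> ('a, 'b) dsum"
  where "u + v = DSum (dfst u + dfst v) (dsnd u + dsnd v)"
definition minus_dsum :: "('a, 'b) dsum \<Rightarrow> ('a, 'b) dsum \<Rightarrow> ('a, 'b) dsum"
  where "u - v = DSum (dfst u - dfst v) (dsnd u - dsnd v)"
definition uminus_dsum :: "('a, 'b) dsum \<Rightarrow> ('a, 'b) dsum"
  where "- u = DSum (- dfst u) (- dsnd u)"
definition scaleR_dsum :: "real \<Rightarrow> ('a, 'b) dsum \<Rightarrow> ('a, 'b) dsum"
  where "r *\<^sub>R u = DSum (r *\<^sub>R dfst u) (r *\<^sub>R dsnd u)"
definition norm_dsum :: "('a, 'b) dsum \<Rightarrow> real"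
  where "norm u = max (norm (dfst u)) (norm (dsnd u))"
definition sgn_dsum :: "('a, 'b) dsum \<Rightarrow> ('a, 'b) dsum"
  where "sgn (u :: ('a, 'b) dsum) = inverse (norm u) *\<^sub>R u"
definition dist_dsum :: "('a, 'b) dsum \<Rightarrow> ('a, 'b) dsum \<Rightarrow> real"
  where "dist (u :: ('a, 'b) dsum) v = norm (u - v)"
definition uniformity_dsum :: "(('a, 'b) dsum \<times> ('a, 'b) dsum) filter" where
  "(uniformity :: (('a, 'b) dsum \<times> ('a, 'b) dsum) filter) =
     (INF e\<in>{0<..}. principal {(x, y). dist x y < e})"
definition open_dsum :: "('a, 'b) dsum set \<Rightarrow> bool" where
  "open (U :: ('a, 'b) dsum set) \<longleftrightarrow>
     (\<forall>x\<in>U. eventually (\<lambda>(x', y). x' = x \<longrightarrow> y \<in> U) uniformity)"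

instance
proof
  fix u v :: "('a, 'b) dsum" and r :: real
  show "norm (u + v) \<le> norm u + norm v"
    using norm_triangle_ineq[of "dfst u" "dfst v"] norm_triangle_ineq[of "dsnd u" "dsnd v"]
    by (auto simp: norm_dsum_def plus_dsum_def max_def)
  show "norm u = 0 \<longleftrightarrow> u = 0"
  proof
    assume "norm u = 0"
    then have "norm (dfst u) \<le> 0" "norm (dsnd u) \<le> 0"
      unfolding norm_dsum_def by linarith+
    then show "u = 0"
      by (simp add: zero_dsum_def dsum.expand)
  qed (simp add: norm_dsum_def zero_dsum_def)
  show "norm (r *\<^sub>R u) = \<bar>r\<bar> * norm u"
    by (simp add: norm_dsum_def scaleR_dsum_def max_mult_distrib_left)
qed (simp_all add: zero_dsum_def plus_dsum_def minus_dsum_def uminus_dsum_def scaleR_dsum_def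
    sgn_dsum_def dist_dsum_def uniformity_dsum_def open_dsum_def algebra_simps)

end

instance dsum :: (banach, banach) banach
proof
  fix X :: "nat \<Rightarrow> ('a, 'b) dsum"
  assume X: "Cauchy X"
  have le: "dist (dfst u) (dfst v) \<le> dist u v" "dist (dsnd u) (dsnd v) \<le> dist u v"
    for u v :: "('a, 'b) dsum"
    by (simp_all add: dist_dsum_def norm_dsum_def minus_dsum_def dist_norm)
  have "Cauchy (\<lambda>n. dfst (X n))" "Cauchy (\<lambda>n. dsnd (X n))"
    using X le unfolding Cauchy_def by (meson order_le_less_trans)+
  then obtain a b where ab: "(\<lambda>n. dfst (X n)) \<longlonglongrightarrow> a" "(\<lambda>n. dsnd (X n)) \<longlonglongrightarrow> b"
    using Cauchy_convergent convergent_def by metis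
  have "(\<lambda>n. max (dist (dfst (X n)) a) (dist (dsnd (X n)) b)) \<longlonglongrightarrow> max 0 0"
    by (intro tendsto_max) (use ab in \<open>auto simp: tendsto_dist_iff[symmetric]\<close>)
  then have "(\<lambda>n. dist (X n) (DSum a b)) \<longlonglongrightarrow> 0"
    by (simp add: dist_dsum_def norm_dsum_def minus_dsum_def dist_norm)
  then show "convergent X"
    using tendsto_dist_iff convergent_def by blast
qed

instantiation dsum :: (unital_cstar_algebra, unital_cstar_algebra) unital_cstar_algebra
begin

definition one_dsum :: "('a, 'b) dsum" where "1 = DSum 1 1"
definition times_dsum :: "('a, 'b) dsum \<Rightarrow> ('a, 'b) dsum \<Rightarrow> ('a, 'b) dsum"
  where "u * v = DSum (dfst u * dfst v) (dsnd u * dsnd v)"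
definition scaleC_dsum :: "complex \<Rightarrow> ('a, 'b) dsum \<Rightarrow> ('a, 'b) dsum"
  where "c *\<^sub>C u = DSum (c *\<^sub>C dfst u) (c *\<^sub>C dsnd u)"
definition star_dsum :: "('a, 'b) dsum \<Rightarrow> ('a, 'b) dsum"
  where "star u = DSum (star (dfst u)) (star (dsnd u))"

instance
proof
  fix u v :: "('a, 'b) dsum" and c :: complex
  show "norm (u * v) \<le> norm u * norm v"
  proof -
    have "norm (dfst u * dfst v) \<le> norm u * norm v"
      by (rule order_trans[OF norm_mult_ineq]) (auto intro!: mult_mono simp: norm_dsum_def le_max_iff_disj)
    moreover have "norm (dsnd u * dsnd v) \<le> norm u * norm v"
      by (rule order_trans[OF norm_mult_ineq]) (auto intro!: mult_mono simp: norm_dsum_def le_max_iff_disj)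
    ultimately show ?thesis
      by (simp add: norm_dsum_def[of "DSum _ _"] times_dsum_def)
  qed
  show "norm (c *\<^sub>C u) = cmod c * norm u"
    by (simp add: norm_dsum_def scaleC_dsum_def norm_scaleC max_mult_distrib_left)
  show "norm (star u * u) = (norm u)\<^sup>2"
    by (auto simp: norm_dsum_def star_dsum_def times_dsum_def cstar_identity max_def
        intro: power_mono antisym dest: power2_le_imp_le)
qed (simp_all add: zero_dsum_def plus_dsum_def one_dsum_def times_dsum_def scaleC_dsum_def
    star_dsum_def scaleR_dsum_def norm_dsum_def algebra_simps scaleC_add_right scaleC_add_left
    scaleC_scaleC scaleC_of_real mult_scaleC_left mult_scaleC_right star_star star_add
    star_scaleC star_mult)

end

definition dsum_set :: "'a set \<Rightarrow> 'b set \<Rightarrow> ('a, 'b) dsum set"  (infixr \<open>\<oplus>\<^sub>d\<close> 65)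
  where "S \<oplus>\<^sub>d T = {DSum x y | x y. x \<in> S \<and> y \<in> T}"


section \<open>Positivity and operator systems\<close>

definition positive_elem :: "'a::unital_cstar_algebra \<Rightarrow> bool"
  where "positive_elem a \<longleftrightarrow> (\<exists>b. a = star b * b)"

definition mat_star :: "'a::unital_cstar_algebra mat \<Rightarrow> 'a mat"
  where "mat_star B = map_mat star (transpose_mat B)"

text \<open>The factor \<open>B\<close> ranges over matrices with entries in the whole C*-algebra, so a matrix over an
  operator system is positive iff it is so in the ambient C*-algebra of matrices.\<close>

definition positive_mat :: "nat \<Rightarrow> 'a::unital_cstar_algebra mat \<Rightarrow> bool"
  where "positive_mat n P \<longleftrightarrow> (\<exists>B \<in> carrier_mat n n. P = mat_star B * B)"

definition mat_over :: "nat \<Rightarrow> 'a set \<Rightarrow> 'a mat set"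
  where "mat_over n X = {P \<in> carrier_mat n n. elements_mat P \<subseteq> X}"

definition operator_system :: "'a::unital_cstar_algebra set \<Rightarrow> bool"
  where "operator_system X \<longleftrightarrow>
    closed X \<and> 1 \<in> X \<and> (\<forall>x\<in>X. star x \<in> X) \<and>
    (\<forall>x\<in>X. \<forall>y\<in>X. x + y \<in> X) \<and> (\<forall>c. \<forall>x\<in>X. c *\<^sub>C x \<in> X)"

definition sa_part :: "'a::unital_cstar_algebra set \<Rightarrow> 'a set"
  where "sa_part X = {x \<in> X. star x = x}"


section \<open>Maps between operator systems\<close>

definition clinear_on :: "'a::unital_cstar_algebra set \<Rightarrow> ('a \<Rightarrow> 'b::unital_cstar_algebra) \<Rightarrow> bool"
  where "clinear_on X \<Phi> \<longleftrightarrow>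
    (\<forall>x\<in>X. \<forall>y\<in>X. \<Phi> (x + y) = \<Phi> x + \<Phi> y) \<and> (\<forall>c. \<forall>x\<in>X. \<Phi> (c *\<^sub>C x) = c *\<^sub>C \<Phi> x)"

definition n_positive_on ::
    "nat \<Rightarrow> 'a::unital_cstar_algebra set \<Rightarrow> ('a \<Rightarrow> 'b::unital_cstar_algebra) \<Rightarrow> bool"
  where "n_positive_on n X \<Phi> \<longleftrightarrow>
    (\<forall>P \<in> mat_over n X. positive_mat n P \<longrightarrow> positive_mat n (map_mat \<Phi> P))"

definition completely_positive_on ::
    "'a::unital_cstar_algebra set \<Rightarrow> ('a \<Rightarrow> 'b::unital_cstar_algebra) \<Rightarrow> bool"
  where "completely_positive_on X \<Phi> \<longleftrightarrow> (\<forall>m\<ge>1. n_positive_on m X \<Phi>)"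

definition unital_n_order_iso ::
    "nat \<Rightarrow> 'a::unital_cstar_algebra set \<Rightarrow> 'b::unital_cstar_algebra set \<Rightarrow> ('a \<Rightarrow> 'b) \<Rightarrow> bool"
  where "unital_n_order_iso n X Y \<Phi> \<longleftrightarrow>
    bij_betw \<Phi> X Y \<and> clinear_on X \<Phi> \<and> \<Phi> 1 = 1 \<and>
    (\<forall>m\<in>{1..n}. n_positive_on m X \<Phi> \<and> n_positive_on m Y (inv_into X \<Phi>))"

definition unital_complete_order_iso ::
    "'a::unital_cstar_algebra set \<Rightarrow> 'b::unital_cstar_algebra set \<Rightarrow> ('a \<Rightarrow> 'b) \<Rightarrow> bool"
  where "unital_complete_order_iso X Y \<Phi> \<longleftrightarrow>
    bij_betw \<Phi> X Y \<and> clinear_on X \<Phi> \<and> \<Phi> 1 = 1 \<and>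
    completely_positive_on X \<Phi> \<and> completely_positive_on Y (inv_into X \<Phi>)"


section \<open>Matrix-valued u.c.p. maps\<close>

text \<open>For \<open>\<phi> : X \<rightarrow> M\<^sub>n\<close> and a matrix \<open>P\<close> in \<open>M\<^sub>m(X)\<close>, this is the image of \<open>P\<close> under
  \<open>id\<^sub>m \<otimes> \<phi>\<close>, with \<open>M\<^sub>m(M\<^sub>n)\<close> identified with \<open>M\<^sub>m\<^sub>n\<close> by erasing the block structure.\<close>

definition block_amplify ::
    "nat \<Rightarrow> nat \<Rightarrow> ('a \<Rightarrow> complex mat) \<Rightarrow> 'a mat \<Rightarrow> complex mat"
  where "block_amplify m n \<phi> P =
    mat (m * n) (m * n) (\<lambda>(i, j). \<phi> (P $$ (i div n, j div n)) $$ (i mod n, j mod n))"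

text \<open>Elements of \<open>UCP n X\<close> are extensional, so that two of them are equal iff they agree on \<open>X\<close>.\<close>

definition UCP :: "nat \<Rightarrow> 'a::unital_cstar_algebra set \<Rightarrow> ('a \<Rightarrow> complex mat) set"
  where "UCP n X = {\<phi> \<in> X \<rightarrow>\<^sub>E carrier_mat n n.
    (\<forall>x\<in>X. \<forall>y\<in>X. \<phi> (x + y) = \<phi> x + \<phi> y) \<and>
    (\<forall>c. \<forall>x\<in>X. \<phi> (c *\<^sub>C x) = c \<cdot>\<^sub>m \<phi> x) \<and>
    \<phi> 1 = 1\<^sub>m n \<and>
    (\<forall>m\<ge>1. \<forall>P \<in> mat_over m X. positive_mat m P \<longrightarrow> positive_mat (m * n) (block_amplify m n \<phi> P))}"

definition l2_norm :: "complex vec \<Rightarrow> real"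
  where "l2_norm v = L2_set (\<lambda>i. cmod (v $ i)) {..<dim_vec v}"

definition op_norm :: "complex mat \<Rightarrow> real"
  where "op_norm A = (SUP v \<in> {v \<in> carrier_vec (dim_col A). l2_norm v \<le> 1}. l2_norm (A *\<^sub>v v))"


section \<open>Lip-norms\<close>

text \<open>A Lip-norm is a function on the whole type together with its domain \<open>D\<close>; its values
  outside \<open>D\<close> are irrelevant.\<close>

definition unit_lip_ball :: "'a set \<Rightarrow> ('a \<Rightarrow> real) \<Rightarrow> 'a set"
  where "unit_lip_ball D L = {a \<in> D. L a \<le> 1}"

definition state_space :: "'a::unital_cstar_algebra set \<Rightarrow> ('a \<Rightarrow> real) set"
  where "state_space D = {\<mu> \<in> extensional D.
    (\<forall>a\<in>D. \<forall>b\<in>D. \<mu> (a + b) = \<mu> a + \<mu> b) \<and>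
    (\<forall>r. \<forall>a\<in>D. \<mu> (r *\<^sub>R a) = r * \<mu> a) \<and>
    \<mu> 1 = 1 \<and>
    (\<forall>a\<in>D. positive_elem a \<longrightarrow> 0 \<le> \<mu> a)}"

definition weak_star_topology :: "'a::unital_cstar_algebra set \<Rightarrow> ('a \<Rightarrow> real) topology"
  where "weak_star_topology D =
    subtopology (product_topology (\<lambda>_. euclideanreal) D) (state_space D)"

text \<open>Distances are valued in \<open>ennreal\<close>, where every supremum and infimum exists; a Lip-norm is
  required to give finite distances, so that \<open>enn2real\<close> loses nothing below.\<close>

definition lip_dist :: "'a set \<Rightarrow> ('a \<Rightarrow> real) \<Rightarrow> ('a \<Rightarrow> real) \<Rightarrow> ('a \<Rightarrow> real) \<Rightarrow> ennreal"
  where "lip_dist D L \<mu> \<nu> = (SUP a \<in> unit_lip_ball D L. ennreal \<bar>\<mu> a - \<nu> a\<bar>)"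

definition seminorm_on :: "'a::real_vector set \<Rightarrow> ('a \<Rightarrow> real) \<Rightarrow> bool"
  where "seminorm_on D L \<longleftrightarrow>
    (\<forall>a\<in>D. 0 \<le> L a) \<and>
    (\<forall>a\<in>D. \<forall>b\<in>D. L (a + b) \<le> L a + L b) \<and>
    (\<forall>r. \<forall>a\<in>D. L (r *\<^sub>R a) = \<bar>r\<bar> * L a)"

definition lip_norm_on :: "'a::unital_cstar_algebra set \<Rightarrow> ('a \<Rightarrow> real) \<Rightarrow> bool"
  where "lip_norm_on D L \<longleftrightarrow>
    seminorm_on D L \<and>
    (\<forall>a\<in>D. L a = 0 \<longleftrightarrow> a \<in> range (\<lambda>r. r *\<^sub>R 1)) \<and>
    (\<forall>\<mu>\<in>state_space D. \<forall>\<nu>\<in>state_space D. lip_dist D L \<mu> \<nu> < \<infinity>) \<and>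
    Metric_space (state_space D) (\<lambda>\<mu> \<nu>. enn2real (lip_dist D L \<mu> \<nu>)) \<and>
    Metric_space.mtopology (state_space D) (\<lambda>\<mu> \<nu>. enn2real (lip_dist D L \<mu> \<nu>)) =
      weak_star_topology D"

definition lip_normed_operator_system ::
    "'a::unital_cstar_algebra set \<Rightarrow> 'a set \<Rightarrow> ('a \<Rightarrow> real) \<Rightarrow> bool"
  where "lip_normed_operator_system X D L \<longleftrightarrow>
    operator_system X \<and>
    subspace D \<and> 1 \<in> D \<and> D \<subseteq> sa_part X \<and> sa_part X \<subseteq> closure D \<and>
    lip_norm_on D L \<and>
    closedin (top_of_set (sa_part X)) (unit_lip_ball D L)"


section \<open>Quantum Gromov-Hausdorff distances\<close>

definition ucp_dist ::
    "'a set \<Rightarrow> ('a \<Rightarrow> real) \<Rightarrow> ('a \<Rightarrow> complex mat) \<Rightarrow> ('a \<Rightarrow> complex mat) \<Rightarrow> ennreal"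
  where "ucp_dist D L \<phi> \<psi> = (SUP x \<in> unit_lip_ball D L. ennreal (op_norm (\<phi> x - \<psi> x)))"

definition hausdorff_dist :: "('p \<Rightarrow> 'p \<Rightarrow> ennreal) \<Rightarrow> 'p set \<Rightarrow> 'p set \<Rightarrow> ennreal"
  where "hausdorff_dist \<rho> A B =
    max (SUP a\<in>A. INF b\<in>B. \<rho> a b) (SUP b\<in>B. INF a\<in>A. \<rho> a b)"

definition admissible_lip_norms ::
    "'a::unital_cstar_algebra set \<Rightarrow> 'a set \<Rightarrow> ('a \<Rightarrow> real) \<Rightarrow>
     'b::unital_cstar_algebra set \<Rightarrow> 'b set \<Rightarrow> ('b \<Rightarrow> real) \<Rightarrow> (('a, 'b) dsum \<Rightarrow> real) set"
  where "admissible_lip_norms X D\<^sub>X L\<^sub>X Y D\<^sub>Y L\<^sub>Y = {L.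
    lip_norm_on (D\<^sub>X \<oplus>\<^sub>d D\<^sub>Y) L \<and>
    closedin (top_of_set (sa_part (X \<oplus>\<^sub>d Y))) (unit_lip_ball (D\<^sub>X \<oplus>\<^sub>d D\<^sub>Y) L) \<and>
    (\<forall>x\<in>D\<^sub>X. L\<^sub>X x = (INF y\<in>D\<^sub>Y. L (DSum x y))) \<and>
    (\<forall>y\<in>D\<^sub>Y. L\<^sub>Y y = (INF x\<in>D\<^sub>X. L (DSum x y)))}"

definition UCP_fst ::
    "nat \<Rightarrow> 'a::unital_cstar_algebra set \<Rightarrow> 'b::unital_cstar_algebra set \<Rightarrow>
     (('a, 'b) dsum \<Rightarrow> complex mat) set"
  where "UCP_fst n X Y = (\<lambda>\<phi>. restrict (\<phi> \<circ> dfst) (X \<oplus>\<^sub>d Y)) ` UCP n X"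

definition UCP_snd ::
    "nat \<Rightarrow> 'a::unital_cstar_algebra set \<Rightarrow> 'b::unital_cstar_algebra set \<Rightarrow>
     (('a, 'b) dsum \<Rightarrow> complex mat) set"
  where "UCP_snd n X Y = (\<lambda>\<psi>. restrict (\<psi> \<circ> dsnd) (X \<oplus>\<^sub>d Y)) ` UCP n Y"

definition dist_s_n ::
    "nat \<Rightarrow> 'a::unital_cstar_algebra set \<Rightarrow> 'a set \<Rightarrow> ('a \<Rightarrow> real) \<Rightarrow>
     'b::unital_cstar_algebra set \<Rightarrow> 'b set \<Rightarrow> ('b \<Rightarrow> real) \<Rightarrow> ennreal"
  where "dist_s_n n X D\<^sub>X L\<^sub>X Y D\<^sub>Y L\<^sub>Y =
    (INF L \<in> admissible_lip_norms X D\<^sub>X L\<^sub>X Y D\<^sub>Y L\<^sub>Y.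
       hausdorff_dist (ucp_dist (D\<^sub>X \<oplus>\<^sub>d D\<^sub>Y) L) (UCP_fst n X Y) (UCP_snd n X Y))"

definition dist_s ::
    "'a::unital_cstar_algebra set \<Rightarrow> 'a set \<Rightarrow> ('a \<Rightarrow> real) \<Rightarrow>
     'b::unital_cstar_algebra set \<Rightarrow> 'b set \<Rightarrow> ('b \<Rightarrow> real) \<Rightarrow> ennreal"
  where "dist_s X D\<^sub>X L\<^sub>X Y D\<^sub>Y L\<^sub>Y =
    (INF L \<in> admissible_lip_norms X D\<^sub>X L\<^sub>X Y D\<^sub>Y L\<^sub>Y.
       SUP n\<in>{1..}. hausdorff_dist (ucp_dist (D\<^sub>X \<oplus>\<^sub>d D\<^sub>Y) L) (UCP_fst n X Y) (UCP_snd n X Y))"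


section \<open>Lip-isometries\<close>

definition lip_isometric :: "'a set \<Rightarrow> ('a \<Rightarrow> real) \<Rightarrow> 'b set \<Rightarrow> ('b \<Rightarrow> real) \<Rightarrow> ('a \<Rightarrow> 'b) \<Rightarrow> bool"
  where "lip_isometric D\<^sub>X L\<^sub>X D\<^sub>Y L\<^sub>Y \<Phi> \<longleftrightarrow>
    \<Phi> ` D\<^sub>X \<subseteq> D\<^sub>Y \<and> (\<forall>x\<in>D\<^sub>X. L\<^sub>Y (\<Phi> x) = L\<^sub>X x)"

definition bi_lip_isometric ::
    "'a set \<Rightarrow> 'a set \<Rightarrow> ('a \<Rightarrow> real) \<Rightarrow> 'b set \<Rightarrow> ('b \<Rightarrow> real) \<Rightarrow> ('a \<Rightarrow> 'b) \<Rightarrow> bool"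
  where "bi_lip_isometric X D\<^sub>X L\<^sub>X D\<^sub>Y L\<^sub>Y \<Phi> \<longleftrightarrow>
    lip_isometric D\<^sub>X L\<^sub>X D\<^sub>Y L\<^sub>Y \<Phi> \<and> lip_isometric D\<^sub>Y L\<^sub>Y D\<^sub>X L\<^sub>X (inv_into X \<Phi>)"

end

theory Submission
  imports Defs
begin

text \<open>
Both directions compare \<open>X\<close> and \<open>Y\<close> through elements \<open>(x, y)\<close> of the direct sum that are \<^emph>\<open>matched\<close>,
which means that \<open>L (x, y)\<close> is bounded in terms of the Lip-norms of \<open>x\<close> and \<open>y\<close>.

Suppose that for every \<open>k\<close> there is an admissible \<open>L\<^sub>k\<close> for which the sets of u.c.p. maps are within
\<open>1 / (k + 1)\<close> of each other. States are u.c.p. maps and compute norms, so matched elements have nearly the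
same norm, and two elements matched with the same \<open>x\<close> nearly coincide. Choose for each \<open>x\<close> in the domain
of the Lip-norm a matched \<open>y\<^sub>k x\<close>, and for each \<open>y\<close> a matched \<open>x\<^sub>k y\<close>. A Lip-norm has the property that
its balls of bounded norm are compact (\<open>lip_norm_compact\<close>), so all these choices lie in compact
sets that do not depend on \<open>k\<close>, and Tychonoff's theorem provides a common cluster point of both
families. The limits are linear, isometric, inverse to each other and preserve the Lip-norms; by density
they extend to \<open>X\<close> and \<open>Y\<close>. If \<open>\<psi>\<close> is u.c.p. on \<open>Y\<close>, then \<open>\<psi> \<circ> \<Phi>\<close> is a pointwise limit of
u.c.p. maps on \<open>X\<close>, hence completely positive. Since u.c.p. maps into \<open>M\<^sub>n\<close> detect positivity of \<open>m \<times> m\<close>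
matrices for \<open>m \<le> n\<close> (\<open>positive_mat_if_UCP\<close>), the limit \<open>\<Phi>\<close> is \<open>m\<close>-positive. This is
\<open>order_iso_if_small_distances\<close>; the set \<open>N\<close> there is \<open>{n}\<close> for the first claim and all of the positive
integers for the second.

Conversely, let \<open>\<Phi>\<close> be an isomorphism and \<open>e > 0\<close>. The seminorm
\<open>max (L x) (L' y) (\<parallel>\<Phi> x - y\<parallel> / e)\<close> is admissible: its quotients are attained at \<open>y = \<Phi> x\<close>, and its
unit ball is compact modulo scalars, which makes it a Lip-norm (\<open>lip_norm_onI\<close>). Composition with
\<open>\<Phi>\<close> and its inverse moves u.c.p. maps by at most \<open>e\<close>. The compositions are u.c.p. although \<open>\<Phi>\<close>
may be only \<open>n\<close>-positive, because an \<open>n\<close>-positive map into \<open>M\<^sub>n\<close> is completely positive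
(\<open>UCP_comp_n_positive\<close>).

The positivity theory behind this is developed without spectral theory. A self-adjoint \<open>h\<close> is positive
iff \<open>\<parallel>t - h\<parallel> \<le> t\<close> for some \<open>t\<close>. This describes a convex cone, whose elements have square roots given
by the binomial series of \<open>sqrt (1 - x)\<close>, which converges absolutely up to the boundary. The main point is
that it contains every \<open>x\<^sup>* x\<close> (\<open>norm_positive_selfmult\<close>). A matrix \<open>P\<close> over the algebra is of the form
\<open>B\<^sup>* B\<close> iff all \<open>\<Sum> \<xi>\<^sub>i\<^sup>* P\<^sub>i\<^sub>j \<xi>\<^sub>j\<close> are positive (\<open>positive_mat_iff_weakly_positive\<close>); this turns questions
about matrix positivity into questions about sums of elements and avoids norms on matrix algebras.
\<close>

section \<open>Involution and square roots in a unital C*-algebra\<close>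

lemma star_zero [simp]: "star 0 = (0::'a::unital_cstar_algebra)"
  using star_add[of "0::'a" 0] by simp

lemma star_one [simp]: "star 1 = (1::'a::unital_cstar_algebra)"
  by (metis mult.right_neutral star_mult star_star)

lemma star_minus: "star (- x) = - star (x::'a::unital_cstar_algebra)"
  using star_add[of x "- x"] by (simp add: eq_neg_iff_add_eq_0 add.commute)

lemma star_diff: "star (x - y) = star x - star (y::'a::unital_cstar_algebra)"
  using star_add[of x "- y"] by (simp add: star_minus)

lemma star_scaleR: "star (r *\<^sub>R x) = r *\<^sub>R star (x::'a::unital_cstar_algebra)"
  using star_scaleC[of "complex_of_real r" x] by (simp add: scaleC_of_real)

lemma norm_star [simp]: "norm (star x) = norm (x::'a::unital_cstar_algebra)"
proof -
  have le: "norm y \<le> norm (star y)" for y :: 'a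
  proof (cases "y = 0")
    case False
    have "norm y * norm y \<le> norm (star y) * norm y"
      using norm_mult_ineq[of "star y" y] by (simp add: cstar_identity power2_eq_square)
    then show ?thesis using False by simp
  qed simp
  show ?thesis using le[of x] le[of "star x"] by (simp add: star_star)
qed

lemma bounded_linear_star: "bounded_linear (star :: 'a::unital_cstar_algebra \<Rightarrow> 'a)"
  by (rule bounded_linear_intro[where K=1]) (simp_all add: star_add star_scaleR)

lemma star_power: "star (x ^ n) = star (x::'a::unital_cstar_algebra) ^ n"
  by (induction n) (simp_all add: star_mult power_commutes)

lemma star_sum: "star (sum f A) = (\<Sum>i\<in>A. star (f i :: 'a::unital_cstar_algebra))"
  by (rule Real_Vector_Spaces.linear_sum) (rule bounded_linear.linear[OF bounded_linear_star])

lemma scaleC_zero_right [simp]: "c *\<^sub>C 0 = (0::'a::unital_cstar_algebra)"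
  using scaleC_add_right[of c "0::'a" 0] by simp

lemma scaleC_zero_left [simp]: "0 *\<^sub>C x = (0::'a::unital_cstar_algebra)"
  using scaleC_of_real[of 0 x] by simp

lemma scaleC_one [simp]: "1 *\<^sub>C x = (x::'a::unital_cstar_algebra)"
  using scaleC_of_real[of 1 x] by simp

lemma scaleC_minus_right: "c *\<^sub>C (- x) = - (c *\<^sub>C (x::'a::unital_cstar_algebra))"
  using scaleC_add_right[of c x "- x"] by (simp add: eq_neg_iff_add_eq_0 add.commute)

lemma scaleC_minus_left: "(- c) *\<^sub>C x = - (c *\<^sub>C (x::'a::unital_cstar_algebra))"
  using scaleC_add_left[of c "- c" x] by (simp add: eq_neg_iff_add_eq_0 add.commute)

lemma scaleC_diff_right: "c *\<^sub>C (x - y) = c *\<^sub>C x - c *\<^sub>C (y::'a::unital_cstar_algebra)"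
  using scaleC_add_right[of c x "- y"] by (simp add: scaleC_minus_right)

lemma bounded_linear_scaleC: "bounded_linear (\<lambda>x::'a::unital_cstar_algebra. c *\<^sub>C x)"
  by (rule bounded_linear_intro[where K="cmod c"])
    (simp_all add: scaleC_add_right norm_scaleC mult.commute scaleC_scaleC flip: scaleC_of_real)

text \<open>The Taylor coefficients of \<open>\<lambda>x. sqrt (1 - x)\<close>. Their absolute summability is what makes the
  series converge even at norm \<open>1\<close>, where the square root is needed.\<close>

definition sqrt_coeff :: "nat \<Rightarrow> real"
  where "sqrt_coeff k = (1/2 gchoose k) * (- 1) ^ k"

lemma sqrt_coeff_0: "sqrt_coeff 0 = 1"
  by (simp add: sqrt_coeff_def)

lemma sqrt_coeff_convolution:
  "(\<Sum>i\<le>n. sqrt_coeff i * sqrt_coeff (n - i)) = (if n = 0 then 1 else if n = 1 then - 1 else 0)"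
proof -
  have "(\<Sum>i\<le>n. sqrt_coeff i * sqrt_coeff (n - i))
      = (\<Sum>i\<le>n. (1/2 gchoose i) * (1/2 gchoose (n - i)) * (- 1) ^ n)"
    by (intro sum.cong refl) (auto simp: sqrt_coeff_def power_add[symmetric])
  also have "\<dots> = ((1::real) gchoose n) * (- 1) ^ n"
    using gbinomial_Vandermonde[of "1/2::real" "1/2" n] by (simp add: sum_distrib_right[symmetric] atLeast0AtMost)
  also have "\<dots> = (if n = 0 then 1 else if n = 1 then - 1 else 0)"
  proof (cases "n \<le> 1")
    case False
    have "((1::real) gchoose n) = of_nat (1 choose n)"
      using binomial_gbinomial[of 1 n, where ?'a=real] by simp
    then show ?thesis using False by simp
  qed (auto simp: le_Suc_eq)
  finally show ?thesis .
qed


lemma sqrt_coeff_pochhammer: "sqrt_coeff k = pochhammer (- 1/2) k / fact k"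
  by (simp add: sqrt_coeff_def gbinomial_pochhammer flip: power_add power_mult_distrib)

lemma sqrt_coeff_nonpos: "sqrt_coeff (Suc k) \<le> 0"
proof -
  have "pochhammer (- 1/2 :: real) (Suc k) = (- 1/2) * pochhammer (1/2) k"
    by (simp add: pochhammer_rec)
  moreover have "0 \<le> pochhammer (1/2 :: real) k"
    by (simp add: pochhammer_nonneg)
  ultimately show ?thesis
    by (simp add: sqrt_coeff_pochhammer divide_nonpos_pos)
qed

text \<open>From index \<open>1\<close> on the coefficients have constant sign, and the partial sums
  \<open>(1 - 1/2) (1 - 1/4) \<cdots> (1 - 1/(2m))\<close> of the series at \<open>1\<close> are nonnegative; so the absolute values
  sum up to at most \<open>2\<close>.\<close>

lemma summable_sqrt_coeff: "summable (\<lambda>k. \<bar>sqrt_coeff k\<bar>)"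
proof (rule summableI_nonneg_bounded[where x=2])
  fix n
  have partial: "0 \<le> (\<Sum>k\<le>m. sqrt_coeff k)" for m
  proof -
    have "(\<Sum>k\<le>m. sqrt_coeff k) = (- 1) ^ m * (- 1/2 gchoose m)"
      using gbinomial_sum_lower_neg[of "1/2::real" m] by (simp add: sqrt_coeff_def)
    also have "\<dots> = pochhammer (1/2) m / fact m"
      by (simp add: gbinomial_pochhammer flip: power_add power_mult_distrib)
    finally show ?thesis
      by (simp add: pochhammer_nonneg)
  qed
  have "(\<Sum>k<n. \<bar>sqrt_coeff k\<bar>) \<le> (\<Sum>k\<le>n. \<bar>sqrt_coeff k\<bar>)"
    by (rule sum_mono2) auto
  also have "\<dots> = (\<Sum>k\<le>n. (if k = 0 then 2 else 0) - sqrt_coeff k)"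
    by (intro sum.cong refl) (auto simp: sqrt_coeff_0 abs_of_nonpos sqrt_coeff_nonpos gr0_conv_Suc)
  also have "\<dots> \<le> 2"
    using partial[of n] by (simp add: sum_subtractf)
  finally show "(\<Sum>k<n. \<bar>sqrt_coeff k\<bar>) \<le> 2" .
qed simp

text \<open>That the root commutes with everything that commutes with \<open>q\<close> allows roots of commuting elements
  to be multiplied.\<close>

lemma sqrt_of_one_minus:
  fixes q :: "'a::unital_cstar_algebra"
  assumes "norm q \<le> 1" and "star q = q"
  obtains s where "star s = s" "s * s = 1 - q" "\<And>y. y * q = q * y \<Longrightarrow> y * s = s * y"
proof -
  define f where "f k = sqrt_coeff k *\<^sub>R q ^ k" for k
  define s where "s = suminf f"
  have "norm (f k) \<le> \<bar>sqrt_coeff k\<bar>" for k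
    using norm_power_ineq[of q k] power_le_one[OF norm_ge_zero assms(1), of k]
    by (auto simp: f_def intro!: mult_left_le)
  then have norm_f: "summable (\<lambda>k. norm (f k))"
    by (intro summable_comparison_test[OF _ summable_sqrt_coeff]) auto
  then have f: "summable f"
    by (rule summable_norm_cancel)
  have "star (f k) = f k" for k
    by (simp add: f_def star_scaleR star_power assms)
  then have "star s = s"
    using bounded_linear.suminf[OF bounded_linear_star f] by (simp add: s_def)
  moreover have "s * s = 1 - q"
  proof -
    define g where "g n = (if n = 0 then 1 else if n = 1 then - q else 0)" for n :: nat
    have "(\<Sum>i\<le>n. f i * f (n - i)) = (\<Sum>i\<le>n. sqrt_coeff i * sqrt_coeff (n - i)) *\<^sub>R q ^ n" for n
      unfolding f_def scaleR_sum_left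
      by (intro sum.cong refl) (simp add: power_add[symmetric])
    then have "(\<Sum>i\<le>n. f i * f (n - i)) = g n" for n
      by (simp add: sqrt_coeff_convolution g_def)
    then have "g sums (s * s)"
      using Cauchy_product_sums[OF norm_f norm_f] by (simp add: s_def)
    moreover have "g sums (\<Sum>n\<in>{0,1}. g n)"
      by (rule sums_finite) (auto simp: g_def)
    ultimately have "s * s = (\<Sum>n\<in>{0,1}. g n)"
      by (rule sums_unique2)
    then show ?thesis by (simp add: g_def)
  qed
  moreover have "y * s = s * y" if "y * q = q * y" for y
  proof -
    have "y * q ^ k = q ^ k * y" for k
      by (induction k) (simp_all add: mult.assoc that, metis mult.assoc that)
    then have "y * f k = f k * y" for k
      by (simp add: f_def)
    then show ?thesis
      using suminf_mult[OF f, of y] suminf_mult2[OF f, of y] by (simp add: s_def)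
  qed
  ultimately show thesis by (rule that)
qed

section \<open>Positive elements of a C*-algebra\<close>

text \<open>For a self-adjoint \<open>h\<close> the condition says that the spectrum of \<open>h\<close> lies in \<open>[0, 2t]\<close>. Stated
  with the norm, it makes the convexity of the cone evident and feeds the binomial series directly.\<close>

definition norm_positive :: "'a::unital_cstar_algebra \<Rightarrow> bool"
  where "norm_positive h \<longleftrightarrow> star h = h \<and> (\<exists>t\<ge>0. norm (t *\<^sub>R 1 - h) \<le> t)"

lemma norm_positive_sa: "norm_positive h \<Longrightarrow> star h = h"
  by (simp add: norm_positive_def)

lemma norm_positive_add:
  assumes "norm_positive h" "norm_positive k"
  shows "norm_positive (h + k)"
proof -
  from assms obtain s t where "s \<ge> 0" "t \<ge> 0" "norm (s *\<^sub>R 1 - h) \<le> s" "norm (t *\<^sub>R 1 - k) \<le> t"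
    by (auto simp: norm_positive_def)
  moreover have "norm ((s + t) *\<^sub>R 1 - (h + k)) \<le> norm (s *\<^sub>R 1 - h) + norm (t *\<^sub>R 1 - k)"
    using norm_triangle_ineq[of "s *\<^sub>R 1 - h" "t *\<^sub>R 1 - k"] by (simp add: algebra_simps)
  ultimately show ?thesis
    using assms by (auto simp: norm_positive_def star_add intro!: exI[of _ "s + t"])
qed

lemma norm_positive_scaleR:
  assumes "norm_positive h" "0 \<le> r"
  shows "norm_positive (r *\<^sub>R h)"
proof -
  from assms obtain s where s: "s \<ge> 0" "norm (s *\<^sub>R 1 - h) \<le> s"
    by (auto simp: norm_positive_def)
  have "(r * s) *\<^sub>R 1 - r *\<^sub>R h = r *\<^sub>R (s *\<^sub>R 1 - h)"
    by (simp add: scaleR_diff_right)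
  then have "norm ((r * s) *\<^sub>R 1 - r *\<^sub>R h) \<le> r * s"
    using s assms by (simp add: mult_left_mono)
  then show ?thesis
    using assms s by (auto simp: norm_positive_def star_scaleR intro!: exI[of _ "r * s"])
qed

lemma norm_positive_shift:
  assumes "star h = h" "norm h \<le> t"
  shows "norm_positive (t *\<^sub>R 1 + h)"
  unfolding norm_positive_def
proof (intro conjI exI[of _ t])
  show "0 \<le> t" using assms norm_ge_zero order_trans by blast
qed (use assms in \<open>simp_all add: star_add star_scaleR\<close>)

lemma norm_positive_scalar: "norm_positive (r *\<^sub>R (1::'a::unital_cstar_algebra)) \<longleftrightarrow> 0 \<le> r"
proof -
  have "norm (t *\<^sub>R (1::'a) - r *\<^sub>R 1) = \<bar>t - r\<bar>" for t
    by (metis norm_scaleR norm_one mult.right_neutral scaleR_left_diff_distrib)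
  then show ?thesis
    by (auto simp: norm_positive_def star_scaleR intro!: exI[of _ r])
qed

lemma norm_positive_sqrt:
  fixes h :: "'a::unital_cstar_algebra"
  assumes "norm_positive h"
  obtains s where "star s = s" "s * s = h" "\<And>y. y * h = h * y \<Longrightarrow> y * s = s * y"
proof -
  from assms obtain t where t: "t \<ge> 0" "norm (t *\<^sub>R 1 - h) \<le> t" and h: "star h = h"
    by (auto simp: norm_positive_def)
  show thesis
  proof (cases "t = 0")
    case True
    then show ?thesis using t that[of 0] by simp
  next
    case False
    then have pos: "t > 0" using t by simp
    define q where "q = 1 - inverse t *\<^sub>R h"
    have "t *\<^sub>R q = t *\<^sub>R 1 - h"
      using pos by (simp add: q_def scaleR_diff_right)
    then have "t * norm q \<le> t"
      using t pos by (metis abs_of_pos norm_scaleR)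
    then have "norm q \<le> 1" using pos by simp
    moreover have "star q = q" by (simp add: q_def star_diff star_scaleR h)
    ultimately obtain s where s: "star s = s" "s * s = 1 - q" "\<And>y. y * q = q * y \<Longrightarrow> y * s = s * y"
      using sqrt_of_one_minus by metis
    show ?thesis
    proof (rule that[of "sqrt t *\<^sub>R s"])
      show "star (sqrt t *\<^sub>R s) = sqrt t *\<^sub>R s" by (simp add: star_scaleR s)
      show "sqrt t *\<^sub>R s * sqrt t *\<^sub>R s = h" using pos by (simp add: s q_def mult.assoc[symmetric])
      fix y assume "y * h = h * y"
      then have "y * q = q * y" by (simp add: q_def algebra_simps)
      then show "y * sqrt t *\<^sub>R s = sqrt t *\<^sub>R s * y" by (simp add: s)
    qed
  qed
qed

text \<open>For commuting self-adjoint \<open>s\<close> and \<open>c\<close> the element \<open>s + \<i> c\<close> is normal, with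
  \<open>(s + \<i> c)\<^sup>* (s + \<i> c) = s\<^sup>2 + c\<^sup>2\<close>; this turns norm estimates of sums of squares into the
  C*-identity.\<close>

lemma norm_normal_sum:
  fixes s c :: "'a::unital_cstar_algebra"
  assumes "star s = s" "star c = c" "s * c = c * s"
  shows "(norm (s + \<i> *\<^sub>C c))\<^sup>2 = norm (s * s + c * c)"
proof -
  have "star (s + \<i> *\<^sub>C c) * (s + \<i> *\<^sub>C c) = s * s + c * c"
    using assms by (simp add: star_add star_scaleC algebra_simps mult_scaleC_left mult_scaleC_right
        scaleC_scaleC scaleC_minus_left scaleC_minus_right scaleC_diff_right scaleC_add_right)
  then show ?thesis using cstar_identity[of "s + \<i> *\<^sub>C c"] by simp
qed

lemma norm_sa_part_le:
  fixes s c :: "'a::unital_cstar_algebra"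
  assumes "star s = s" "star c = c"
  shows "norm s \<le> norm (s + \<i> *\<^sub>C c)" "norm c \<le> norm (s + \<i> *\<^sub>C c)"
proof -
  let ?u = "s + \<i> *\<^sub>C c"
  have u: "star ?u = s - \<i> *\<^sub>C c"
    by (simp add: star_add star_scaleC scaleC_minus_left assms)
  have "norm (?u + star ?u) \<le> 2 * norm ?u"
    using norm_triangle_ineq[of ?u "star ?u"] unfolding norm_star by simp
  moreover have "?u + star ?u = 2 *\<^sub>R s" by (simp add: u scaleR_2)
  ultimately show "norm s \<le> norm ?u" by simp
  have "norm (?u - star ?u) \<le> 2 * norm ?u"
    using norm_triangle_ineq4[of ?u "star ?u"] unfolding norm_star by simp
  moreover have "?u - star ?u = 2 *\<^sub>R \<i> *\<^sub>C c" by (simp add: u scaleR_2)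
  ultimately show "norm c \<le> norm ?u" by (simp add: norm_scaleC)
qed

lemma norm_sa_square: "star s = s \<Longrightarrow> norm (s * s) = (norm (s::'a::unital_cstar_algebra))\<^sup>2"
  using cstar_identity[of s] by simp

text \<open>If \<open>\<parallel>s\<parallel> \<le> 1\<close>, then \<open>s + \<i> sqrt (1 - s\<^sup>2)\<close> is unitary, so the square root has norm at
  most \<open>1\<close>.\<close>

lemma norm_one_minus_square:
  fixes s :: "'a::unital_cstar_algebra"
  assumes "star s = s" "norm s \<le> 1"
  shows "norm (1 - s * s) \<le> 1"
proof -
  have "norm (s * s) \<le> 1"
    using assms by (simp add: norm_sa_square power_le_one)
  moreover have "star (s * s) = s * s" by (simp add: star_mult assms)
  ultimately obtain c where c: "star c = c" "c * c = 1 - s * s"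
    and comm: "\<And>y. y * (s * s) = (s * s) * y \<Longrightarrow> y * c = c * y"
    using sqrt_of_one_minus by metis
  have "s * c = c * s" by (rule comm) (simp add: mult.assoc)
  then have "(norm (s + \<i> *\<^sub>C c))\<^sup>2 = 1"
    using norm_normal_sum[OF assms(1) c(1)] c by simp
  then have "norm (s + \<i> *\<^sub>C c) = 1" by (simp add: power2_eq_1_iff)
      (metis norm_ge_zero not_one_le_zero le_minus_one_simps(3))
  then have "norm c \<le> 1"
    using norm_sa_part_le(2)[OF assms(1) c(1)] by simp
  then show ?thesis
    using c norm_sa_square[OF c(1)] by (simp add: power_le_one)
qed

lemma norm_positive_square_norm:
  fixes s :: "'a::unital_cstar_algebra"
  assumes "star s = s"
  shows "norm (norm (s * s) *\<^sub>R 1 - s * s) \<le> norm (s * s)"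
proof (cases "s = 0")
  case False
  define u where "u = inverse (norm s) *\<^sub>R s"
  have s: "s = norm s *\<^sub>R u" using False by (simp add: u_def)
  have "norm (1 - u * u) \<le> 1"
    by (rule norm_one_minus_square) (auto simp: u_def star_scaleR assms False)
  moreover have "norm (s * s) *\<^sub>R 1 - s * s = (norm s)\<^sup>2 *\<^sub>R (1 - u * u)"
    by (subst (3 4) s) (simp add: norm_sa_square assms power2_eq_square scaleR_diff_right)
  ultimately show ?thesis
    by (simp add: norm_sa_square assms mult_left_le)
qed simp

lemma norm_positive_square: "star s = s \<Longrightarrow> norm_positive (s * s)"
  unfolding norm_positive_def using norm_positive_square_norm[of s]
  by (metis norm_ge_zero star_mult)

text \<open>The choice \<open>t = \<parallel>h\<parallel>\<close> always works. This removes the existential quantifier, and with it the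
  obstacle to closedness of the cone.\<close>

lemma norm_positive_iff_norm: "norm_positive h \<longleftrightarrow> star h = h \<and> norm (norm h *\<^sub>R 1 - h) \<le> norm h"
  by (metis norm_ge_zero norm_positive_def norm_positive_sqrt norm_positive_square_norm)

lemma closed_norm_positive: "closed {h::'a::unital_cstar_algebra. norm_positive h}"
  unfolding norm_positive_iff_norm
  by (intro closed_Collect_conj closed_Collect_eq closed_Collect_le continuous_intros
      bounded_linear.continuous_on[OF bounded_linear_star])

lemma norm_positive_commuting_mult:
  fixes h k :: "'a::unital_cstar_algebra"
  assumes "norm_positive h" "norm_positive k" "h * k = k * h"
  shows "norm_positive (h * k)"
proof -
  obtain s where s: "star s = s" "s * s = h" "\<And>y. y * h = h * y \<Longrightarrow> y * s = s * y"
    using norm_positive_sqrt[OF assms(1)] by blast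
  obtain r where r: "star r = r" "r * r = k" "\<And>y. y * k = k * y \<Longrightarrow> y * r = r * y"
    using norm_positive_sqrt[OF assms(2)] by blast
  have "k * s = s * k" using s(3)[of k] assms(3) by simp
  then have sr: "s * r = r * s" using r(3)[of s] by simp
  then have "star (s * r) = s * r" by (simp add: star_mult s r)
  moreover have "(s * r) * (s * r) = h * k"
    by (metis mult.assoc r(2) s(2) sr)
  ultimately show ?thesis using norm_positive_square by metis
qed

lemma norm_positive_power: "norm_positive (h::'a::unital_cstar_algebra) \<Longrightarrow> norm_positive (h ^ n)"
proof (induction n)
  case 0
  then show ?case using norm_positive_scalar[of 1, where ?'a='a] by simp
next
  case (Suc n)
  then show ?case by (simp add: norm_positive_commuting_mult power_commutes)
qed

text \<open>If \<open>- c \<le> h \<le> c\<close>, then \<open>c\<^sup>2 - h\<^sup>2 = (c - h) (c + h)\<close> has a square root \<open>r\<close>, and \<open>h + \<i> r\<close> has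
  norm \<open>c\<close>.\<close>

lemma norm_le_if_norm_positive:
  fixes h :: "'a::unital_cstar_algebra"
  assumes "norm_positive (c *\<^sub>R 1 - h)" "norm_positive (c *\<^sub>R 1 + h)"
  shows "norm h \<le> c"
proof -
  have "(c *\<^sub>R 1 - h) + (c *\<^sub>R 1 + h) = (2 * c) *\<^sub>R 1"
    by (simp add: scaleR_add_left[symmetric])
  then have "norm_positive ((2 * c) *\<^sub>R (1::'a))"
    using norm_positive_add[OF assms] by simp
  then have c: "c \<ge> 0" unfolding norm_positive_scalar by simp
  have h: "star h = h"
    using norm_positive_sa[OF assms(2)] by (simp add: star_add star_scaleR)
  have eq: "(c *\<^sub>R 1 - h) * (c *\<^sub>R 1 + h) = c\<^sup>2 *\<^sub>R 1 - h * h"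
    by (simp add: algebra_simps power2_eq_square)
  have "norm_positive (c\<^sup>2 *\<^sub>R 1 - h * h)"
    using norm_positive_commuting_mult[OF assms] unfolding eq by (simp add: algebra_simps power2_eq_square)
  then obtain r where r: "star r = r" "r * r = c\<^sup>2 *\<^sub>R 1 - h * h"
    "\<And>y. y * (c\<^sup>2 *\<^sub>R 1 - h * h) = (c\<^sup>2 *\<^sub>R 1 - h * h) * y \<Longrightarrow> y * r = r * y"
    using norm_positive_sqrt by metis
  have "h * r = r * h" by (rule r(3)) (simp add: algebra_simps)
  then have "(norm (h + \<i> *\<^sub>C r))\<^sup>2 = c\<^sup>2"
    using norm_normal_sum[OF h r(1)] by (simp add: r)
  then have "norm (h + \<i> *\<^sub>C r) = c" using c by simp
  then show ?thesis using norm_sa_part_le(1)[OF h r(1)] by simp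
qed

lemma norm_sa_power:
  assumes "star h = (h::'a::unital_cstar_algebra)"
  shows "norm (h ^ (2 ^ j)) = norm h ^ (2 ^ j)"
proof (induction j)
  case (Suc j)
  have "h ^ (2 ^ Suc j) = h ^ (2 ^ j) * h ^ (2 ^ j)"
    by (simp add: power_add[symmetric] mult_2)
  also have "norm \<dots> = (norm (h ^ (2 ^ j)))\<^sup>2"
    by (rule norm_sa_square) (simp add: star_power assms)
  finally show ?case by (simp add: Suc power_mult[symmetric] mult.commute)
qed simp

text \<open>The elements \<open>b (1 - b)\<^sup>j\<close> decrease with \<open>j\<close>, and those with \<open>j < n\<close> sum up to
  \<open>1 - (1 - b)\<^sup>n \<le> 1\<close>.\<close>

lemma norm_mult_power_one_minus:
  fixes b :: "'a::unital_cstar_algebra"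
  assumes b: "norm_positive b" and "norm b \<le> 1"
  shows "norm_positive (b * (1 - b) ^ n)" and "n > 0 \<Longrightarrow> norm (b * (1 - b) ^ n) \<le> 1 / n"
proof -
  let ?h = "1 - b" and ?f = "\<lambda>n. b * (1 - b) ^ n"
  have sb: "star b = b" using b by (rule norm_positive_sa)
  have h: "norm_positive ?h"
    using norm_positive_shift[of "- b" 1] assms sb by (simp add: star_minus)
  have comm: "b * ?h ^ n = ?h ^ n * b" for n
    by (rule power_commuting_commutes[symmetric]) (simp add: algebra_simps)
  show f: "norm_positive (?f n)" for n
    by (intro norm_positive_commuting_mult norm_positive_power b h comm)
  have diff: "norm_positive (?f n - ?f (Suc n))" for n
  proof -
    have "?f n - ?f (Suc n) = b * ?f n"
      using comm[of n] by (simp add: algebra_simps power_commutes)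
    moreover have "b * ?f n = ?f n * b" by (simp add: comm mult.assoc[symmetric])
    ultimately show ?thesis using norm_positive_commuting_mult[OF b f] by simp
  qed
  have "norm_positive (1 - ?h ^ n - real n *\<^sub>R ?f n)" for n
  proof (induction n)
    case (Suc n)
    have "1 - ?h ^ Suc n - real (Suc n) *\<^sub>R ?f (Suc n)
        = (1 - ?h ^ n - real n *\<^sub>R ?f n) + real (Suc n) *\<^sub>R (?f n - ?f (Suc n))"
      by (simp add: algebra_simps)
    then show ?case
      using norm_positive_add[OF Suc norm_positive_scaleR[OF diff, of "real (Suc n)"]]
      by (simp only:)
  qed (use norm_positive_scalar[of 0, where ?'a='a] in simp)
  from norm_positive_add[OF this[of n] norm_positive_power[OF h, of n]]
  have le: "norm_positive (1 - real n *\<^sub>R ?f n)" by simp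
  assume n: "n > 0"
  have "norm_positive ((1 / n) *\<^sub>R 1 - ?f n)"
    using norm_positive_scaleR[OF le, of "1 / n"] n by (simp add: scaleR_diff_right)
  moreover have "norm_positive ((1 / n) *\<^sub>R 1 + ?f n)"
    by (intro norm_positive_add f) (simp add: norm_positive_scalar)
  ultimately show "norm (?f n) \<le> 1 / n" by (rule norm_le_if_norm_positive)
qed

text \<open>The smallest \<open>t\<close> with \<open>t + a \<ge> 0\<close> plays the role of minus the least point of the spectrum of
  \<open>a\<close>, and the powers of \<open>1 - b\<close> are approximate eigenvectors there: they have norm one, but
  multiplication by \<open>b = (t + a) / T\<close> makes them small.\<close>

lemma approximate_eigenvector:
  fixes a :: "'a::unital_cstar_algebra"
  assumes a: "star a = a" and neg: "\<not> norm_positive a"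
  obtains t where "t > 0" "\<And>T j b v. \<lbrakk>t + norm a \<le> T; b = inverse T *\<^sub>R (t *\<^sub>R 1 + a); v = (1 - b) ^ 2 ^ j\<rbrakk>
     \<Longrightarrow> norm (v * v) = 1 \<and> norm (b * (v * v)) \<le> 1 / 2 ^ j"
proof -
  define S where "S = {t. 0 \<le> t \<and> norm_positive (t *\<^sub>R 1 + a)}"
  have "closed {t. norm_positive (t *\<^sub>R 1 + a)}"
    using closed_vimage[OF closed_norm_positive, of "\<lambda>t. t *\<^sub>R 1 + a"]
    by (simp add: vimage_def continuous_intros)
  then have "closed S"
    unfolding S_def by (intro closed_Collect_conj closed_Collect_le continuous_intros)
  moreover have "norm a \<in> S" using norm_positive_shift[OF a order_refl] by (simp add: S_def)
  moreover have bdd: "bdd_below S" by (auto simp: S_def bdd_below_def)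
  ultimately have "Inf S \<in> S" by (intro closed_contains_Inf) auto
  moreover define t where "t = Inf S"
  ultimately have t: "0 \<le> t" "norm_positive (t *\<^sub>R 1 + a)" by (auto simp: S_def)
  have least: "\<not> norm_positive (s *\<^sub>R 1 + a)" if "0 \<le> s" "s < t" for s
    using cInf_lower[OF _ bdd, of s] that by (auto simp: S_def t_def)
  have "t \<noteq> 0" using t neg by auto
  then have "t > 0" using t by simp
  moreover have "norm (v * v) = 1 \<and> norm (b * (v * v)) \<le> 1 / 2 ^ j"
    if T: "t + norm a \<le> T" and b: "b = inverse T *\<^sub>R (t *\<^sub>R 1 + a)" and v: "v = (1 - b) ^ 2 ^ j"
    for T j b v
  proof -
    have T0: "T > 0" using \<open>t > 0\<close> T norm_ge_zero[of a] by linarith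
    have pb: "norm_positive b"
      unfolding b using t T0 by (intro norm_positive_scaleR) auto
    have "norm (t *\<^sub>R 1 + a) \<le> T"
      using norm_triangle_ineq[of "t *\<^sub>R 1" a] T t by simp
    then have nb: "norm b \<le> 1" using T0 by (simp add: b divide_simps del: scaleR_right.add scaleR_add_right)
    have sb: "star b = b" using pb by (rule norm_positive_sa)
    have "norm (1 - b) \<le> 1"
    proof -
      have "norm ((1 - norm b) *\<^sub>R 1 + (norm b *\<^sub>R 1 - b)) \<le> (1 - norm b) + norm b"
        using pb nb by (intro norm_triangle_le add_mono) (auto simp: norm_positive_iff_norm)
      then show ?thesis by (simp add: algebra_simps)
    qed
    moreover have "\<not> norm (1 - b) < 1"
    proof
      assume less: "norm (1 - b) < 1"
      define \<kappa> where "\<kappa> = 1 - norm (1 - b)"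
      have "norm_positive (b - \<kappa> *\<^sub>R 1)"
        unfolding norm_positive_def
        by (intro conjI exI[of _ "1 - \<kappa>"]) (simp_all add: star_diff star_add star_scaleR sb \<kappa>_def algebra_simps)
      then have "norm_positive (T *\<^sub>R (b - \<kappa> *\<^sub>R 1))"
        using T0 by (intro norm_positive_scaleR) auto
      moreover have "T *\<^sub>R (b - \<kappa> *\<^sub>R 1) = (t - T * \<kappa>) *\<^sub>R 1 + a"
        using T0 by (simp add: b algebra_simps)
      ultimately have shift: "norm_positive ((t - T * \<kappa>) *\<^sub>R 1 + a)" by simp
      have "T * \<kappa> > 0" using T0 less by (simp add: \<kappa>_def)
      show False
      proof (cases "T * \<kappa> \<le> t")
        case True
        then show False using least[of "t - T * \<kappa>"] shift \<open>T * \<kappa> > 0\<close> by simp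
      next
        case False
        then have "norm_positive ((T * \<kappa> - t) *\<^sub>R 1 + ((t - T * \<kappa>) *\<^sub>R 1 + a))"
          by (intro norm_positive_add shift) (simp add: norm_positive_scalar)
        then have "norm_positive a" by (simp add: algebra_simps)
        then show False using neg by simp
      qed
    qed
    ultimately have n1: "norm (1 - b) = 1" by simp
    have vv: "v * v = (1 - b) ^ 2 ^ Suc j"
      by (simp add: v power_add[symmetric] mult_2)
    have "star (1 - b) = 1 - b" by (simp add: star_diff sb)
    then have "norm (v * v) = 1" unfolding vv by (simp only: norm_sa_power n1 power_one)
    moreover have "norm (b * (v * v)) \<le> 1 / 2 ^ j"
      using norm_mult_power_one_minus(2)[OF pb nb, of "2 ^ Suc j"] unfolding vv
      by (rule order_trans) (simp_all add: field_simps)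
    ultimately show ?thesis by simp
  qed
  ultimately show thesis by (rule that)
qed


lemma norm_selfmult_swap: "norm (y * star y) = norm (star y * (y::'a::unital_cstar_algebra))"
  using cstar_identity[of "star y"] cstar_identity[of y] by (simp add: star_star)

text \<open>The spectra of \<open>y y\<^sup>*\<close> and \<open>y\<^sup>* y\<close> have the same negative part. Were \<open>y\<^sup>* y\<close> to reach further
  down than \<open>- \<eta>\<close>, then multiplying \<open>y\<close> by approximate eigenvectors \<open>v\<close> would give elements with
  \<open>(y v)\<^sup>* (y v)\<close> bounded away from \<open>0\<close>, while \<open>(y v) (y v)\<^sup>*\<close> tends to \<open>0\<close> because
  \<open>y p(y\<^sup>* y) = p(y y\<^sup>*) y\<close> for every polynomial \<open>p\<close>.\<close>

lemma norm_positive_swap: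
  fixes y :: "'a::unital_cstar_algebra"
  assumes pos: "norm_positive (\<eta> *\<^sub>R 1 + y * star y)" and \<eta>: "\<eta> \<ge> 0"
  shows "norm_positive (\<eta> *\<^sub>R 1 + star y * y)"
proof (rule ccontr)
  define c where "c = star y * y"
  define d where "d = y * star y"
  define M where "M = norm c"
  have M: "norm d = M" by (simp add: M_def c_def d_def norm_selfmult_swap)
  have sc: "star c = c" and sd: "star d = d" by (simp_all add: c_def d_def star_mult star_star)
  assume "\<not> norm_positive (\<eta> *\<^sub>R 1 + star y * y)"
  moreover have "star (\<eta> *\<^sub>R 1 + c) = \<eta> *\<^sub>R 1 + c" by (simp add: star_add star_scaleR sc)
  ultimately obtain t where t: "t > 0" and
    v: "\<And>T j b v. \<lbrakk>t + norm (\<eta> *\<^sub>R 1 + c) \<le> T; b = inverse T *\<^sub>R (t *\<^sub>R 1 + (\<eta> *\<^sub>R 1 + c)); v = (1 - b) ^ 2 ^ j\<rbrakk>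
     \<Longrightarrow> norm (v * v) = 1 \<and> norm (b * (v * v)) \<le> 1 / 2 ^ j"
    using approximate_eigenvector[of "\<eta> *\<^sub>R 1 + c"] unfolding c_def by metis
  define T where "T = t + \<eta> + M"
  have T0: "T > 0" using t \<eta> by (simp add: T_def M_def add_pos_nonneg)
  have T: "t + norm (\<eta> *\<^sub>R 1 + c) \<le> T"
    using norm_triangle_ineq[of "\<eta> *\<^sub>R 1" c] \<eta> by (simp add: T_def M_def)
  define b where "b = inverse T *\<^sub>R (t *\<^sub>R 1 + (\<eta> *\<^sub>R 1 + c))"
  define b' where "b' = inverse T *\<^sub>R (t *\<^sub>R 1 + (\<eta> *\<^sub>R 1 + d))"
  have inter: "y * (1 - b) ^ k = (1 - b') ^ k * y" for k
  proof (induction k)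
    case (Suc k)
    have "y * (1 - b) = (1 - b') * y"
      by (simp add: b_def b'_def c_def d_def algebra_simps)
    then have "y * (1 - b) ^ Suc k = (1 - b') * (y * (1 - b) ^ k)"
      by (simp add: mult.assoc[symmetric])
    then show ?case by (simp add: Suc mult.assoc)
  qed simp
  have sb: "star (1 - b) = 1 - b" by (simp add: b_def star_diff star_scaleR star_add sc)
  define \<rho> where "\<rho> = (M + \<eta>) / T"
  have M0: "M \<ge> 0" by (simp add: M_def)
  have \<rho>: "0 \<le> \<rho>" "\<rho> < 1"
    using t \<eta> T0 M0 by (simp_all add: \<rho>_def) (simp add: T_def)
  have nb': "norm (1 - b') \<le> \<rho>"
  proof -
    have "norm_positive ((M + \<eta>) *\<^sub>R 1 - (M *\<^sub>R 1 - d))"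
      using pos by (simp add: d_def algebra_simps)
    moreover have "norm_positive (M *\<^sub>R 1 - d)"
      using norm_positive_shift[of "- d" M] by (simp add: M star_minus sd)
    then have "norm_positive ((M + \<eta>) *\<^sub>R 1 + (M *\<^sub>R 1 - d))"
      by (rule norm_positive_add[rotated]) (use \<eta> M0 in \<open>simp add: norm_positive_scalar\<close>)
    ultimately have "norm (M *\<^sub>R 1 - d) \<le> M + \<eta>" by (rule norm_le_if_norm_positive)
    moreover have "T *\<^sub>R b' = t *\<^sub>R 1 + (\<eta> *\<^sub>R 1 + d)"
      using T0 by (simp add: b'_def)
    then have "M *\<^sub>R 1 - d = T *\<^sub>R (1 - b')"
      by (simp add: scaleR_diff_right) (simp add: T_def scaleR_add_left)
    then have "norm (M *\<^sub>R 1 - d) = T * norm (1 - b')"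
      using T0 by (metis abs_of_pos norm_scaleR)
    ultimately show ?thesis using T0 by (simp add: \<rho>_def field_simps)
  qed
  have "t - T / 2 ^ j \<le> M * \<rho> ^ j" for j
  proof -
    define v where "v = (1 - b) ^ 2 ^ j"
    have norms: "norm (v * v) = 1" "norm (b * (v * v)) \<le> 1 / 2 ^ j"
      using v[OF T b_def v_def] by auto
    have sv: "star v = v" by (simp add: v_def star_power sb)
    have "c * (1 - b) = (1 - b) * c" by (simp add: b_def algebra_simps)
    then have cv: "c * v = v * c"
      unfolding v_def by (metis power_commuting_commutes)
    have "star (y * v) * (y * v) = c * (v * v)"
      by (metis c_def cv mult.assoc star_mult sv)
    moreover have "norm (c * (v * v)) \<ge> t - T / 2 ^ j"
    proof -
      have "T *\<^sub>R (b * (v * v)) = (t *\<^sub>R 1 + (\<eta> *\<^sub>R 1 + c)) * (v * v)"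
        using T0 by (simp add: b_def)
      then have "(t + \<eta>) *\<^sub>R (v * v) = T *\<^sub>R (b * (v * v)) - c * (v * v)"
        by (simp add: algebra_simps)
      then have "norm ((t + \<eta>) *\<^sub>R (v * v)) \<le> norm (T *\<^sub>R (b * (v * v))) + norm (c * (v * v))"
        using norm_triangle_ineq4 by metis
      moreover have "norm (T *\<^sub>R (b * (v * v))) \<le> T * (1 / 2 ^ j)"
        using mult_left_mono[OF norms(2), of T] T0 by simp
      ultimately show ?thesis using norms t \<eta> by simp
    qed
    moreover have "(y * v) * star (y * v) = ((1 - b') ^ (2 ^ j + 2 ^ j)) * d"
    proof -
      have "(y * v) * star (y * v) = (y * (v * v)) * star y"
        by (simp add: star_mult sv mult.assoc)
      also have "v * v = (1 - b) ^ (2 ^ j + 2 ^ j)" by (simp add: v_def power_add)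
      finally show ?thesis by (simp only: inter) (simp add: d_def mult.assoc)
    qed
    moreover have "norm (((1 - b') ^ (2 ^ j + 2 ^ j)) * d) \<le> \<rho> ^ j * M"
    proof -
      have "j \<le> 2 ^ j + (2::nat) ^ j" using less_exp[of j] by linarith
      then have "\<rho> ^ (2 ^ j + 2 ^ j) \<le> \<rho> ^ j"
        using \<rho> by (intro power_decreasing) auto
      moreover have "norm ((1 - b') ^ (2 ^ j + 2 ^ j)) \<le> \<rho> ^ (2 ^ j + 2 ^ j)"
        by (rule order_trans[OF norm_power_ineq]) (intro power_mono nb' norm_ge_zero)
      ultimately show ?thesis
        by (intro norm_mult_ineq[THEN order_trans] mult_mono) (auto simp: M M0 \<rho>)
    qed
    ultimately show ?thesis
      using norm_selfmult_swap[of "y * v"] by (simp add: mult.commute)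
  qed
  moreover have "(\<lambda>j. t - T / 2 ^ j) \<longlonglongrightarrow> t - 0"
    by (intro tendsto_diff tendsto_const LIMSEQ_divide_realpow_zero) auto
  moreover have "(\<lambda>j. M * \<rho> ^ j) \<longlonglongrightarrow> M * 0"
    using \<rho> by (intro tendsto_mult tendsto_const LIMSEQ_power_zero) auto
  ultimately have "t - 0 \<le> M * 0" by (intro LIMSEQ_le) auto
  then show False using t by simp
qed

lemma sa_decomposition:
  fixes x :: "'a::unital_cstar_algebra"
  obtains h k where "star h = h" "star k = k" "x = h + \<i> *\<^sub>C k"
    "h = (1/2) *\<^sub>R (x + star x)" "k = (- \<i> / 2) *\<^sub>C (x - star x)"
proof -
  define h where "h = (1/2) *\<^sub>R (x + star x)"
  define k where "k = (- \<i> / 2) *\<^sub>C (x - star x)"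
  have "star h = h" by (simp add: h_def star_add star_scaleR star_star add.commute)
  moreover have "star k = k"
    by (simp add: k_def star_scaleC star_diff star_star scaleC_diff_right scaleC_minus_left)
  moreover have "\<i> *\<^sub>C k = (1/2) *\<^sub>R (x - star x)"
    by (simp add: k_def scaleC_scaleC flip: scaleC_of_real)
  then have "x = h + \<i> *\<^sub>C k"
    by (simp add: h_def scaleR_add_right[symmetric])
  ultimately show thesis using that h_def k_def by blast
qed

text \<open>Were \<open>a = x\<^sup>* x\<close> not positive, an approximate eigenvector \<open>v\<close> at the bottom of its spectrum would
  make \<open>y\<^sup>* y = v a v\<close>, for \<open>y = x v\<close>, almost equal to \<open>- t v\<^sup>2\<close>. This is almost negative; hence
  \<open>y y\<^sup>*\<close> is almost positive, by \<open>norm_positive_swap\<close> so is \<open>y\<^sup>* y\<close>, and \<open>y\<^sup>* y\<close> is almost \<open>0\<close>.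
  But \<open>t v\<^sup>2\<close> has norm \<open>t > 0\<close>.\<close>

theorem norm_positive_selfmult: "norm_positive (star x * (x::'a::unital_cstar_algebra))"
proof (rule ccontr)
  define a where "a = star x * x"
  have sa: "star a = a" by (simp add: a_def star_mult star_star)
  assume "\<not> norm_positive (star x * x)"
  then obtain t where t: "t > 0" and
    v: "\<And>T j b v. \<lbrakk>t + norm a \<le> T; b = inverse T *\<^sub>R (t *\<^sub>R 1 + a); v = (1 - b) ^ 2 ^ j\<rbrakk>
     \<Longrightarrow> norm (v * v) = 1 \<and> norm (b * (v * v)) \<le> 1 / 2 ^ j"
    using approximate_eigenvector[OF sa] unfolding a_def by metis
  define T where "T = t + norm a"
  have T0: "T > 0" using t by (simp add: T_def add_pos_nonneg)
  define b where "b = inverse T *\<^sub>R (t *\<^sub>R 1 + a)"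
  have sb: "star b = b" by (simp add: b_def star_scaleR star_add sa)
  have "t - T / 2 ^ j \<le> T / 2 ^ j" for j
  proof -
    define v where "v = (1 - b) ^ 2 ^ j"
    define \<eta> where "\<eta> = T / 2 ^ j"
    have norms: "norm (v * v) = 1" "norm (b * (v * v)) \<le> 1 / 2 ^ j"
      using v[OF _ b_def v_def] by (auto simp: T_def)
    have sv: "star v = v" by (simp add: v_def star_power star_diff sb)
    have "a * (1 - b) = (1 - b) * a" by (simp add: b_def algebra_simps)
    then have av: "a * v = v * a" unfolding v_def by (metis power_commuting_commutes)
    have "b * (1 - b) = (1 - b) * b" by (simp add: algebra_simps)
    then have bv: "b * v = v * b" unfolding v_def by (metis power_commuting_commutes)
    define y where "y = x * v"
    have yy: "star y * y = a * (v * v)"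
      unfolding y_def by (metis a_def av mult.assoc star_mult sv)
    have "T *\<^sub>R (b * (v * v)) = (t *\<^sub>R 1 + a) * (v * v)"
      using T0 by (simp add: b_def)
    then have split: "a * (v * v) = T *\<^sub>R (b * (v * v)) - t *\<^sub>R (v * v)"
      by (simp add: algebra_simps)
    have n: "norm (T *\<^sub>R (b * (v * v))) \<le> \<eta>"
      using mult_left_mono[OF norms(2), of T] T0 by (simp add: \<eta>_def)
    have s: "star (T *\<^sub>R (b * (v * v))) = T *\<^sub>R (b * (v * v))"
      by (simp add: star_scaleR star_mult sv sb) (metis bv mult.assoc)
    have "norm_positive (\<eta> *\<^sub>R 1 - T *\<^sub>R (b * (v * v)))"
      using norm_positive_shift[of "- (T *\<^sub>R (b * (v * v)))" \<eta>] n s by (simp add: star_minus)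
    moreover have "norm_positive (t *\<^sub>R (v * v))"
      using t by (intro norm_positive_scaleR norm_positive_square sv) auto
    ultimately have "norm_positive ((\<eta> *\<^sub>R 1 - T *\<^sub>R (b * (v * v))) + t *\<^sub>R (v * v))"
      by (rule norm_positive_add)
    then have upper: "norm_positive (\<eta> *\<^sub>R 1 - star y * y)"
      by (simp add: yy split algebra_simps)
    \<comment> \<open>Since \<open>y y\<^sup>* + y\<^sup>* y = 2 h\<^sup>2 + 2 k\<^sup>2\<close> for \<open>y = h + \<i> k\<close>, an upper bound on \<open>y\<^sup>* y\<close> is a lower
      bound on \<open>y y\<^sup>*\<close>.\<close>
    obtain h k where hk: "star h = h" "star k = k" "y = h + \<i> *\<^sub>C k"
      using sa_decomposition by metis
    have "star y = h - \<i> *\<^sub>C k" by (simp add: hk star_add star_scaleC scaleC_minus_left)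
    then have "y * star y + star y * y
        = (h + \<i> *\<^sub>C k) * (h - \<i> *\<^sub>C k) + (h - \<i> *\<^sub>C k) * (h + \<i> *\<^sub>C k)"
      by (simp only: hk(3))
    then have sum: "y * star y + star y * y = 2 *\<^sub>R (h * h + k * k)"
      by (simp add: algebra_simps scaleR_2 mult_scaleC_left mult_scaleC_right scaleC_scaleC
          scaleC_minus_left scaleC_minus_right scaleC_diff_right scaleC_add_right)
    have "norm_positive (2 *\<^sub>R (h * h + k * k))"
      by (intro norm_positive_scaleR norm_positive_add norm_positive_square hk) auto
    then have "norm_positive (y * star y + star y * y + (\<eta> *\<^sub>R 1 - star y * y))"
      unfolding sum using upper by (rule norm_positive_add)
    then have "norm_positive (\<eta> *\<^sub>R 1 + y * star y)" by (simp add: algebra_simps)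
    then have "norm_positive (\<eta> *\<^sub>R 1 + star y * y)"
      by (rule norm_positive_swap) (use T0 in \<open>simp add: \<eta>_def\<close>)
    with upper have "norm (star y * y) \<le> \<eta>" by (rule norm_le_if_norm_positive)
    moreover have "t \<le> norm (T *\<^sub>R (b * (v * v))) + norm (star y * y)"
    proof -
      have "t *\<^sub>R (v * v) = T *\<^sub>R (b * (v * v)) - star y * y" by (simp add: yy split)
      then show ?thesis
        using norm_triangle_ineq4[of "T *\<^sub>R (b * (v * v))" "star y * y"] norms t
        by (metis abs_of_pos mult.right_neutral norm_scaleR)
    qed
    ultimately show ?thesis using n by (simp add: \<eta>_def)
  qed
  moreover have "(\<lambda>j. t - T / 2 ^ j) \<longlonglongrightarrow> t - 0"
    by (intro tendsto_diff tendsto_const LIMSEQ_divide_realpow_zero) auto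
  moreover have "(\<lambda>j. T / 2 ^ j) \<longlonglongrightarrow> 0"
    by (rule LIMSEQ_divide_realpow_zero) simp
  ultimately have "t - 0 \<le> 0" by (intro LIMSEQ_le) auto
  then show False using t by simp
qed

lemma positive_elem_iff_norm_positive: "positive_elem a \<longleftrightarrow> norm_positive a"
  unfolding positive_elem_def
  by (metis norm_positive_selfmult norm_positive_sqrt)

lemma positive_elem_sa: "positive_elem h \<Longrightarrow> star h = h"
  by (simp add: positive_elem_iff_norm_positive norm_positive_sa)

lemma positive_elem_add: "positive_elem h \<Longrightarrow> positive_elem k \<Longrightarrow> positive_elem (h + k)"
  by (simp add: positive_elem_iff_norm_positive norm_positive_add)

lemma positive_elem_zero [simp]: "positive_elem 0"
  unfolding positive_elem_def by (rule exI[of _ 0]) simp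

lemma positive_elem_sum: "(\<And>i. i \<in> I \<Longrightarrow> positive_elem (f i)) \<Longrightarrow> positive_elem (sum f I)"
  by (induction I rule: infinite_finite_induct) (auto intro: positive_elem_add)

lemma positive_elem_scaleR: "positive_elem h \<Longrightarrow> 0 \<le> r \<Longrightarrow> positive_elem (r *\<^sub>R h)"
  by (simp add: positive_elem_iff_norm_positive norm_positive_scaleR)

lemma positive_elem_shift: "star h = h \<Longrightarrow> norm h \<le> t \<Longrightarrow> positive_elem (t *\<^sub>R 1 + h)"
  by (simp add: positive_elem_iff_norm_positive norm_positive_shift)

lemma positive_elem_shift_minus: "star h = h \<Longrightarrow> norm h \<le> t \<Longrightarrow> positive_elem (t *\<^sub>R 1 - h)"
  using positive_elem_shift[of "- h" t] by (simp add: star_minus)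

lemma positive_elem_scalar: "positive_elem (r *\<^sub>R (1::'a::unital_cstar_algebra)) \<longleftrightarrow> 0 \<le> r"
  by (simp add: positive_elem_iff_norm_positive norm_positive_scalar)

lemma closed_positive_elem: "closed {h::'a::unital_cstar_algebra. positive_elem h}"
  by (simp add: positive_elem_iff_norm_positive closed_norm_positive)

lemma norm_le_if_positive_elem:
  "positive_elem (c *\<^sub>R 1 - h) \<Longrightarrow> positive_elem (c *\<^sub>R 1 + h) \<Longrightarrow> norm h \<le> c"
  by (simp add: positive_elem_iff_norm_positive norm_le_if_norm_positive)

lemma positive_elem_sandwich:
  assumes "positive_elem h" shows "positive_elem (star x * h * x)"
proof -
  from assms obtain b where "h = star b * b" by (auto simp: positive_elem_def)
  then have "star x * h * x = star (b * x) * (b * x)" by (simp add: star_mult mult.assoc)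
  then show ?thesis unfolding positive_elem_def by blast
qed

section \<open>States\<close>

text \<open>The Hahn--Banach theorem, by way of minimal sublinear functionals: for such a \<open>q\<close> and every
  \<open>y\<close>, the functional \<open>\<lambda>x. INF t. q (x + t y) - t q y\<close> is sublinear and below \<open>q\<close>, hence
  equal to \<open>q\<close>, and that makes \<open>q\<close> additive.\<close>

definition sublinear :: "('a::real_vector \<Rightarrow> real) \<Rightarrow> bool"
  where "sublinear p \<longleftrightarrow> (\<forall>x y. p (x + y) \<le> p x + p y) \<and> (\<forall>r\<ge>0. \<forall>x. p (r *\<^sub>R x) = r * p x)"

lemma sublinear_lower: "sublinear p \<Longrightarrow> - p (- x) \<le> p x"
proof -
  assume p: "sublinear p"
  then have "p (0 *\<^sub>R x) = 0 * p x" "p (x + - x) \<le> p x + p (- x)"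
    unfolding sublinear_def by (blast, blast)
  then show ?thesis by simp
qed

lemma sublinearD:
  assumes "sublinear p"
  shows "p (x + y) \<le> p x + p y" "r \<ge> 0 \<Longrightarrow> p (r *\<^sub>R x) = r * p x"
  using assms unfolding sublinear_def by auto

definition sublinear_slide :: "('a::real_vector \<Rightarrow> real) \<Rightarrow> 'a \<Rightarrow> 'a \<Rightarrow> real"
  where "sublinear_slide q y x = (INF t\<in>{0..}. q (x + t *\<^sub>R y) - t * q y)"

lemma sublinear_slide_bound:
  assumes q: "sublinear q" and "t \<ge> 0"
  shows "- q (- x) \<le> q (x + t *\<^sub>R y) - t * q y"
proof -
  have "q (x + t *\<^sub>R y + - x) \<le> q (x + t *\<^sub>R y) + q (- x)" by (rule sublinearD[OF q])
  then show ?thesis using sublinearD(2)[OF q assms(2), of y] by simp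
qed

lemma sublinear_slide_le:
  assumes q: "sublinear q" and "t \<ge> 0"
  shows "sublinear_slide q y x \<le> q (x + t *\<^sub>R y) - t * q y"
  unfolding sublinear_slide_def
  by (rule cINF_lower) (use assms sublinear_slide_bound[OF q] in \<open>auto intro!: bdd_belowI2\<close>)

lemma sublinear_slide_greatest:
  "(\<And>t. t \<ge> 0 \<Longrightarrow> m \<le> q (x + t *\<^sub>R y) - t * q y) \<Longrightarrow> m \<le> sublinear_slide q y x"
  unfolding sublinear_slide_def by (rule cINF_greatest) auto

lemma sublinear_slide_sublinear:
  assumes q: "sublinear q"
  shows "sublinear (sublinear_slide q y)"
proof -
  let ?s = "sublinear_slide q y"
  have add: "?s (x + z) \<le> ?s x + ?s z" for x z
  proof -
    have bound: "?s (x + z) \<le> (q (x + t *\<^sub>R y) - t * q y) + (q (z + u *\<^sub>R y) - u * q y)"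
      if that: "t \<ge> 0" "u \<ge> 0" for t u
    proof -
      have "?s (x + z) \<le> q ((x + z) + (t + u) *\<^sub>R y) - (t + u) * q y"
        using that by (intro sublinear_slide_le q) auto
      also have "q ((x + z) + (t + u) *\<^sub>R y) \<le> q (x + t *\<^sub>R y) + q (z + u *\<^sub>R y)"
        using sublinearD(1)[OF q, of "x + t *\<^sub>R y" "z + u *\<^sub>R y"] by (simp add: algebra_simps)
      finally show ?thesis by (simp add: algebra_simps)
    qed
    then have "?s (x + z) - (q (x + t *\<^sub>R y) - t * q y) \<le> ?s z" if "t \<ge> 0" for t
      using bound[OF that] by (intro sublinear_slide_greatest) (simp add: algebra_simps)
    then have "?s (x + z) - ?s z \<le> ?s x"
      by (intro sublinear_slide_greatest) (simp add: algebra_simps)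
    then show ?thesis by simp
  qed
  have scale_le: "?s (r *\<^sub>R x) \<le> r * ?s x" if r: "r > 0" for r x
  proof -
    have "?s (r *\<^sub>R x) / r \<le> q (x + t *\<^sub>R y) - t * q y" if "t \<ge> 0" for t
    proof -
      have "?s (r *\<^sub>R x) \<le> q (r *\<^sub>R x + (r * t) *\<^sub>R y) - (r * t) * q y"
        using r that by (intro sublinear_slide_le q) auto
      also have "q (r *\<^sub>R x + (r * t) *\<^sub>R y) = r * q (x + t *\<^sub>R y)"
        using sublinearD(2)[OF q, of r "x + t *\<^sub>R y"] r by (simp add: scaleR_add_right)
      finally show ?thesis using r by (simp add: field_simps)
    qed
    then have "?s (r *\<^sub>R x) / r \<le> ?s x" by (rule sublinear_slide_greatest)
    then show ?thesis using r by (simp add: field_simps)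
  qed
  have "?s (r *\<^sub>R x) = r * ?s x" if r: "r \<ge> 0" for r x
  proof (cases "r = 0")
    case True
    have q0: "q 0 = 0" using sublinearD(2)[OF q, of 0 0] by simp
    have "?s 0 \<le> 0" using sublinear_slide_le[OF q, of 0 y 0] by (simp add: q0)
    moreover have "0 \<le> ?s 0"
      by (rule sublinear_slide_greatest) (simp add: sublinearD(2)[OF q])
    ultimately show ?thesis using True by simp
  next
    case False
    then have "r > 0" using r by simp
    moreover have "?s x \<le> inverse r * ?s (r *\<^sub>R x)"
      using scale_le[of "inverse r" "r *\<^sub>R x"] \<open>r > 0\<close> by simp
    ultimately show ?thesis using scale_le[of r x] by (simp add: field_simps)
  qed
  with add show ?thesis by (simp add: sublinear_def)
qed

text \<open>Sliding \<open>p\<close> along \<open>x0\<close> before minimising pins down the value at \<open>x0\<close>: it lowers the value at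
  \<open>- x0\<close> to \<open>- p x0\<close>.\<close>

theorem Hahn_Banach_sublinear:
  fixes p :: "'a::real_vector \<Rightarrow> real"
  assumes p: "sublinear p"
  obtains f where "linear f" "\<And>x. f x \<le> p x" "f x0 = p x0"
proof -
  define p0 where "p0 = sublinear_slide p x0"
  have p0: "sublinear p0" unfolding p0_def by (rule sublinear_slide_sublinear[OF p])
  have p0_le: "p0 x \<le> p x" for x
    using sublinear_slide_le[OF p, of 0 x0 x] by (simp add: p0_def)
  have p0_x0: "p0 (- x0) \<le> - p x0"
    using sublinear_slide_le[OF p, of 1 x0 "- x0"] sublinearD(2)[OF p, of 0 0] by (simp add: p0_def)
  define A where "A = {q. sublinear q \<and> q \<le> p0}"
  have "\<exists>m\<in>A. \<forall>a\<in>A. m \<ge> a \<longrightarrow> a = m"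
  proof (rule predicate_Zorn)
    show "partial_order_on A (relation_of (\<ge>) A)"
      by (rule partial_order_on_relation_ofI) auto
    fix C assume C: "C \<in> Chains (relation_of (\<ge>) A)"
    then have CA: "C \<subseteq> A" and tot: "\<And>q r. q \<in> C \<Longrightarrow> r \<in> C \<Longrightarrow> q \<le> r \<or> r \<le> q"
      by (auto simp: Chains_def relation_of_def)
    show "\<exists>u\<in>A. \<forall>a\<in>C. u \<le> a"
    proof (cases "C = {}")
      case True
      then show ?thesis using p0 by (auto simp: A_def intro!: bexI[of _ p0])
    next
      case False
      define u where "u x = (INF q\<in>C. q x)" for x
      have lower: "- p0 (- x) \<le> q x" if "q \<in> C" for q x
      proof -
        have "sublinear q" "q (- x) \<le> p0 (- x)" using that CA by (auto simp: A_def le_fun_def)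
        then show ?thesis using sublinear_lower[of q x] by linarith
      qed
      have bdd: "bdd_below ((\<lambda>q. q x) ` C)" for x
        by (rule bdd_belowI2[of _ "- p0 (- x)"]) (rule lower)
      have u_le: "u x \<le> q x" if "q \<in> C" for q x
        unfolding u_def using that bdd by (rule cINF_lower[rotated])
      have u_ge: "m \<le> u x" if "\<And>q. q \<in> C \<Longrightarrow> m \<le> q x" for m x
        unfolding u_def using False that by (rule cINF_greatest)
      have sub: "sublinear q" if "q \<in> C" for q using that CA by (auto simp: A_def)
      have "u (x + y) \<le> u x + u y" for x y
      proof -
        have bound: "u (x + y) \<le> q x + r y" if qr: "q \<in> C" "r \<in> C" for q r
        proof -
          obtain s where s: "s \<in> C" "s \<le> q" "s \<le> r" using tot[OF qr] qr by blast
          have "u (x + y) \<le> s x + s y"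
            using u_le[OF s(1), of "x + y"] sublinearD(1)[OF sub[OF s(1)], of x y] by linarith
          then show ?thesis using s(2,3) by (smt (verit) le_funD)
        qed
        have "u (x + y) - q x \<le> u y" if "q \<in> C" for q
          using bound[OF that] by (intro u_ge) (simp add: algebra_simps)
        then have "u (x + y) - u y \<le> u x" by (intro u_ge) (simp add: algebra_simps)
        then show ?thesis by simp
      qed
      moreover have "u (r *\<^sub>R x) = r * u x" if "r \<ge> 0" for r x
      proof (rule antisym)
        show "r * u x \<le> u (r *\<^sub>R x)"
          using that by (intro u_ge) (simp add: sublinearD(2)[OF sub] u_le mult_left_mono)
        show "u (r *\<^sub>R x) \<le> r * u x"
        proof (cases "r = 0")
          case True
          obtain q where q: "q \<in> C" using False by blast
          then show ?thesis using u_le[OF q, of 0] sublinearD(2)[OF sub[OF q], of 0 0] True by simp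
        next
          case False
          then have r: "r > 0" using that by simp
          have "u (r *\<^sub>R x) / r \<le> q x" if "q \<in> C" for q
            using u_le[OF that, of "r *\<^sub>R x"] sublinearD(2)[OF sub[OF that], of r x] r
            by (simp add: field_simps)
          then have "u (r *\<^sub>R x) / r \<le> u x" by (rule u_ge)
          then show ?thesis using r by (simp add: field_simps)
        qed
      qed
      ultimately have "sublinear u" by (simp add: sublinear_def)
      moreover have "u \<le> p0"
      proof -
        obtain q where "q \<in> C" using False by blast
        then show ?thesis using u_le CA unfolding A_def le_fun_def by (blast intro: order_trans)
      qed
      ultimately show ?thesis using u_le by (auto simp: A_def le_fun_def intro!: bexI[of _ u])
    qed
  qed
  then obtain f where f: "sublinear f" "f \<le> p0" and min: "\<And>q. sublinear q \<Longrightarrow> q \<le> p0 \<Longrightarrow> q \<le> f \<Longrightarrow> q = f"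
    by (auto simp: A_def)
  have add: "f (x + y) = f x + f y" for x y
  proof (rule antisym)
    have "sublinear_slide f y \<le> f"
      using sublinear_slide_le[OF f(1), of 0 y] by (simp add: le_fun_def)
    then have "sublinear_slide f y = f"
      using f by (intro min sublinear_slide_sublinear) auto
    then show "f x + f y \<le> f (x + y)"
      using sublinear_slide_le[OF f(1), of 1 y x] by simp
  qed (rule sublinearD(1)[OF f(1)])
  have "f 0 = 0" using sublinearD(2)[OF f(1), of 0 0] by simp
  then have minus: "f (- x) = - f x" for x using add[of x "- x"] by simp
  have "f (r *\<^sub>R x) = r * f x" for r x
  proof (cases "r \<ge> 0")
    case False
    then have "f ((- r) *\<^sub>R x) = (- r) * f x" by (intro sublinearD(2)[OF f(1)]) simp
    then show ?thesis using minus[of "r *\<^sub>R x"] by simp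
  qed (rule sublinearD(2)[OF f(1)])
  with add have "linear f" by (intro linearI) auto
  moreover have le: "f x \<le> p x" for x using f(2) p0_le[of x] by (meson le_funD order_trans)
  moreover have "f x0 = p x0"
    using le[of x0] p0_x0 f(2) minus[of x0] by (smt (verit) le_funD)
  ultimately show thesis by (rule that)
qed

definition is_state :: "('a::unital_cstar_algebra \<Rightarrow> complex) \<Rightarrow> bool"
  where "is_state \<mu> \<longleftrightarrow> (\<forall>x y. \<mu> (x + y) = \<mu> x + \<mu> y) \<and> (\<forall>c x. \<mu> (c *\<^sub>C x) = c * \<mu> x) \<and>
    \<mu> 1 = 1 \<and> (\<forall>x. positive_elem x \<longrightarrow> \<mu> x \<in> \<real>\<^sub>\<ge>\<^sub>0)"

text \<open>The gauge \<open>p x = inf {r. r - Re x \<ge> 0}\<close> dominates exactly those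
  functionals of the self-adjoint part that are positive and unital.\<close>

lemma state_separates_sa:
  fixes a :: "'a::unital_cstar_algebra"
  assumes a: "star a = a" and neg: "\<not> positive_elem a"
  obtains \<mu> where "is_state \<mu>" "Re (\<mu> a) < 0"
proof -
  define H where "H x = (1/2) *\<^sub>R (x + star x)" for x :: 'a
  define S where "S x = {r. positive_elem (r *\<^sub>R 1 - H x)}" for x
  define p where "p x = Inf (S x)" for x
  have sH: "star (H x) = H x" for x
    by (simp add: H_def star_scaleR star_add star_star add.commute)
  have H_sa: "H x = x" if "star x = x" for x using that by (simp add: H_def scaleR_2[symmetric])
  have lower: "- norm (H x) \<le> r" if "r \<in> S x" for x r
  proof -
    have "positive_elem ((r *\<^sub>R 1 - H x) + (norm (H x) *\<^sub>R 1 + H x))"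
      using that by (intro positive_elem_add positive_elem_shift sH) (auto simp: S_def)
    then have "positive_elem ((r + norm (H x)) *\<^sub>R (1::'a))" by (simp add: algebra_simps)
    then show ?thesis by (simp add: positive_elem_scalar)
  qed
  have bdd: "bdd_below (S x)" for x using lower by (auto intro!: bdd_belowI)
  have ne: "norm (H x) \<in> S x" for x
    by (simp add: S_def positive_elem_shift_minus sH)
  have "closed {r. positive_elem (r *\<^sub>R 1 - H x)}" for x
    using closed_vimage[OF closed_positive_elem, of "\<lambda>r. r *\<^sub>R 1 - H x"]
    by (simp add: vimage_def continuous_intros)
  then have "closed (S x)" for x by (simp add: S_def)
  then have pS: "p x \<in> S x" for x
    unfolding p_def using ne bdd by (intro closed_contains_Inf) auto
  have p_le: "p x \<le> r" if "positive_elem (r *\<^sub>R 1 - H x)" for x r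
    unfolding p_def using that by (intro cInf_lower bdd) (simp add: S_def)
  have "sublinear p"
    unfolding sublinear_def
  proof (intro conjI allI impI)
    fix x y
    have "positive_elem ((p x *\<^sub>R 1 - H x) + (p y *\<^sub>R 1 - H y))"
      using pS by (intro positive_elem_add) (auto simp: S_def)
    then show "p (x + y) \<le> p x + p y"
      by (intro p_le) (simp add: H_def star_add algebra_simps)
  next
    have le: "p (r *\<^sub>R x) \<le> r * p x" if "0 \<le> r" for r x
    proof -
      have "positive_elem (r *\<^sub>R (p x *\<^sub>R 1 - H x))"
        using pS that by (intro positive_elem_scaleR) (auto simp: S_def)
      then show ?thesis by (intro p_le) (simp add: H_def star_scaleR algebra_simps)
    qed
    fix r :: real and x assume r: "0 \<le> r"
    show "p (r *\<^sub>R x) = r * p x"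
    proof (cases "r = 0")
      case True
      have "0 \<le> p 0" using lower[OF pS[of 0]] by (simp add: H_def)
      then show ?thesis using le[of 0 x] True by simp
    next
      case False
      then show ?thesis using le[of r x] le[of "inverse r" "r *\<^sub>R x"] r by (simp add: field_simps)
    qed
  qed
  then obtain f where f: "linear f" "\<And>x. f x \<le> p x" "f (- a) = p (- a)"
    using Hahn_Banach_sublinear[of p "- a"] by blast
  have "p (- a) > 0"
  proof (rule ccontr)
    assume "\<not> p (- a) > 0"
    then have shift: "positive_elem ((- p (- a)) *\<^sub>R (1::'a))"
      by (subst positive_elem_scalar) simp
    have "positive_elem (p (- a) *\<^sub>R 1 + a)"
      using pS[of "- a"] by (simp add: S_def H_sa star_minus a)
    from positive_elem_add[OF shift this]
    have "positive_elem a" by simp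
    then show False using neg by simp
  qed
  then have fa: "f a < 0" using f(3) linear_neg[OF f(1), of a] by simp
  have f_anti: "f x = 0" if "star x = - x" for x
  proof -
    have "H x = 0" "H (- x) = 0" using that by (simp_all add: H_def star_minus)
    then have "p x \<le> 0" "p (- x) \<le> 0" by (auto intro!: p_le)
    then show ?thesis using f(2)[of x] f(2)[of "- x"] linear_neg[OF f(1), of x] by linarith
  qed
  have f_pos: "0 \<le> f x" if "positive_elem x" for x
  proof -
    have "p (- x) \<le> 0"
      using that by (intro p_le) (simp add: H_sa star_minus positive_elem_sa)
    then show ?thesis using f(2)[of "- x"] linear_neg[OF f(1), of x] by linarith
  qed
  have f_one: "f 1 = 1"
  proof -
    have "p 1 \<le> 1" "p (- 1) \<le> - 1" by (auto intro!: p_le simp: H_sa star_minus)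
    then show ?thesis using f(2)[of 1] f(2)[of "- 1"] linear_neg[OF f(1), of 1] by linarith
  qed
  define \<mu> where "\<mu> x = Complex (f x) (- f (\<i> *\<^sub>C x))" for x
  have add: "\<mu> (x + y) = \<mu> x + \<mu> y" for x y
    by (simp add: \<mu>_def complex_eq_iff scaleC_add_right linear_add[OF f(1)])
  have scale: "\<mu> (c *\<^sub>C x) = c * \<mu> x" for c x
  proof -
    have "c = of_real (Re c) + of_real (Im c) * \<i>" by (simp add: complex_eq_iff)
    then have "c *\<^sub>C x = (of_real (Re c) + of_real (Im c) * \<i>) *\<^sub>C x" by simp
    also have "\<dots> = Re c *\<^sub>R x + Im c *\<^sub>R \<i> *\<^sub>C x"
      by (simp only: scaleC_add_left scaleC_scaleC[symmetric] scaleC_of_real)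
    finally have c: "c *\<^sub>C x = Re c *\<^sub>R x + Im c *\<^sub>R \<i> *\<^sub>C x" .
    have "\<i> * c = of_real (Re c) * \<i> + of_real (- Im c)" by (simp add: complex_eq_iff)
    then have "\<i> *\<^sub>C c *\<^sub>C x = (of_real (Re c) * \<i> + of_real (- Im c)) *\<^sub>C x"
      by (simp only: scaleC_scaleC)
    also have "\<dots> = Re c *\<^sub>R \<i> *\<^sub>C x - Im c *\<^sub>R x"
      by (simp only: scaleC_add_left scaleC_scaleC[symmetric] scaleC_of_real) simp
    finally have ic: "\<i> *\<^sub>C c *\<^sub>C x = Re c *\<^sub>R \<i> *\<^sub>C x - Im c *\<^sub>R x" .
    show ?thesis
      unfolding \<mu>_def ic unfolding c
      by (simp add: complex_eq_iff linear_add[OF f(1)] linear_diff[OF f(1)] linear_cmul[OF f(1)])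
  qed
  have sa: "\<mu> x = of_real (f x)" if "star x = x" for x
    using f_anti[of "\<i> *\<^sub>C x"] that by (simp add: \<mu>_def complex_eq_iff star_scaleC scaleC_minus_left)
  have "is_state \<mu>"
    unfolding is_state_def using add scale sa[of 1] f_one f_pos
    by (auto simp: sa positive_elem_sa)
  moreover have "Re (\<mu> a) < 0" using fa by (simp add: \<mu>_def)
  ultimately show thesis by (rule that)
qed

context
  fixes \<mu> :: "'a::unital_cstar_algebra \<Rightarrow> complex"
  assumes \<mu>: "is_state \<mu>"
begin

lemma state_add: "\<mu> (x + y) = \<mu> x + \<mu> y"
  and state_scaleC: "\<mu> (c *\<^sub>C x) = c * \<mu> x"
  and state_one: "\<mu> 1 = 1"
  and state_pos: "positive_elem x \<Longrightarrow> \<mu> x \<in> \<real>\<^sub>\<ge>\<^sub>0"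
  using \<mu> by (auto simp: is_state_def)

lemma state_scaleR: "\<mu> (r *\<^sub>R x) = of_real r * \<mu> x"
  using state_scaleC[of "of_real r" x] by (simp add: scaleC_of_real)

lemma state_zero: "\<mu> 0 = 0" using state_scaleC[of 0 0] by simp

lemma state_minus: "\<mu> (- x) = - \<mu> x" using state_scaleR[of "-1" x] by simp

lemma state_diff: "\<mu> (x - y) = \<mu> x - \<mu> y" using state_add[of x "- y"] by (simp add: state_minus)

lemma state_sum: "\<mu> (sum f I) = (\<Sum>i\<in>I. \<mu> (f i))"
  by (induction I rule: infinite_finite_induct) (simp_all add: state_zero state_add)

lemma state_sa:
  assumes "star x = x" shows "Im (\<mu> x) = 0" "\<bar>Re (\<mu> x)\<bar> \<le> norm x"
proof -
  have "\<mu> (norm x *\<^sub>R 1 + x) \<in> \<real>\<^sub>\<ge>\<^sub>0" "\<mu> (norm x *\<^sub>R 1 - x) \<in> \<real>\<^sub>\<ge>\<^sub>0"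
    using assms by (auto intro!: state_pos positive_elem_shift positive_elem_shift_minus)
  then show "Im (\<mu> x) = 0" "\<bar>Re (\<mu> x)\<bar> \<le> norm x"
    by (auto simp: complex_nonneg_Reals_iff state_add state_diff state_scaleR state_one)
qed

lemma state_star: "\<mu> (star x) = cnj (\<mu> x)"
proof -
  obtain h k where hk: "star h = h" "star k = k" "x = h + \<i> *\<^sub>C k"
    using sa_decomposition by metis
  have "star x = h - \<i> *\<^sub>C k" by (simp add: hk star_add star_scaleC scaleC_minus_left)
  then show ?thesis
    using state_sa(1)[OF hk(1)] state_sa(1)[OF hk(2)]
    by (simp add: hk(3) complex_eq_iff state_add state_diff state_scaleC)
qed

text \<open>The degenerate case of the Cauchy--Schwarz inequality: \<open>\<mu> ((z b + c)\<^sup>* (z b + c)) \<ge> 0\<close> is real-affine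
  in \<open>z\<close> when \<open>\<mu> (b\<^sup>* b) = 0\<close>.\<close>

lemma state_null_left:
  assumes "\<mu> (star b * b) = 0"
  shows "\<mu> (star b * c) = 0"
proof (rule ccontr)
  define w where "w = \<mu> (star b * c)"
  assume "\<mu> (star b * c) \<noteq> 0"
  then have w: "cmod w > 0" by (simp add: w_def)
  have "0 \<le> Re (\<mu> (star c * c)) - 2 * s * (cmod w)\<^sup>2" for s
  proof -
    let ?z = "- of_real s * w"
    have cb: "\<mu> (star c * b) = cnj w"
      using state_star[of "star b * c"] by (simp add: w_def star_mult star_star)
    have "\<mu> (star (?z *\<^sub>C b + c) * (?z *\<^sub>C b + c))
        = cnj ?z * (?z * \<mu> (star b * b) + w) + (?z * cnj w + \<mu> (star c * c))"
      by (simp add: star_add star_scaleC distrib_left distrib_right mult_scaleC_left mult_scaleC_right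
          state_add state_scaleC cb w_def algebra_simps)
    moreover have "\<mu> (star (?z *\<^sub>C b + c) * (?z *\<^sub>C b + c)) \<in> \<real>\<^sub>\<ge>\<^sub>0"
      by (rule state_pos) (auto simp: positive_elem_def)
    ultimately have "0 \<le> Re (cnj ?z * w + (?z * cnj w + \<mu> (star c * c)))"
      by (simp add: assms complex_nonneg_Reals_iff)
    also have "\<dots> = Re (\<mu> (star c * c)) - 2 * s * (cmod w)\<^sup>2"
      unfolding cmod_power2 by (simp add: power2_eq_square algebra_simps)
    finally show ?thesis .
  qed
  from this[of "(Re (\<mu> (star c * c)) + 1) / (2 * (cmod w)\<^sup>2)"] w show False
    by (simp add: field_simps)
qed

end

text \<open>Applied to the real and the imaginary part of \<open>e\<close>: the real part is positive, and the imaginary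
  part is positive and negative at once.\<close>

lemma positive_elem_if_states:
  fixes e :: "'a::unital_cstar_algebra"
  assumes "\<And>\<mu>. is_state \<mu> \<Longrightarrow> \<mu> e \<in> \<real>\<^sub>\<ge>\<^sub>0"
  shows "positive_elem e"
proof -
  obtain h k where hk: "star h = h" "star k = k" "e = h + \<i> *\<^sub>C k"
    using sa_decomposition by metis
  have \<mu>: "Re (\<mu> h) \<ge> 0 \<and> Re (\<mu> k) = 0" if "is_state \<mu>" for \<mu>
    using assms[OF that] state_sa(1)[OF that hk(1)] state_sa(1)[OF that hk(2)]
    by (auto simp: hk(3) complex_nonneg_Reals_iff state_add[OF that] state_scaleC[OF that])
  have "positive_elem h"
    using state_separates_sa[OF hk(1)] \<mu> by (metis not_le)
  moreover have "positive_elem k"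
    using state_separates_sa[OF hk(2)] \<mu> by (metis less_irrefl)
  moreover have "positive_elem (- k)"
    using state_separates_sa[of "- k"] \<mu> hk(2) state_minus
    by (metis less_irrefl neg_equal_zero star_minus uminus_complex.simps(1) minus_zero)
  ultimately have "norm k \<le> 0" using norm_le_if_positive_elem[of 0 k] by simp
  then show ?thesis using \<open>positive_elem h\<close> hk by simp
qed

lemma norm_le_if_states:
  fixes h :: "'a::unital_cstar_algebra"
  assumes h: "star h = h" and le: "\<And>\<mu>. is_state \<mu> \<Longrightarrow> \<bar>Re (\<mu> h)\<bar> \<le> c"
  shows "norm h \<le> c"
proof (rule norm_le_if_positive_elem)
  show "positive_elem (c *\<^sub>R 1 - h)"
    by (rule positive_elem_if_states)
      (use le state_sa(1)[OF _ h] in \<open>fastforce simp: complex_nonneg_Reals_iff state_diff state_scaleR state_one\<close>)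
  show "positive_elem (c *\<^sub>R 1 + h)"
    by (rule positive_elem_if_states)
      (use le state_sa(1)[OF _ h] in \<open>fastforce simp: complex_nonneg_Reals_iff state_add state_scaleR state_one\<close>)
qed

section \<open>Positive matrices over a C*-algebra\<close>

text \<open>Columns over the algebra are functions on \<open>nat\<close> of which only the first \<open>m\<close> values matter;
  \<open>column_ip\<close> is their algebra-valued inner product and \<open>mat_app\<close> the action of a matrix.\<close>

definition column_ip :: "nat \<Rightarrow> (nat \<Rightarrow> 'a::unital_cstar_algebra) \<Rightarrow> (nat \<Rightarrow> 'a) \<Rightarrow> 'a"
  where "column_ip m \<xi> \<eta> = (\<Sum>i<m. star (\<xi> i) * \<eta> i)"

definition mat_app :: "nat \<Rightarrow> (nat \<Rightarrow> nat \<Rightarrow> 'a::unital_cstar_algebra) \<Rightarrow> (nat \<Rightarrow> 'a) \<Rightarrow> nat \<Rightarrow> 'a"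
  where "mat_app m p \<xi> i = (\<Sum>j<m. p i j * \<xi> j)"

text \<open>As \<open>\<xi>\<close> ranges over columns with entries in the algebra, this amounts to positivity of \<open>p\<close> as an
  operator on a Hilbert module. Closure under sums, limits and compressions is inherited from the
  positive cone of the algebra.\<close>

definition weakly_positive :: "nat \<Rightarrow> (nat \<Rightarrow> nat \<Rightarrow> 'a::unital_cstar_algebra) \<Rightarrow> bool"
  where "weakly_positive m p \<longleftrightarrow> (\<forall>\<xi>. positive_elem (column_ip m \<xi> (mat_app m p \<xi>)))"

definition mat_mult :: "nat \<Rightarrow> (nat \<Rightarrow> nat \<Rightarrow> 'a::unital_cstar_algebra) \<Rightarrow> (nat \<Rightarrow> nat \<Rightarrow> 'a) \<Rightarrow> nat \<Rightarrow> nat \<Rightarrow> 'a"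
  where "mat_mult m p q i j = (\<Sum>k<m. p i k * q k j)"

definition mat_id :: "nat \<Rightarrow> nat \<Rightarrow> 'a::unital_cstar_algebra"
  where "mat_id i j = (if i = j then 1 else 0)"

primrec mat_power :: "nat \<Rightarrow> (nat \<Rightarrow> nat \<Rightarrow> 'a::unital_cstar_algebra) \<Rightarrow> nat \<Rightarrow> nat \<Rightarrow> nat \<Rightarrow> 'a"
  where "mat_power m q 0 = mat_id"
  | "mat_power m q (Suc k) = mat_mult m (mat_power m q k) q"

lemma column_ip_cong:
  "(\<And>i. i < m \<Longrightarrow> \<xi> i = \<xi>' i) \<Longrightarrow> (\<And>i. i < m \<Longrightarrow> \<eta> i = \<eta>' i) \<Longrightarrow> column_ip m \<xi> \<eta> = column_ip m \<xi>' \<eta>'"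
  by (simp add: column_ip_def)

lemma mat_app_cong:
  "(\<And>j. j < m \<Longrightarrow> p i j = p' i j) \<Longrightarrow> mat_app m p \<xi> i = mat_app m p' \<xi> i"
  by (simp add: mat_app_def)

lemma weakly_positive_cong:
  assumes "\<And>i j. i < m \<Longrightarrow> j < m \<Longrightarrow> p i j = p' i j"
  shows "weakly_positive m p \<longleftrightarrow> weakly_positive m p'"
proof -
  have "column_ip m \<xi> (mat_app m p \<xi>) = column_ip m \<xi> (mat_app m p' \<xi>)" for \<xi>
    by (intro column_ip_cong mat_app_cong assms refl)
  then show ?thesis by (simp add: weakly_positive_def)
qed

lemma column_ip_add_left: "column_ip m (\<lambda>i. \<xi> i + \<xi>' i) \<eta> = column_ip m \<xi> \<eta> + column_ip m \<xi>' \<eta>"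
  and column_ip_add_right: "column_ip m \<xi> (\<lambda>i. \<eta> i + \<eta>' i) = column_ip m \<xi> \<eta> + column_ip m \<xi> \<eta>'"
  and column_ip_diff_left: "column_ip m (\<lambda>i. \<xi> i - \<xi>' i) \<eta> = column_ip m \<xi> \<eta> - column_ip m \<xi>' \<eta>"
  and column_ip_diff_right: "column_ip m \<xi> (\<lambda>i. \<eta> i - \<eta>' i) = column_ip m \<xi> \<eta> - column_ip m \<xi> \<eta>'"
  and column_ip_scaleR_right: "column_ip m \<xi> (\<lambda>i. r *\<^sub>R \<eta> i) = r *\<^sub>R column_ip m \<xi> \<eta>"
  by (simp_all add: column_ip_def star_add star_diff algebra_simps sum.distrib sum_subtractf scaleR_sum_right)

lemma mat_app_add: "mat_app m p (\<lambda>i. \<xi> i + \<eta> i) = (\<lambda>i. mat_app m p \<xi> i + mat_app m p \<eta> i)"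
  and mat_app_diff: "mat_app m p (\<lambda>i. \<xi> i - \<eta> i) = (\<lambda>i. mat_app m p \<xi> i - mat_app m p \<eta> i)"
  and mat_app_mat_add: "mat_app m (\<lambda>i j. p i j + q i j) \<xi> = (\<lambda>i. mat_app m p \<xi> i + mat_app m q \<xi> i)"
  and mat_app_mat_diff: "mat_app m (\<lambda>i j. p i j - q i j) \<xi> = (\<lambda>i. mat_app m p \<xi> i - mat_app m q \<xi> i)"
  and mat_app_mat_scaleR: "mat_app m (\<lambda>i j. r *\<^sub>R p i j) \<xi> = (\<lambda>i. r *\<^sub>R mat_app m p \<xi> i)"
  by (simp_all add: mat_app_def fun_eq_iff algebra_simps sum.distrib sum_subtractf scaleR_sum_right)

lemma mat_app_id: "i < m \<Longrightarrow> mat_app m mat_id \<xi> i = \<xi> i"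
proof -
  assume "i < m"
  have "mat_app m mat_id \<xi> i = (\<Sum>j<m. if j = i then \<xi> j else 0)"
    unfolding mat_app_def mat_id_def by (intro sum.cong) auto
  then show ?thesis using \<open>i < m\<close> by simp
qed

lemma mat_app_mult: "mat_app m (mat_mult m p q) \<xi> i = mat_app m p (mat_app m q \<xi>) i"
  unfolding mat_app_def mat_mult_def
  by (simp add: sum_distrib_left sum_distrib_right mult.assoc) (rule sum.swap)

lemma column_ip_adjoint:
  assumes "\<And>i j. i < m \<Longrightarrow> j < m \<Longrightarrow> star (q i j) = q j i"
  shows "column_ip m (mat_app m q \<xi>) \<eta> = column_ip m \<xi> (mat_app m q \<eta>)"
proof -
  have "column_ip m (mat_app m q \<xi>) \<eta> = (\<Sum>i<m. \<Sum>j<m. star (\<xi> j) * star (q i j) * \<eta> i)"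
    by (simp add: column_ip_def mat_app_def star_sum star_mult sum_distrib_right)
  also have "\<dots> = (\<Sum>i<m. \<Sum>j<m. star (\<xi> j) * (q j i * \<eta> i))"
    by (intro sum.cong refl) (simp add: assms mult.assoc)
  also have "\<dots> = (\<Sum>j<m. \<Sum>i<m. star (\<xi> j) * (q j i * \<eta> i))" by (rule sum.swap)
  also have "\<dots> = column_ip m \<xi> (mat_app m q \<eta>)"
    by (simp add: column_ip_def mat_app_def sum_distrib_left)
  finally show ?thesis .
qed

lemma weakly_positive_add:
  "weakly_positive m p \<Longrightarrow> weakly_positive m q \<Longrightarrow> weakly_positive m (\<lambda>i j. p i j + q i j)"
  by (simp add: weakly_positive_def mat_app_mat_add column_ip_add_right positive_elem_add)

lemma weakly_positive_scaleR:
  "weakly_positive m p \<Longrightarrow> 0 \<le> r \<Longrightarrow> weakly_positive m (\<lambda>i j. r *\<^sub>R p i j)"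
  by (simp add: weakly_positive_def mat_app_mat_scaleR column_ip_scaleR_right positive_elem_scaleR)

lemma positive_elem_self_ip: "positive_elem (column_ip m \<xi> \<xi>)"
  unfolding column_ip_def by (intro positive_elem_sum) (auto simp: positive_elem_def)

lemma weakly_positive_id: "weakly_positive m mat_id"
  unfolding weakly_positive_def
proof
  fix \<xi> :: "nat \<Rightarrow> 'a"
  have "column_ip m \<xi> (mat_app m mat_id \<xi>) = column_ip m \<xi> \<xi>"
    by (intro column_ip_cong mat_app_id refl)
  then show "positive_elem (column_ip m \<xi> (mat_app m mat_id \<xi>))"
    by (simp add: positive_elem_self_ip)
qed

lemma weakly_positive_sandwich:
  assumes "weakly_positive m p" and "\<And>i j. i < m \<Longrightarrow> j < m \<Longrightarrow> star (q i j) = q j i"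
  shows "weakly_positive m (mat_mult m q (mat_mult m p q))"
  unfolding weakly_positive_def
proof
  fix \<xi>
  have "mat_app m (mat_mult m q (mat_mult m p q)) \<xi> = mat_app m q (mat_app m p (mat_app m q \<xi>))"
    by (simp add: fun_eq_iff mat_app_mult mat_app_mult[abs_def])
  then have "column_ip m \<xi> (mat_app m (mat_mult m q (mat_mult m p q)) \<xi>)
      = column_ip m (mat_app m q \<xi>) (mat_app m p (mat_app m q \<xi>))"
    by (simp add: column_ip_adjoint[OF assms(2)])
  then show "positive_elem (column_ip m \<xi> (mat_app m (mat_mult m q (mat_mult m p q)) \<xi>))"
    using assms(1) by (simp add: weakly_positive_def)
qed

text \<open>The form at the column \<open>a e\<^sub>i + b e\<^sub>j\<close>; all information about single entries is extracted from it.\<close>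

lemma weakly_positive_two_entries:
  assumes "weakly_positive m p" "i < m" "j < m"
  shows "positive_elem (star a * p i i * a + star a * p i j * b + star b * p j i * a + star b * p j j * b)"
proof -
  define e where "e l x = (\<lambda>k. if k = l then x else (0::'a))" for l :: nat and x
  have app: "mat_app m p (e l x) k = p k l * x" if "l < m" for k l x
  proof -
    have "mat_app m p (e l x) k = (\<Sum>j<m. if j = l then p k j * x else 0)"
      unfolding mat_app_def e_def by (intro sum.cong) auto
    then show ?thesis using that by simp
  qed
  have ip: "column_ip m (e l x) \<eta> = star x * \<eta> l" if "l < m" for l x \<eta>
  proof -
    have "column_ip m (e l x) \<eta> = (\<Sum>j<m. if j = l then star x * \<eta> j else 0)"
      unfolding column_ip_def e_def by (intro sum.cong) auto
    then show ?thesis using that by simp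
  qed
  let ?\<xi> = "\<lambda>k. e i a k + e j b k"
  have "positive_elem (column_ip m ?\<xi> (mat_app m p ?\<xi>))"
    using assms by (auto simp: weakly_positive_def)
  then show ?thesis
    using assms(2,3) by (simp add: mat_app_add column_ip_add_left column_ip_add_right ip app mult.assoc add.assoc)
qed

lemma weakly_positive_diagonal:
  assumes "weakly_positive m p" "i < m" shows "positive_elem (p i i)"
  using weakly_positive_two_entries[OF assms assms(2), of 1 0] by simp

lemma weakly_positive_hermitian:
  assumes p: "weakly_positive m p" and ij: "i < m" "j < m"
  shows "star (p i j) = p j i"
proof -
  have d: "star (p i i) = p i i" "star (p j j) = p j j"
    using weakly_positive_diagonal[OF p] ij positive_elem_sa by blast+
  have 1: "star (p i j) + star (p j i) = p i j + p j i"
    using positive_elem_sa[OF weakly_positive_two_entries[OF p ij, of 1 1]]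
    by (simp add: star_add d)
  have "\<i> *\<^sub>C star (p j i) - \<i> *\<^sub>C star (p i j) = \<i> *\<^sub>C p i j - \<i> *\<^sub>C p j i"
    using positive_elem_sa[OF weakly_positive_two_entries[OF p ij, of 1 "\<i> *\<^sub>C 1"]]
    by (simp add: star_add star_scaleC d mult_scaleC_left mult_scaleC_right scaleC_scaleC scaleC_minus_left
        scaleC_minus_right star_minus star_diff)
  then have "(- \<i>) *\<^sub>C \<i> *\<^sub>C (star (p j i) - star (p i j)) = (- \<i>) *\<^sub>C \<i> *\<^sub>C (p i j - p j i)"
    by (simp add: scaleC_diff_right)
  then have 2: "star (p j i) - star (p i j) = p i j - p j i"
    by (simp add: scaleC_scaleC)
  have "(star (p i j) + star (p j i)) - (star (p j i) - star (p i j)) = (p i j + p j i) - (p i j - p j i)"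
    by (simp only: 1 2)
  then have "2 *\<^sub>R star (p i j) = 2 *\<^sub>R p j i" by (simp add: scaleR_2)
  then show ?thesis by simp
qed

text \<open>Taking \<open>1 e\<^sub>i + z e\<^sub>j\<close> with \<open>z\<close> a fourth root of unity bounds the real and the imaginary part of
  the entry by the diagonal.\<close>

lemma weakly_positive_entry_bound:
  fixes r :: "nat \<Rightarrow> nat \<Rightarrow> 'a::unital_cstar_algebra"
  assumes r: "weakly_positive m r" "weakly_positive m (\<lambda>i j. mat_id i j - r i j)" and ij: "i < m" "j < m"
  shows "norm (r i j) \<le> 2"
proof -
  let ?c = "r i j"
  have le: "positive_elem (1 - r i i)" "positive_elem (1 - r j j)"
    using weakly_positive_diagonal[OF r(2)] ij by (auto simp: mat_id_def)
  have c: "r j i = star ?c" using weakly_positive_hermitian[OF r(1) ij] by simp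
  have key: "positive_elem (2 *\<^sub>R 1 + (z *\<^sub>C ?c + cnj z *\<^sub>C star ?c))" if "cmod z = 1" for z
  proof -
    have "z * cnj z = 1" using that by (simp add: complex_norm_square[symmetric])
    then have zz: "cnj z * z = 1" by (simp add: mult.commute)
    have "positive_elem (r i i + z *\<^sub>C ?c + cnj z *\<^sub>C star ?c + r j j)"
      using weakly_positive_two_entries[OF r(1) ij, of 1 "z *\<^sub>C 1"]
      by (simp add: star_scaleC mult_scaleC_left mult_scaleC_right scaleC_scaleC c zz
            mult.commute[of z "cnj z"])
    from positive_elem_add[OF this positive_elem_add[OF le]]
    show ?thesis by (simp add: algebra_simps scaleR_2)
  qed
  have "norm (?c + star ?c) \<le> 2"
    using key[of 1] key[of "- 1"]
    by (intro norm_le_if_positive_elem) (simp_all add: scaleC_minus_left algebra_simps)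
  moreover have "norm (\<i> *\<^sub>C (?c - star ?c)) \<le> 2"
    using key[of \<i>] key[of "- \<i>"]
    by (intro norm_le_if_positive_elem) (simp_all add: scaleC_minus_left scaleC_diff_right algebra_simps)
  then have "norm (?c - star ?c) \<le> 2" by (simp add: norm_scaleC)
  ultimately have "norm ((?c + star ?c) + (?c - star ?c)) \<le> 2 + 2" by (intro norm_triangle_le) simp
  moreover have "(?c + star ?c) + (?c - star ?c) = 2 *\<^sub>R ?c" by (simp add: scaleR_2)
  ultimately show ?thesis by simp
qed

text \<open>Summing the form over all \<open>\<xi>\<^sub>i e\<^sub>i - \<xi>\<^sub>j e\<^sub>j\<close> bounds a weakly positive matrix by a multiple
  of its diagonal.\<close>

lemma weakly_positive_upper_bound:
  fixes p :: "nat \<Rightarrow> nat \<Rightarrow> 'a::unital_cstar_algebra"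
  assumes p: "weakly_positive m p"
  obtains T where "T > 0" "weakly_positive m (\<lambda>i j. T *\<^sub>R mat_id i j - p i j)"
proof -
  define T where "T = 1 + real m * (\<Sum>i<m. norm (p i i))"
  have T0: "T > 0" unfolding T_def by (intro add_pos_nonneg mult_nonneg_nonneg sum_nonneg) auto
  have T: "real m * norm (p i i) \<le> T" if "i < m" for i
  proof -
    have "norm (p i i) \<le> (\<Sum>i<m. norm (p i i))"
      using that by (intro member_le_sum) auto
    then have "real m * norm (p i i) \<le> real m * (\<Sum>i<m. norm (p i i))" by (rule mult_left_mono) simp
    then show ?thesis by (simp add: T_def)
  qed
  have "positive_elem (column_ip m \<xi> (mat_app m (\<lambda>i j. T *\<^sub>R mat_id i j - p i j) \<xi>))" for \<xi>
  proof -
    define s where "s i j = star (\<xi> i) * p i j * \<xi> j" for i j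
    define D where "D = (\<Sum>i<m. s i i)"
    define N where "N = (\<Sum>i<m. \<Sum>j<m. s i j)"
    have form: "column_ip m \<xi> (mat_app m (\<lambda>i j. T *\<^sub>R mat_id i j - p i j) \<xi>) = T *\<^sub>R column_ip m \<xi> \<xi> - N"
    proof -
      have "column_ip m \<xi> (mat_app m mat_id \<xi>) = column_ip m \<xi> \<xi>"
        by (intro column_ip_cong mat_app_id refl)
      moreover have "column_ip m \<xi> (mat_app m p \<xi>) = N"
        by (simp add: N_def s_def column_ip_def mat_app_def sum_distrib_left mult.assoc)
      ultimately show ?thesis
        by (simp add: mat_app_mat_diff mat_app_mat_scaleR column_ip_diff_right column_ip_scaleR_right)
    qed
    have "positive_elem (s i i - s i j - s j i + s j j)" if "i < m" "j < m" for i j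
      using weakly_positive_two_entries[OF p that, of "\<xi> i" "- \<xi> j"] by (simp add: s_def star_minus)
    then have "positive_elem (\<Sum>i<m. \<Sum>j<m. s i i - s i j - s j i + s j j)"
      by (intro positive_elem_sum) auto
    also have "(\<Sum>i<m. \<Sum>j<m. s i i - s i j - s j i + s j j) = 2 *\<^sub>R (real m *\<^sub>R D - N)"
    proof -
      have "(\<Sum>i<m. \<Sum>j<m. s j i) = N" unfolding N_def by (rule sum.swap)
      moreover have "(\<Sum>i<m. \<Sum>j<m. s i i) = real m *\<^sub>R D" "(\<Sum>i<m. \<Sum>j<m. s j j) = real m *\<^sub>R D"
        by (simp_all add: D_def scaleR_sum_right[symmetric] sum_constant_scaleR del: sum_constant)
      ultimately show ?thesis
        by (simp add: sum.distrib sum_subtractf N_def[symmetric] scaleR_2)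
    qed
    finally have "positive_elem ((1/2) *\<^sub>R 2 *\<^sub>R (real m *\<^sub>R D - N))"
      by (rule positive_elem_scaleR) simp
    then have 1: "positive_elem (real m *\<^sub>R D - N)" by simp
    have "positive_elem (T *\<^sub>R (star (\<xi> i) * \<xi> i) - real m *\<^sub>R s i i)" if "i < m" for i
    proof -
      have "norm (real m *\<^sub>R p i i) \<le> T" using T[OF that] by simp
      moreover have "star (real m *\<^sub>R p i i) = real m *\<^sub>R p i i"
        using weakly_positive_diagonal[OF p that] by (simp add: star_scaleR positive_elem_sa)
      ultimately have "positive_elem (star (\<xi> i) * (T *\<^sub>R 1 - real m *\<^sub>R p i i) * \<xi> i)"
        by (intro positive_elem_sandwich positive_elem_shift_minus)
      then show ?thesis by (simp add: s_def algebra_simps)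
    qed
    then have "positive_elem (\<Sum>i<m. T *\<^sub>R (star (\<xi> i) * \<xi> i) - real m *\<^sub>R s i i)"
      by (intro positive_elem_sum) auto
    then have "positive_elem (T *\<^sub>R column_ip m \<xi> \<xi> - real m *\<^sub>R D)"
      by (simp add: sum_subtractf column_ip_def D_def scaleR_sum_right)
    from positive_elem_add[OF this 1] show ?thesis by (simp add: form)
  qed
  then show thesis using that T0 by (auto simp: weakly_positive_def)
qed

lemma mat_mult_assoc: "mat_mult m (mat_mult m p q) r = mat_mult m p (mat_mult m q r)"
  unfolding mat_mult_def fun_eq_iff
  by (auto simp: sum_distrib_left sum_distrib_right mult.assoc intro: sum.swap)

lemma mat_mult_cong:
  "(\<And>k. k < m \<Longrightarrow> p i k = p' i k) \<Longrightarrow> (\<And>k. k < m \<Longrightarrow> q k j = q' k j) \<Longrightarrow> mat_mult m p q i j = mat_mult m p' q' i j"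
  by (simp add: mat_mult_def)

lemma mat_mult_id_left: "i < m \<Longrightarrow> mat_mult m mat_id q i j = q i j"
  using mat_app_id[of i m "\<lambda>k. q k j"] by (simp add: mat_mult_def mat_app_def)

lemma mat_mult_id_right: "j < m \<Longrightarrow> mat_mult m q mat_id i j = q i j"
proof -
  assume "j < m"
  have "mat_mult m q mat_id i j = (\<Sum>k<m. if k = j then q i k else 0)"
    unfolding mat_mult_def mat_id_def by (intro sum.cong) auto
  then show ?thesis using \<open>j < m\<close> by simp
qed

lemma mat_power_add:
  "j < m \<Longrightarrow> mat_mult m (mat_power m q a) (mat_power m q b) i j = mat_power m q (a + b) i j"
proof (induction b arbitrary: j)
  case 0
  then show ?case by (simp add: mat_mult_id_right)
next
  case (Suc b)
  then show ?case by (simp add: mat_mult_assoc[symmetric]) (rule mat_mult_cong, auto)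
qed

lemma mat_power_one: "i < m \<Longrightarrow> mat_power m q (Suc 0) i j = q i j"
  by (simp add: mat_mult_id_left)

lemma mat_power_Suc_left:
  assumes "i < m" "j < m"
  shows "mat_mult m q (mat_power m q k) i j = mat_power m q (Suc k) i j"
proof -
  have "mat_mult m q (mat_power m q k) i j = mat_mult m (mat_power m q (Suc 0)) (mat_power m q k) i j"
    by (rule mat_mult_cong) (simp_all only: mat_power_one[OF assms(1)])
  also have "\<dots> = mat_power m q (Suc 0 + k) i j" by (rule mat_power_add[OF assms(2)])
  finally show ?thesis by simp
qed

lemma mat_power_hermitian:
  assumes q: "\<And>i j. i < m \<Longrightarrow> j < m \<Longrightarrow> star (q i j) = q j i"
  shows "i < m \<Longrightarrow> j < m \<Longrightarrow> star (mat_power m q k i j) = mat_power m q k j i"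
proof (induction k arbitrary: i j)
  case 0
  then show ?case by (simp add: mat_id_def)
next
  case (Suc k)
  have "star (mat_power m q (Suc k) i j) = mat_mult m q (mat_power m q k) j i"
    using Suc by (simp add: mat_mult_def star_sum star_mult q)
  then show ?case using Suc.prems mat_power_Suc_left by metis
qed

text \<open>\<open>0 \<le> q \<le> 1\<close> gives \<open>q - q\<^sup>2 = q (1 - q) q + (1 - q) q (1 - q) \<ge> 0\<close>, and sandwiching with \<open>q\<close>
  makes the powers of \<open>q\<close> decreasing.\<close>

lemma weakly_positive_powers:
  fixes q :: "nat \<Rightarrow> nat \<Rightarrow> 'a::unital_cstar_algebra"
  assumes q: "weakly_positive m q" and le: "weakly_positive m (\<lambda>i j. mat_id i j - q i j)"
  shows "weakly_positive m (mat_power m q k) \<and>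
    weakly_positive m (\<lambda>i j. mat_power m q k i j - mat_power m q (Suc k) i j)"
proof (induction k rule: induct_nat_012)
  note herm = weakly_positive_hermitian[OF q]
  case 0
  have "weakly_positive m (\<lambda>i j. mat_power m q 0 i j - mat_power m q (Suc 0) i j)"
    by (subst weakly_positive_cong[OF _]) (use le in \<open>simp_all add: mat_mult_id_left\<close>)
  then show ?case by (simp add: weakly_positive_id)
next
  note herm = weakly_positive_hermitian[OF q]
  case 1
  have one: "weakly_positive m (mat_power m q (Suc 0))"
    using q weakly_positive_cong[of m "mat_power m q (Suc 0)" q] mat_power_one by blast
  have "positive_elem (column_ip m \<xi> (mat_app m (\<lambda>i j. q i j - mat_mult m q q i j) \<xi>))" for \<xi>
  proof -
    define \<eta> where "\<eta> = mat_app m q \<xi>"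
    define \<zeta> where "\<zeta> = (\<lambda>i. \<xi> i - \<eta> i)"
    let ?f = "\<lambda>\<xi> \<eta>. column_ip m \<xi> (mat_app m q \<eta>)"
    have adj: "?f u w = column_ip m (mat_app m q u) w" for u w
      by (simp add: column_ip_adjoint herm)
    have id: "column_ip m \<eta> (mat_app m mat_id \<eta>) = column_ip m \<eta> \<eta>"
      by (intro column_ip_cong mat_app_id refl)
    have "positive_elem (column_ip m \<eta> (mat_app m (\<lambda>i j. mat_id i j - q i j) \<eta>) + ?f \<zeta> \<zeta>)"
      using q le by (intro positive_elem_add) (auto simp: weakly_positive_def)
    also have "column_ip m \<eta> (mat_app m (\<lambda>i j. mat_id i j - q i j) \<eta>) + ?f \<zeta> \<zeta> = ?f \<xi> \<xi> - column_ip m \<eta> \<eta>"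
    proof -
      have "?f \<zeta> \<zeta> = ?f \<xi> \<xi> - ?f \<xi> \<eta> - (?f \<eta> \<xi> - ?f \<eta> \<eta>)"
        by (simp add: \<zeta>_def mat_app_diff column_ip_diff_left column_ip_diff_right algebra_simps)
      moreover have "?f \<xi> \<eta> = column_ip m \<eta> \<eta>" by (simp add: adj \<eta>_def)
      moreover have "?f \<eta> \<xi> = column_ip m \<eta> \<eta>" by (simp add: \<eta>_def)
      ultimately show ?thesis
        by (simp add: mat_app_mat_diff column_ip_diff_right id)
    qed
    also have "\<dots> = column_ip m \<xi> (mat_app m (\<lambda>i j. q i j - mat_mult m q q i j) \<xi>)"
      by (simp add: mat_app_mat_diff column_ip_diff_right mat_app_mult[abs_def] \<eta>_def column_ip_adjoint herm)
    finally show ?thesis .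
  qed
  then have "weakly_positive m (\<lambda>i j. q i j - mat_mult m q q i j)" by (simp add: weakly_positive_def)
  then have "weakly_positive m (\<lambda>i j. mat_power m q (Suc 0) i j - mat_power m q (Suc (Suc 0)) i j)"
    by (subst weakly_positive_cong[where p'="\<lambda>i j. q i j - mat_mult m q q i j"])
      (auto simp: mat_mult_id_left intro!: mat_mult_cong)
  with one show ?case by (simp only: One_nat_def)
next
  note herm = weakly_positive_hermitian[OF q]
  case (ge2 k)
  have two: "mat_mult m q (mat_mult m (mat_power m q l) q) i j = mat_power m q (Suc (Suc l)) i j"
    if "i < m" "j < m" for l i j
    using mat_power_Suc_left[OF that, of q "Suc l"] by simp
  have "weakly_positive m (mat_mult m q (mat_mult m (mat_power m q k) q))"
    using ge2 by (intro weakly_positive_sandwich herm) auto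
  then have 1: "weakly_positive m (mat_power m q (Suc (Suc k)))"
    by (subst weakly_positive_cong[OF two[symmetric]])
  have "weakly_positive m (mat_mult m q (mat_mult m (\<lambda>i j. mat_power m q k i j - mat_power m q (Suc k) i j) q))"
    using ge2 by (intro weakly_positive_sandwich herm) auto
  moreover have "mat_mult m q (mat_mult m (\<lambda>i j. mat_power m q k i j - mat_power m q (Suc k) i j) q) i j
      = mat_power m q (Suc (Suc k)) i j - mat_power m q (Suc (Suc (Suc k))) i j" if "i < m" "j < m" for i j
  proof -
    have "mat_mult m q (mat_mult m (\<lambda>i j. mat_power m q k i j - mat_power m q (Suc k) i j) q) i j
      = mat_mult m q (mat_mult m (mat_power m q k) q) i j - mat_mult m q (mat_mult m (mat_power m q (Suc k)) q) i j"
      by (simp only: mat_mult_def left_diff_distrib right_diff_distrib sum_subtractf)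
    then show ?thesis by (simp only: two[OF that])
  qed
  note diff = this
  ultimately have "weakly_positive m (\<lambda>i j. mat_power m q (Suc (Suc k)) i j - mat_power m q (Suc (Suc (Suc k))) i j)"
    by (subst weakly_positive_cong[OF diff[symmetric]])
  with 1 show ?case by blast
qed

lemma weakly_positive_one_minus_power:
  fixes q :: "nat \<Rightarrow> nat \<Rightarrow> 'a::unital_cstar_algebra"
  assumes q: "weakly_positive m q" and le: "weakly_positive m (\<lambda>i j. mat_id i j - q i j)"
  shows "weakly_positive m (\<lambda>i j. mat_id i j - mat_power m q k i j)"
proof (induction k)
  case 0
  have "weakly_positive m (\<lambda>i j. 0 *\<^sub>R (mat_id i j :: 'a))"
    by (intro weakly_positive_scaleR weakly_positive_id) simp
  then show ?case by simp
next
  case (Suc k)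
  have "weakly_positive m (\<lambda>i j. mat_power m q k i j - mat_power m q (Suc k) i j)"
    using weakly_positive_powers[OF q le, of k] by blast
  from weakly_positive_add[OF Suc this] show ?case by simp
qed

text \<open>The entries of all powers of \<open>q\<close> are bounded by \<open>2\<close>, so the binomial series of \<open>sqrt (1 - q)\<close>
  converges absolutely in every entry.\<close>

lemma weakly_positive_sqrt:
  fixes q :: "nat \<Rightarrow> nat \<Rightarrow> 'a::unital_cstar_algebra"
  assumes q: "weakly_positive m q" and le: "weakly_positive m (\<lambda>i j. mat_id i j - q i j)"
  obtains s where "\<And>i j. i < m \<Longrightarrow> j < m \<Longrightarrow> star (s i j) = s j i"
    "\<And>i j. i < m \<Longrightarrow> j < m \<Longrightarrow> mat_mult m s s i j = mat_id i j - q i j"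
proof -
  define f where "f i j k = sqrt_coeff k *\<^sub>R mat_power m q k i j" for i j k
  define s where "s i j = suminf (f i j)" for i j
  have "norm (mat_power m q k i j) \<le> 2" if "i < m" "j < m" for i j k
    by (rule weakly_positive_entry_bound[OF _ weakly_positive_one_minus_power[OF q le] that])
      (use weakly_positive_powers[OF q le] in blast)
  then have bound: "norm (f i j k) \<le> \<bar>sqrt_coeff k\<bar> * 2" if "i < m" "j < m" for i j k
    unfolding f_def norm_scaleR using that by (intro mult_left_mono) auto
  have norm_f: "summable (\<lambda>k. norm (f i j k))" if "i < m" "j < m" for i j
    using bound[OF that] by (intro summable_comparison_test[OF _ summable_mult2[OF summable_sqrt_coeff]]) auto
  have f: "summable (f i j)" if "i < m" "j < m" for i j
    using norm_f[OF that] by (rule summable_norm_cancel)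
  have "star (s i j) = s j i" if ij: "i < m" "j < m" for i j
  proof -
    have "star (f i j k) = f j i k" for k
      by (simp add: f_def star_scaleR mat_power_hermitian weakly_positive_hermitian[OF q] ij)
    then show ?thesis
      using bounded_linear.suminf[OF bounded_linear_star f[OF ij]] by (simp add: s_def fun_eq_iff)
  qed
  moreover have "mat_mult m s s i j = mat_id i j - q i j" if ij: "i < m" "j < m" for i j
  proof -
    define g where "g n = (\<Sum>l<m. \<Sum>a\<le>n. f i l a * f l j (n - a))" for n
    have "(\<lambda>n. \<Sum>a\<le>n. f i l a * f l j (n - a)) sums (s i l * s l j)" if "l < m" for l
      unfolding s_def using that ij by (intro Cauchy_product_sums norm_f)
    then have "g sums (\<Sum>l<m. s i l * s l j)"
      unfolding g_def by (intro sums_sum) auto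
    moreover have gn: "g n = (\<Sum>a\<le>n. sqrt_coeff a * sqrt_coeff (n - a)) *\<^sub>R mat_power m q n i j" for n
    proof -
      have "g n = (\<Sum>a\<le>n. \<Sum>l<m. f i l a * f l j (n - a))"
        unfolding g_def by (rule sum.swap)
      also have "\<dots> = (\<Sum>a\<le>n. (sqrt_coeff a * sqrt_coeff (n - a)) *\<^sub>R mat_power m q n i j)"
      proof (rule sum.cong)
        fix a assume "a \<in> {..n}"
        have "(\<Sum>l<m. f i l a * f l j (n - a))
            = (sqrt_coeff a * sqrt_coeff (n - a)) *\<^sub>R mat_mult m (mat_power m q a) (mat_power m q (n - a)) i j"
          by (simp add: f_def mat_mult_def scaleR_sum_right mult.commute)
        also have "mat_mult m (mat_power m q a) (mat_power m q (n - a)) i j = mat_power m q n i j"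
          using mat_power_add[OF ij(2), of q a "n - a" i] \<open>a \<in> {..n}\<close> by simp
        finally show "(\<Sum>l<m. f i l a * f l j (n - a)) = (sqrt_coeff a * sqrt_coeff (n - a)) *\<^sub>R mat_power m q n i j" .
      qed simp
      finally show ?thesis by (simp add: scaleR_sum_left)
    qed
    have "g sums (\<Sum>n\<in>{0,1}. g n)"
      by (rule sums_finite) (auto simp: gn sqrt_coeff_convolution)
    ultimately have "(\<Sum>l<m. s i l * s l j) = (\<Sum>n\<in>{0,1}. g n)" by (metis sums_unique2)
    then show ?thesis
      by (simp add: mat_mult_def gn sqrt_coeff_convolution)
        (use mat_mult_id_left[OF ij(1), of q j] in \<open>simp add: mat_mult_def\<close>)
  qed
  ultimately show thesis by (rule that)
qed

text \<open>For the nontrivial direction, scale \<open>P\<close> such that \<open>0 \<le> P \<le> 1\<close> and take the square root of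
  \<open>1 - q\<close> for \<open>q = 1 - P\<close>.\<close>

theorem positive_mat_iff_weakly_positive:
  fixes P :: "'a::unital_cstar_algebra mat"
  shows "positive_mat m P \<longleftrightarrow> P \<in> carrier_mat m m \<and> weakly_positive m (\<lambda>i j. P $$ (i, j))"
proof
  assume "positive_mat m P"
  then obtain B where B: "B \<in> carrier_mat m m" "P = mat_star B * B" by (auto simp: positive_mat_def)
  define b where "b i j = B $$ (i, j)" for i j
  have P: "P $$ (i, j) = (\<Sum>k<m. star (b k i) * b k j)" if "i < m" "j < m" for i j
    using that B by (simp add: mat_star_def b_def scalar_prod_def atLeast0LessThan)
  have "positive_elem (column_ip m \<xi> (mat_app m (\<lambda>i j. P $$ (i, j)) \<xi>))" for \<xi>
  proof -
    have "column_ip m \<xi> (mat_app m (\<lambda>i j. P $$ (i, j)) \<xi>)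
        = (\<Sum>i<m. \<Sum>j<m. \<Sum>k<m. star (\<xi> i) * (star (b k i) * b k j * \<xi> j))"
      by (simp add: column_ip_def mat_app_def P sum_distrib_left sum_distrib_right)
    also have "\<dots> = (\<Sum>i<m. \<Sum>k<m. \<Sum>j<m. star (\<xi> i) * (star (b k i) * b k j * \<xi> j))"
      by (intro sum.cong refl sum.swap)
    also have "\<dots> = (\<Sum>k<m. \<Sum>i<m. \<Sum>j<m. star (\<xi> i) * (star (b k i) * b k j * \<xi> j))"
      by (rule sum.swap)
    also have "\<dots> = (\<Sum>k<m. star (\<Sum>i<m. b k i * \<xi> i) * (\<Sum>j<m. b k j * \<xi> j))"
      by (simp add: star_sum star_mult sum_product mult.assoc)
    finally have eq: "column_ip m \<xi> (mat_app m (\<lambda>i j. P $$ (i, j)) \<xi>)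
        = (\<Sum>k<m. star (\<Sum>i<m. b k i * \<xi> i) * (\<Sum>j<m. b k j * \<xi> j))" .
    show ?thesis
      unfolding eq by (rule positive_elem_sum) (auto simp: positive_elem_def)
  qed
  moreover have "P \<in> carrier_mat m m" using B by (auto simp: mat_star_def)
  ultimately show "P \<in> carrier_mat m m \<and> weakly_positive m (\<lambda>i j. P $$ (i, j))"
    by (simp add: weakly_positive_def)
next
  assume asm: "P \<in> carrier_mat m m \<and> weakly_positive m (\<lambda>i j. P $$ (i, j))"
  define p where "p i j = P $$ (i, j)" for i j
  have p: "weakly_positive m p" using asm by (simp add: p_def[abs_def])
  obtain T where T: "T > 0" "weakly_positive m (\<lambda>i j. T *\<^sub>R mat_id i j - p i j)"
    using weakly_positive_upper_bound[OF p] .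
  define q where "q i j = mat_id i j - inverse T *\<^sub>R p i j" for i j
  have "weakly_positive m (\<lambda>i j. inverse T *\<^sub>R (T *\<^sub>R mat_id i j - p i j))"
    using T by (intro weakly_positive_scaleR) auto
  then have "weakly_positive m q" using T by (simp add: q_def[abs_def] scaleR_diff_right)
  moreover have "weakly_positive m (\<lambda>i j. mat_id i j - q i j)"
    using weakly_positive_scaleR[OF p, of "inverse T"] T by (simp add: q_def)
  ultimately obtain s where s: "\<And>i j. i < m \<Longrightarrow> j < m \<Longrightarrow> star (s i j) = s j i"
    "\<And>i j. i < m \<Longrightarrow> j < m \<Longrightarrow> mat_mult m s s i j = mat_id i j - q i j"
    using weakly_positive_sqrt by blast
  define B where "B = mat m m (\<lambda>(i, j). sqrt T *\<^sub>R s i j)"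
  have "mat_star B * B = P"
  proof (rule eq_matI)
    fix i j assume "i < dim_row P" "j < dim_col P"
    then have ij: "i < m" "j < m" using asm by auto
    have "(mat_star B * B) $$ (i, j) = (\<Sum>k<m. star (sqrt T *\<^sub>R s k i) * sqrt T *\<^sub>R s k j)"
      using ij by (simp add: mat_star_def B_def scalar_prod_def atLeast0LessThan)
    also have "\<dots> = (\<Sum>k<m. T *\<^sub>R (s i k * s k j))"
      using ij T by (intro sum.cong refl) (simp add: star_scaleR s(1))
    also have "\<dots> = T *\<^sub>R mat_mult m s s i j" by (simp add: mat_mult_def scaleR_sum_right)
    also have "\<dots> = P $$ (i, j)" using s(2)[OF ij] T by (simp add: q_def p_def)
    finally show "(mat_star B * B) $$ (i, j) = P $$ (i, j)" .
  qed (use asm in \<open>auto simp: mat_star_def B_def\<close>)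
  then show "positive_mat m P"
    unfolding positive_mat_def by (intro bexI[of _ B]) (auto simp: B_def)
qed

section \<open>Matrix-valued u.c.p. maps\<close>

lemma positive_elem_complex: "positive_elem (z::complex) \<longleftrightarrow> z \<in> \<real>\<^sub>\<ge>\<^sub>0"
proof
  assume "positive_elem z"
  then obtain b where "z = cnj b * b" by (auto simp: positive_elem_def star_complex_def)
  then have "z = of_real ((cmod b)\<^sup>2)" by (simp only: complex_norm_square mult.commute)
  then show "z \<in> \<real>\<^sub>\<ge>\<^sub>0" by (metis nonneg_Reals_of_real_iff zero_le_power2)
next
  assume "z \<in> \<real>\<^sub>\<ge>\<^sub>0"
  then obtain r where r: "z = of_real r" "r \<ge> 0" by (auto elim: nonneg_Reals_cases)
  then have "z = star (of_real (sqrt r)) * of_real (sqrt r)"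
    by (simp add: star_complex_def flip: of_real_mult)
  then show "positive_elem z" unfolding positive_elem_def by blast
qed

text \<open>The value at \<open>v\<close> of the quadratic form of the block matrix with blocks \<open>F i j\<close>; a vector of
  length \<open>m n\<close> is split into \<open>m\<close> pieces of length \<open>n\<close>.\<close>

definition block_form :: "nat \<Rightarrow> nat \<Rightarrow> (nat \<Rightarrow> nat \<Rightarrow> complex mat) \<Rightarrow> (nat \<Rightarrow> nat \<Rightarrow> complex) \<Rightarrow> complex"
  where "block_form m n F v =
    (\<Sum>i<m. \<Sum>p<n. \<Sum>j<m. \<Sum>q<n. cnj (v i p) * F i j $$ (p, q) * v j q)"

lemma sum_lessThan_mult:
  fixes f :: "nat \<Rightarrow> 'a::comm_monoid_add"
  shows "(\<Sum>I<m * n. f I) = (\<Sum>i<m. \<Sum>p<n. f (i * n + p))"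
proof -
  have "(\<Sum>I<m * n. f I) = (\<Sum>i<m. sum f {i * n..<i * n + n})"
    by (rule sum.nat_group[symmetric])
  also have "\<dots> = (\<Sum>i<m. \<Sum>p<n. f (i * n + p))"
  proof (rule sum.cong[OF refl])
    fix i
    show "sum f {i * n..<i * n + n} = (\<Sum>p<n. f (i * n + p))"
      using sum.shift_bounds_nat_ivl[of f 0 "i * n" n] by (simp add: atLeast0LessThan add.commute)
  qed
  finally show ?thesis .
qed

lemma positive_block_amplify_iff:
  "positive_mat (m * n) (block_amplify m n \<phi> P)
    \<longleftrightarrow> (\<forall>v. block_form m n (\<lambda>i j. \<phi> (P $$ (i, j))) v \<in> \<real>\<^sub>\<ge>\<^sub>0)"
proof -
  define M where "M I J = \<phi> (P $$ (I div n, J div n)) $$ (I mod n, J mod n)" for I J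
  have form: "column_ip (m * n) \<xi> (mat_app (m * n) M \<xi>)
      = block_form m n (\<lambda>i j. \<phi> (P $$ (i, j))) (\<lambda>i p. \<xi> (i * n + p))" for \<xi> :: "nat \<Rightarrow> complex"
    unfolding column_ip_def mat_app_def sum_lessThan_mult block_form_def sum_distrib_left M_def
    by (intro sum.cong refl) (simp add: star_complex_def mult.assoc)
  have "positive_mat (m * n) (block_amplify m n \<phi> P)
      \<longleftrightarrow> weakly_positive (m * n) (\<lambda>I J. block_amplify m n \<phi> P $$ (I, J))"
    by (simp add: positive_mat_iff_weakly_positive block_amplify_def)
  also have "\<dots> \<longleftrightarrow> weakly_positive (m * n) M"
    by (rule weakly_positive_cong) (simp add: block_amplify_def M_def)
  also have "\<dots> \<longleftrightarrow> (\<forall>\<xi>. block_form m n (\<lambda>i j. \<phi> (P $$ (i, j))) (\<lambda>i p. \<xi> (i * n + p)) \<in> \<real>\<^sub>\<ge>\<^sub>0)"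
    by (simp add: weakly_positive_def positive_elem_complex form)
  also have "\<dots> \<longleftrightarrow> (\<forall>v. block_form m n (\<lambda>i j. \<phi> (P $$ (i, j))) v \<in> \<real>\<^sub>\<ge>\<^sub>0)"
  proof (intro iffI allI)
    fix v
    assume "\<forall>\<xi>. block_form m n (\<lambda>i j. \<phi> (P $$ (i, j))) (\<lambda>i p. \<xi> (i * n + p)) \<in> \<real>\<^sub>\<ge>\<^sub>0"
    then have "block_form m n (\<lambda>i j. \<phi> (P $$ (i, j))) (\<lambda>i p. v ((i * n + p) div n) ((i * n + p) mod n)) \<in> \<real>\<^sub>\<ge>\<^sub>0"
      by (rule allE[where x="\<lambda>I. v (I div n) (I mod n)"])
    then show "block_form m n (\<lambda>i j. \<phi> (P $$ (i, j))) v \<in> \<real>\<^sub>\<ge>\<^sub>0"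
      by (simp add: block_form_def)
  qed simp
  finally show ?thesis .
qed

lemma UCP_iff:
  "\<phi> \<in> UCP n X \<longleftrightarrow> \<phi> \<in> X \<rightarrow>\<^sub>E carrier_mat n n \<and>
    (\<forall>x\<in>X. \<forall>y\<in>X. \<phi> (x + y) = \<phi> x + \<phi> y) \<and>
    (\<forall>c. \<forall>x\<in>X. \<phi> (c *\<^sub>C x) = c \<cdot>\<^sub>m \<phi> x) \<and>
    \<phi> 1 = 1\<^sub>m n \<and>
    (\<forall>m\<ge>1. \<forall>P \<in> mat_over m X. positive_mat m P \<longrightarrow>
      (\<forall>v. block_form m n (\<lambda>i j. \<phi> (P $$ (i, j))) v \<in> \<real>\<^sub>\<ge>\<^sub>0))"
  by (simp add: UCP_def positive_block_amplify_iff)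

context
  fixes X :: "'a::unital_cstar_algebra set"
  assumes X: "operator_system X"
begin

lemma op_sys_add: "x \<in> X \<Longrightarrow> y \<in> X \<Longrightarrow> x + y \<in> X"
  and op_sys_one: "1 \<in> X"
  and op_sys_star: "x \<in> X \<Longrightarrow> star x \<in> X"
  and op_sys_scaleC: "x \<in> X \<Longrightarrow> c *\<^sub>C x \<in> X"
  and op_sys_closed: "closed X"
  using X by (auto simp: operator_system_def)

lemma op_sys_scaleR: "x \<in> X \<Longrightarrow> r *\<^sub>R x \<in> X"
  by (metis op_sys_scaleC scaleC_of_real)

lemma op_sys_zero: "0 \<in> X" using op_sys_scaleR[OF op_sys_one, of 0] by simp

lemma op_sys_minus: "x \<in> X \<Longrightarrow> - x \<in> X" using op_sys_scaleR[of x "- 1"] by simp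

lemma op_sys_diff: "x \<in> X \<Longrightarrow> y \<in> X \<Longrightarrow> x - y \<in> X"
  using op_sys_add[of x "- y"] op_sys_minus by simp

lemma op_sys_sum: "(\<And>i. i \<in> I \<Longrightarrow> f i \<in> X) \<Longrightarrow> sum f I \<in> X"
  by (induction I rule: infinite_finite_induct) (auto simp: op_sys_zero op_sys_add)

lemma op_sys_decomposition:
  assumes "x \<in> X"
  obtains h k where "h \<in> sa_part X" "k \<in> sa_part X" "x = h + \<i> *\<^sub>C k" "norm h \<le> norm x" "norm k \<le> norm x"
proof -
  obtain h k where hk: "star h = h" "star k = k" "x = h + \<i> *\<^sub>C k"
    "h = (1/2) *\<^sub>R (x + star x)" "k = (- \<i> / 2) *\<^sub>C (x - star x)"
    by (rule sa_decomposition)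
  have "h \<in> X" "k \<in> X"
    unfolding hk(4,5)
    by (intro op_sys_scaleR op_sys_scaleC op_sys_add op_sys_diff op_sys_star assms)+
  show thesis
  proof (rule that)
    show "h \<in> sa_part X" "k \<in> sa_part X"
      using \<open>h \<in> X\<close> \<open>k \<in> X\<close> hk(1,2) by (simp_all only: sa_part_def mem_Collect_eq)
    show "norm h \<le> norm x" "norm k \<le> norm x"
      unfolding hk(3) by (rule norm_sa_part_le[OF hk(1,2)])+
  qed (rule hk(3))
qed

context
  fixes n \<phi> assumes \<phi>: "\<phi> \<in> UCP n X"
begin

lemma UCP_carrier: "x \<in> X \<Longrightarrow> \<phi> x \<in> carrier_mat n n"
  and UCP_positive: "\<lbrakk>1 \<le> m; P \<in> mat_over m X; positive_mat m P\<rbrakk>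
    \<Longrightarrow> block_form m n (\<lambda>i j. \<phi> (P $$ (i, j))) v \<in> \<real>\<^sub>\<ge>\<^sub>0"
  using \<phi> by (auto simp: UCP_iff)

lemma UCP_entry_add:
  assumes "x \<in> X" "y \<in> X" "p < n" "q < n"
  shows "\<phi> (x + y) $$ (p, q) = \<phi> x $$ (p, q) + \<phi> y $$ (p, q)"
proof -
  have "\<phi> (x + y) = \<phi> x + \<phi> y" using \<phi> assms by (auto simp: UCP_iff)
  then show ?thesis using UCP_carrier[OF assms(1)] UCP_carrier[OF assms(2)] assms by simp
qed

lemma UCP_entry_scaleC:
  assumes "x \<in> X" "p < n" "q < n"
  shows "\<phi> (c *\<^sub>C x) $$ (p, q) = c * \<phi> x $$ (p, q)"
proof -
  have "\<phi> (c *\<^sub>C x) = c \<cdot>\<^sub>m \<phi> x" using \<phi> assms by (auto simp: UCP_iff)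
  then show ?thesis using UCP_carrier[OF assms(1)] assms by simp
qed

lemma UCP_entry_scaleR:
  "x \<in> X \<Longrightarrow> p < n \<Longrightarrow> q < n \<Longrightarrow> \<phi> (r *\<^sub>R x) $$ (p, q) = of_real r * \<phi> x $$ (p, q)"
  using UCP_entry_scaleC[of x p q "of_real r"] by (simp add: scaleC_of_real)

lemma UCP_entry_diff:
  assumes "x \<in> X" "y \<in> X" "p < n" "q < n"
  shows "\<phi> (x - y) $$ (p, q) = \<phi> x $$ (p, q) - \<phi> y $$ (p, q)"
  using UCP_entry_add[of x "(- 1) *\<^sub>R y" p q] UCP_entry_scaleR[of y p q "- 1"] assms op_sys_scaleR[of y "- 1"] by simp

lemma UCP_entry_one: "p < n \<Longrightarrow> q < n \<Longrightarrow> \<phi> 1 $$ (p, q) = (if p = q then 1 else 0)"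
  using \<phi> by (simp add: UCP_iff)

lemma UCP_entry_zero: "p < n \<Longrightarrow> q < n \<Longrightarrow> \<phi> 0 $$ (p, q) = 0"
  using UCP_entry_scaleR[OF op_sys_one, of p q 0] by simp

lemma UCP_entry_sum:
  assumes "\<And>i. i \<in> I \<Longrightarrow> f i \<in> X" "p < n" "q < n"
  shows "\<phi> (sum f I) $$ (p, q) = (\<Sum>i\<in>I. \<phi> (f i) $$ (p, q))"
  using assms
  by (induction I rule: infinite_finite_induct) (simp_all add: UCP_entry_zero UCP_entry_add op_sys_sum)

end

end

lemma positive_mat_one_iff:
  fixes x :: "'a::unital_cstar_algebra"
  shows "positive_mat 1 (mat 1 1 (\<lambda>_. x)) \<longleftrightarrow> positive_elem x"
proof -
  have "weakly_positive 1 (\<lambda>i j. mat 1 1 (\<lambda>_. x) $$ (i, j)) \<longleftrightarrow> (\<forall>\<xi>. positive_elem (star (\<xi> 0) * x * \<xi> (0::nat)))"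
    by (simp add: weakly_positive_def column_ip_def mat_app_def mult.assoc)
  also have "\<dots> \<longleftrightarrow> positive_elem x"
  proof
    assume "\<forall>\<xi>. positive_elem (star (\<xi> 0) * x * \<xi> (0::nat))"
    from spec[OF this, of "\<lambda>_. 1"] show "positive_elem x" by simp
  qed (simp add: positive_elem_sandwich)
  finally show ?thesis by (simp add: positive_mat_iff_weakly_positive)
qed

lemma mat_over_one: "x \<in> X \<Longrightarrow> mat 1 1 (\<lambda>_. x) \<in> mat_over 1 X"
  by (auto simp: mat_over_def elements_mat_def)

lemma mat_over_iff: "P \<in> mat_over m X \<longleftrightarrow> P \<in> carrier_mat m m \<and> (\<forall>i<m. \<forall>j<m. P $$ (i, j) \<in> X)"
proof (cases "P \<in> carrier_mat m m")
  case True
  then have "elements_mat P = (\<lambda>(i, j). P $$ (i, j)) ` ({..<m} \<times> {..<m})"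
    by (auto simp: elements_mat_def)
  then show ?thesis using True by (auto simp: mat_over_def)
qed (simp add: mat_over_def)

text \<open>Polarisation: comparing the forms of \<open>c - a\<close> and \<open>c + a\<close> at \<open>v + t w\<close> and \<open>v - t w\<close>, where
  \<open>w = a v\<close>, and choosing \<open>t = 1 / c\<close>.\<close>

lemma hermitian_form_bound:
  fixes a :: "nat \<Rightarrow> nat \<Rightarrow> complex"
  assumes "weakly_positive n (\<lambda>i j. complex_of_real c * mat_id i j - a i j)"
    and "weakly_positive n (\<lambda>i j. complex_of_real c * mat_id i j + a i j)" and c: "c \<ge> 0"
  shows "Re (column_ip n (mat_app n a v) (mat_app n a v)) \<le> c\<^sup>2 * Re (column_ip n v v)"
proof -
  have herm: "star (a i j) = a j i" if "i < n" "j < n" for i j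
    using weakly_positive_hermitian[OF assms(2) that]
    by (cases "i = j") (auto simp: mat_id_def star_complex_def)
  define w where "w = mat_app n a v"
  have scale: "mat_app n (\<lambda>i j. complex_of_real c * mat_id i j) x = (\<lambda>i. c *\<^sub>R mat_app n mat_id x i)" for x
    by (simp only: scaleR_conv_of_real[symmetric] mat_app_mat_scaleR)
  have id: "column_ip n x (mat_app n mat_id x) = column_ip n x x" for x :: "nat \<Rightarrow> complex"
    by (intro column_ip_cong mat_app_id refl)
  have m: "0 \<le> c * Re (column_ip n x x) - Re (column_ip n x (mat_app n a x))" for x
    using assms(1)[unfolded weakly_positive_def, THEN spec, of x]
    by (simp add: scale mat_app_mat_diff column_ip_diff_right column_ip_scaleR_right id
        positive_elem_complex complex_nonneg_Reals_iff)
  have p: "0 \<le> c * Re (column_ip n x x) + Re (column_ip n x (mat_app n a x))" for x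
    using assms(2)[unfolded weakly_positive_def, THEN spec, of x]
    by (simp add: scale mat_app_mat_add column_ip_add_right column_ip_scaleR_right id
        positive_elem_complex complex_nonneg_Reals_iff)
  have key: "0 \<le> 2 * c * (Re (column_ip n v v) + t\<^sup>2 * Re (column_ip n w w)) - 4 * t * Re (column_ip n w w)" for t :: real
  proof -
    define y where "y i = t *\<^sub>R w i" for i
    have vy: "column_ip n v (mat_app n a y) = t *\<^sub>R column_ip n w w"
    proof -
      have "column_ip n v (mat_app n a y) = column_ip n w y"
        by (simp add: w_def column_ip_adjoint[OF herm])
      then show ?thesis by (simp add: y_def[abs_def] column_ip_scaleR_right)
    qed
    have left: "column_ip n y u = t *\<^sub>R column_ip n w u" for u
      by (simp add: column_ip_def y_def star_scaleR scaleR_sum_right)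
    have yv: "column_ip n y (mat_app n a v) = t *\<^sub>R column_ip n w w"
      by (simp add: left flip: w_def)
    have yy: "column_ip n y y = t\<^sup>2 *\<^sub>R column_ip n w w"
      by (simp add: left) (simp add: y_def[abs_def] column_ip_scaleR_right power2_eq_square)
    show ?thesis
      using m[of "\<lambda>i. v i + y i"] p[of "\<lambda>i. v i - y i"]
      by (simp add: mat_app_add mat_app_diff column_ip_add_left column_ip_add_right column_ip_diff_left
          column_ip_diff_right vy yv yy algebra_simps)
  qed
  have "Re (column_ip n w w) \<le> c\<^sup>2 * Re (column_ip n v v)"
  proof (cases "c = 0")
    case True
    then show ?thesis using key[of 1] by simp
  next
    case False
    then have "c > 0" using c by simp
    then show ?thesis using key[of "1 / c"] by (simp add: field_simps power2_eq_square)
  qed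
  then show ?thesis by (simp add: w_def)
qed

lemma l2_norm_conv_column_ip:
  assumes "v \<in> carrier_vec n"
  shows "(l2_norm v)\<^sup>2 = Re (column_ip n (\<lambda>i. v $ i) (\<lambda>i. v $ i))"
proof -
  have "(l2_norm v)\<^sup>2 = (\<Sum>i<n. (cmod (v $ i))\<^sup>2)"
    using assms by (simp add: l2_norm_def L2_set_def sum_nonneg)
  also have "\<dots> = (\<Sum>i<n. Re (cnj (v $ i) * v $ i))"
    by (intro sum.cong refl) (simp only: cmod_power2, simp add: power2_eq_square)
  finally show ?thesis by (simp add: column_ip_def star_complex_def)
qed

lemma l2_norm_nonneg: "0 \<le> l2_norm v"
  by (simp add: l2_norm_def)

lemma op_norm_le:
  assumes A: "A \<in> carrier_mat n n" and c: "c \<ge> 0"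
    and "weakly_positive n (\<lambda>i j. complex_of_real c * mat_id i j - A $$ (i, j))"
    and "weakly_positive n (\<lambda>i j. complex_of_real c * mat_id i j + A $$ (i, j))"
  shows "op_norm A \<le> c"
  unfolding op_norm_def
proof (rule cSUP_least)
  have "l2_norm (0\<^sub>v n) = 0" by (simp add: l2_norm_def L2_set_def)
  then show "{v \<in> carrier_vec (dim_col A). l2_norm v \<le> 1} \<noteq> {}"
    using A by (auto intro!: exI[of _ "0\<^sub>v n"])
  fix v assume "v \<in> {v \<in> carrier_vec (dim_col A). l2_norm v \<le> 1}"
  then have v: "v \<in> carrier_vec n" "l2_norm v \<le> 1" using A by auto
  have Av: "A *\<^sub>v v \<in> carrier_vec n" using A v by simp
  have "column_ip n (\<lambda>i. (A *\<^sub>v v) $ i) (\<lambda>i. (A *\<^sub>v v) $ i)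
      = column_ip n (mat_app n (\<lambda>i j. A $$ (i, j)) (\<lambda>i. v $ i)) (mat_app n (\<lambda>i j. A $$ (i, j)) (\<lambda>i. v $ i))"
    using A v by (intro column_ip_cong) (auto simp: mat_app_def scalar_prod_def atLeast0LessThan)
  then have "(l2_norm (A *\<^sub>v v))\<^sup>2 \<le> c\<^sup>2 * (l2_norm v)\<^sup>2"
    using hermitian_form_bound[OF assms(3,4) c, of "\<lambda>i. v $ i"]
    by (simp add: l2_norm_conv_column_ip[OF Av] l2_norm_conv_column_ip[OF v(1)])
  also have "\<dots> \<le> c\<^sup>2"
    using v l2_norm_nonneg[of v] by (intro mult_left_le) (auto simp: power_le_one)
  finally show "l2_norm (A *\<^sub>v v) \<le> c" using c by (rule power2_le_imp_le)
qed

lemma entry_le_op_norm: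
  assumes A: "A \<in> carrier_mat n n" and pq: "p < n" "q < n"
  shows "cmod (A $$ (p, q)) \<le> op_norm A"
proof -
  let ?S = "{v \<in> carrier_vec (dim_col A). l2_norm v \<le> 1}"
  have le: "cmod (w $ i) \<le> l2_norm w" if "i < n" "w \<in> carrier_vec n" for w i
    using that unfolding l2_norm_def by (intro member_le_L2_set) auto
  have "l2_norm (A *\<^sub>v v) \<le> (\<Sum>i<n. \<Sum>j<n. cmod (A $$ (i, j)))" if "v \<in> ?S" for v
  proof -
    have v: "v \<in> carrier_vec n" "l2_norm v \<le> 1" using that A by auto
    have "l2_norm (A *\<^sub>v v) \<le> (\<Sum>i<n. cmod ((A *\<^sub>v v) $ i))"
      unfolding l2_norm_def using A by (intro order_trans[OF L2_set_le_sum]) auto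
    also have "\<dots> \<le> (\<Sum>i<n. \<Sum>j<n. cmod (A $$ (i, j)))"
    proof (rule sum_mono)
      fix i assume "i \<in> {..<n}"
      then have "(A *\<^sub>v v) $ i = (\<Sum>j<n. A $$ (i, j) * v $ j)"
        using A v by (simp add: scalar_prod_def atLeast0LessThan)
      also have "cmod \<dots> \<le> (\<Sum>j<n. cmod (A $$ (i, j)))"
      proof (rule sum_norm_le)
        fix j assume "j \<in> {..<n}"
        then have "cmod (v $ j) \<le> 1" using le[of j v] v by simp
        then show "cmod (A $$ (i, j) * v $ j) \<le> cmod (A $$ (i, j))"
          by (simp add: norm_mult mult_left_le)
      qed
      finally show "cmod ((A *\<^sub>v v) $ i) \<le> (\<Sum>j<n. cmod (A $$ (i, j)))" .
    qed
    finally show ?thesis .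
  qed
  then have bdd: "bdd_above ((\<lambda>v. l2_norm (A *\<^sub>v v)) ` ?S)"
    by (intro bdd_aboveI2)
  have "l2_norm (unit_vec n q) = 1"
  proof -
    have "l2_norm (unit_vec n q) = sqrt (\<Sum>i<n. if i = q then 1 else 0)"
      unfolding l2_norm_def L2_set_def using pq by (intro arg_cong[where f=sqrt] sum.cong) auto
    then show ?thesis using pq by simp
  qed
  then have "unit_vec n q \<in> ?S" using A by simp
  then have "l2_norm (A *\<^sub>v unit_vec n q) \<le> op_norm A"
    unfolding op_norm_def by (intro cSUP_upper bdd)
  moreover have "cmod ((A *\<^sub>v unit_vec n q) $ p) \<le> l2_norm (A *\<^sub>v unit_vec n q)"
    using A pq by (intro le) auto
  moreover have "(A *\<^sub>v unit_vec n q) $ p = A $$ (p, q)"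
    using A pq by simp
  ultimately show ?thesis by simp
qed

text \<open>The constant \<open>1\<close> does not depend on \<open>n\<close>; this uniformity is what makes one Lip-norm serve
  all matrix sizes at once.\<close>

lemma UCP_op_norm_le:
  assumes X: "operator_system X" and \<phi>: "\<phi> \<in> UCP n X" and x: "x \<in> sa_part X"
  shows "op_norm (\<phi> x) \<le> norm x"
proof -
  have xX: "x \<in> X" and sx: "star x = x" using x by (auto simp: sa_part_def)
  have pos: "weakly_positive n (\<lambda>i j. \<phi> y $$ (i, j))" if y: "y \<in> X" "positive_elem y" for y
  proof -
    have "column_ip n v (mat_app n (\<lambda>i j. \<phi> y $$ (i, j)) v)
        = block_form 1 n (\<lambda>i j. \<phi> (mat 1 1 (\<lambda>_. y) $$ (i, j))) (\<lambda>_. v)" for v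
      by (simp add: block_form_def column_ip_def mat_app_def sum_distrib_left star_complex_def mult.assoc)
    then show ?thesis
      using UCP_positive[OF X \<phi> order_refl mat_over_one[OF y(1)]] y(2)
      unfolding weakly_positive_def positive_elem_complex positive_mat_one_iff by simp
  qed
  show ?thesis
  proof (rule op_norm_le)
    show "\<phi> x \<in> carrier_mat n n" by (rule UCP_carrier[OF X \<phi> xX])
    have "weakly_positive n (\<lambda>i j. \<phi> (norm x *\<^sub>R 1 - x) $$ (i, j))"
      by (rule pos) (auto simp: sx positive_elem_shift_minus xX op_sys_diff[OF X] op_sys_one[OF X] op_sys_scaleR[OF X])
    then show "weakly_positive n (\<lambda>i j. complex_of_real (norm x) * mat_id i j - \<phi> x $$ (i, j))"
      by (subst weakly_positive_cong[where p'="\<lambda>i j. \<phi> (norm x *\<^sub>R 1 - x) $$ (i, j)"])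
        (auto simp: UCP_entry_diff[OF X \<phi>] UCP_entry_scaleR[OF X \<phi>] UCP_entry_one[OF X \<phi>] xX mat_id_def
          op_sys_one[OF X] op_sys_scaleR[OF X])
    have "weakly_positive n (\<lambda>i j. \<phi> (norm x *\<^sub>R 1 + x) $$ (i, j))"
      by (rule pos) (auto simp: sx positive_elem_shift xX op_sys_add[OF X] op_sys_one[OF X] op_sys_scaleR[OF X])
    then show "weakly_positive n (\<lambda>i j. complex_of_real (norm x) * mat_id i j + \<phi> x $$ (i, j))"
      by (subst weakly_positive_cong[where p'="\<lambda>i j. \<phi> (norm x *\<^sub>R 1 + x) $$ (i, j)"])
        (auto simp: UCP_entry_add[OF X \<phi>] UCP_entry_scaleR[OF X \<phi>] UCP_entry_one[OF X \<phi>] xX mat_id_def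
          op_sys_one[OF X] op_sys_scaleR[OF X])
  qed simp
qed

lemma UCP_entry_le:
  assumes X: "operator_system X" and \<phi>: "\<phi> \<in> UCP n X" and x: "x \<in> sa_part X" and pq: "p < n" "q < n"
  shows "cmod (\<phi> x $$ (p, q)) \<le> norm x"
proof -
  have "x \<in> X" using x by (simp add: sa_part_def)
  from entry_le_op_norm[OF UCP_carrier[OF X \<phi> this] pq] UCP_op_norm_le[OF X \<phi> x] show ?thesis by simp
qed

lemma UCP_entry_le2:
  assumes X: "operator_system X" and \<phi>: "\<phi> \<in> UCP n X" and x: "x \<in> X" and pq: "p < n" "q < n"
  shows "cmod (\<phi> x $$ (p, q)) \<le> 2 * norm x"
proof -
  obtain h k where hk: "h \<in> sa_part X" "k \<in> sa_part X" "x = h + \<i> *\<^sub>C k" "norm h \<le> norm x" "norm k \<le> norm x"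
    using op_sys_decomposition[OF X x] .
  have hX: "h \<in> X" "k \<in> X" using hk by (auto simp: sa_part_def)
  have "\<phi> x $$ (p, q) = \<phi> h $$ (p, q) + \<i> * \<phi> k $$ (p, q)"
    unfolding hk(3) using hX pq
    by (simp add: UCP_entry_add[OF X \<phi>] UCP_entry_scaleC[OF X \<phi>] op_sys_scaleC[OF X])
  also have "cmod \<dots> \<le> cmod (\<phi> h $$ (p, q)) + cmod (\<phi> k $$ (p, q))"
    by (rule order_trans[OF norm_triangle_ineq]) (simp add: norm_mult)
  finally show ?thesis
    using UCP_entry_le[OF X \<phi> hk(1) pq] UCP_entry_le[OF X \<phi> hk(2) pq] hk(4,5) by linarith
qed

lemma nonneg_Reals_sum: "(\<And>i. i \<in> I \<Longrightarrow> f i \<in> \<real>\<^sub>\<ge>\<^sub>0) \<Longrightarrow> (sum f I :: complex) \<in> \<real>\<^sub>\<ge>\<^sub>0"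
  by (induction I rule: infinite_finite_induct) auto

lemma state_form_expand:
  assumes \<mu>: "is_state \<mu>"
  shows "\<mu> (star (\<Sum>p\<in>S. a p *\<^sub>C \<eta> p) * x * (\<Sum>q\<in>S. b q *\<^sub>C \<eta> q))
    = (\<Sum>p\<in>S. \<Sum>q\<in>S. cnj (a p) * \<mu> (star (\<eta> p) * x * \<eta> q) * b q)"
proof -
  have "star (\<Sum>p\<in>S. a p *\<^sub>C \<eta> p) * x = (\<Sum>p\<in>S. cnj (a p) *\<^sub>C (star (\<eta> p) * x))"
    by (simp add: star_sum star_scaleC sum_distrib_right mult_scaleC_left)
  then have "star (\<Sum>p\<in>S. a p *\<^sub>C \<eta> p) * x * (\<Sum>q\<in>S. b q *\<^sub>C \<eta> q)
      = (\<Sum>p\<in>S. \<Sum>q\<in>S. (cnj (a p) * b q) *\<^sub>C (star (\<eta> p) * x * \<eta> q))"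
    by (simp add: sum_product mult_scaleC_left mult_scaleC_right scaleC_scaleC mult.commute)
  then show ?thesis
    by (simp add: state_sum[OF \<mu>] state_scaleC[OF \<mu>] mult_ac)
qed

lemma state_positive_form:
  assumes \<mu>: "is_state \<mu>" and P: "weakly_positive m p"
  shows "(\<Sum>i<m. \<Sum>j<m. \<mu> (star (\<zeta> i) * p i j * \<zeta> j)) \<in> \<real>\<^sub>\<ge>\<^sub>0"
proof -
  have "(\<Sum>i<m. \<Sum>j<m. \<mu> (star (\<zeta> i) * p i j * \<zeta> j)) = \<mu> (column_ip m \<zeta> (mat_app m p \<zeta>))"
    by (simp add: column_ip_def mat_app_def sum_distrib_left state_sum[OF \<mu>] mult.assoc)
  then show ?thesis using P by (simp add: weakly_positive_def state_pos[OF \<mu>])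
qed

text \<open>Compressing the GNS representation of a state to finitely many orthonormal vectors gives a
  u.c.p. map. The \<open>\<eta> p\<close> that vanish are placeholders: there the state itself is put on the
  diagonal, so that the map stays unital.\<close>

lemma vector_state_UCP:
  assumes X: "operator_system X" and \<mu>: "is_state \<mu>"
    and orth: "\<And>p q. \<mu> (star (\<eta> p) * \<eta> q) = (if p = q \<and> \<eta> p \<noteq> 0 then 1 else 0)"
  shows "restrict (\<lambda>x. mat n n (\<lambda>(p, q). \<mu> (star (\<eta> p) * x * \<eta> q) + (if p = q \<and> \<eta> p = 0 then \<mu> x else 0))) X
    \<in> UCP n X"
    (is "restrict ?\<psi> X \<in> _")
  unfolding UCP_iff
proof (intro conjI ballI allI impI)
  show "restrict ?\<psi> X \<in> X \<rightarrow>\<^sub>E carrier_mat n n" by auto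
  show "restrict ?\<psi> X (x + y) = restrict ?\<psi> X x + restrict ?\<psi> X y" if "x \<in> X" "y \<in> X" for x y
    using that
    by (intro eq_matI) (auto simp: op_sys_add[OF X] state_add[OF \<mu>] distrib_left distrib_right)
  show "restrict ?\<psi> X (c *\<^sub>C x) = c \<cdot>\<^sub>m restrict ?\<psi> X x" if "x \<in> X" for x c
    using that
    by (intro eq_matI) (auto simp: op_sys_scaleC[OF X] state_scaleC[OF \<mu>] mult_scaleC_left mult_scaleC_right
        distrib_left)
  show "restrict ?\<psi> X 1 = 1\<^sub>m n"
    by (intro eq_matI) (auto simp: op_sys_one[OF X] orth state_one[OF \<mu>])
  fix m P and v :: "nat \<Rightarrow> nat \<Rightarrow> complex" assume P: "P \<in> mat_over m X" "positive_mat m P"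
  define p where "p i j = P $$ (i, j)" for i j
  have wp: "weakly_positive m p" using P by (simp add: positive_mat_iff_weakly_positive p_def[abs_def])
  define \<zeta> where "\<zeta> i = (\<Sum>k\<in>{..<n}. v i k *\<^sub>C \<eta> k)" for i
  have "block_form m n (\<lambda>i j. restrict ?\<psi> X (P $$ (i, j))) v
      = (\<Sum>i<m. \<Sum>k<n. \<Sum>j<m. \<Sum>l<n. cnj (v i k) * \<mu> (star (\<eta> k) * p i j * \<eta> l) * v j l)
      + (\<Sum>i<m. \<Sum>k<n. \<Sum>j<m. \<Sum>l<n. if k = l then (if \<eta> k = 0 then cnj (v i k) * \<mu> (p i j) * v j k else 0) else 0)"
    unfolding block_form_def sum.distrib[symmetric]
    using P(1) by (intro sum.cong refl) (auto simp: mat_over_iff p_def algebra_simps)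
  also have "(\<Sum>i<m. \<Sum>k<n. \<Sum>j<m. \<Sum>l<n. cnj (v i k) * \<mu> (star (\<eta> k) * p i j * \<eta> l) * v j l)
      = (\<Sum>i<m. \<Sum>j<m. \<mu> (star (\<zeta> i) * p i j * \<zeta> j))"
    unfolding \<zeta>_def state_form_expand[OF \<mu>]
    by (rule sum.cong[OF refl], rule sum.swap)
  also have "(\<Sum>i<m. \<Sum>k<n. \<Sum>j<m. \<Sum>l<n. if k = l then (if \<eta> k = 0 then cnj (v i k) * \<mu> (p i j) * v j k else 0) else 0)
      = (\<Sum>i<m. \<Sum>k<n. \<Sum>j<m. if \<eta> k = 0 then cnj (v i k) * \<mu> (p i j) * v j k else 0)"
    by (intro sum.cong refl) simp
  also have "\<dots> = (\<Sum>k<n. \<Sum>i<m. \<Sum>j<m. if \<eta> k = 0 then cnj (v i k) * \<mu> (p i j) * v j k else 0)"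
    by (rule sum.swap)
  also have "\<dots> = (\<Sum>k<n. if \<eta> k = 0 then \<Sum>i<m. \<Sum>j<m. \<mu> (star (v i k *\<^sub>C 1) * p i j * (v j k *\<^sub>C 1)) else 0)"
    by (intro sum.cong refl)
      (simp add: star_scaleC mult_scaleC_left mult_scaleC_right scaleC_scaleC state_scaleC[OF \<mu>] mult_ac)
  finally have form: "block_form m n (\<lambda>i j. restrict ?\<psi> X (P $$ (i, j))) v
      = (\<Sum>i<m. \<Sum>j<m. \<mu> (star (\<zeta> i) * p i j * \<zeta> j))
      + (\<Sum>k<n. if \<eta> k = 0 then \<Sum>i<m. \<Sum>j<m. \<mu> (star (v i k *\<^sub>C 1) * p i j * (v j k *\<^sub>C 1)) else 0)" .
  show "block_form m n (\<lambda>i j. restrict ?\<psi> X (P $$ (i, j))) v \<in> \<real>\<^sub>\<ge>\<^sub>0"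
    unfolding form
  proof (intro nonneg_Reals_add_I state_positive_form[OF \<mu> wp] nonneg_Reals_sum)
    fix k
    show "(if \<eta> k = 0 then \<Sum>i<m. \<Sum>j<m. \<mu> (star (v i k *\<^sub>C 1) * p i j * (v j k *\<^sub>C 1)) else 0) \<in> \<real>\<^sub>\<ge>\<^sub>0"
      using state_positive_form[OF \<mu> wp, of "\<lambda>i. v i k *\<^sub>C 1"] by simp
  qed
qed

lemma state_UCP:
  assumes X: "operator_system X" and \<mu>: "is_state \<mu>"
  shows "restrict (\<lambda>x. mat n n (\<lambda>(p, q). if p = q then \<mu> x else 0)) X \<in> UCP n X"
  using vector_state_UCP[OF X \<mu>, of "\<lambda>_. 0" n] by (simp add: state_zero[OF \<mu>])

text \<open>Gram--Schmidt orthonormalisation for the semi-definite inner product \<open>\<mu> (a\<^sup>* b)\<close>.\<close>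

lemma state_Gram_Schmidt:
  fixes \<xi> :: "nat \<Rightarrow> 'a::unital_cstar_algebra"
  assumes \<mu>: "is_state \<mu>"
  obtains \<eta> where
    "\<And>p q. \<mu> (star (\<eta> p) * \<eta> q) = (if p = q \<and> \<eta> p \<noteq> 0 then 1 else 0)"
    "\<And>i r. i < m \<Longrightarrow> r = \<xi> i - (\<Sum>p<m. \<mu> (star (\<eta> p) * \<xi> i) *\<^sub>C \<eta> p) \<Longrightarrow> \<mu> (star r * r) = 0"
    "\<And>p. p \<ge> m \<Longrightarrow> \<eta> p = 0"
proof -
  have "\<exists>\<eta>. (\<forall>p q. \<mu> (star (\<eta> p) * \<eta> q) = (if p = q \<and> \<eta> p \<noteq> 0 then 1 else 0)) \<and>
    (\<forall>i<m. \<forall>r. r = \<xi> i - (\<Sum>p<m. \<mu> (star (\<eta> p) * \<xi> i) *\<^sub>C \<eta> p) \<longrightarrow> \<mu> (star r * r) = 0) \<and>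
    (\<forall>p\<ge>m. \<eta> p = 0)" for m
  proof (induction m)
    case 0
    show ?case by (rule exI[of _ "\<lambda>_. 0"]) (simp add: state_zero[OF \<mu>])
  next
    case (Suc m)
    then obtain \<eta> where orth: "\<And>p q. \<mu> (star (\<eta> p) * \<eta> q) = (if p = q \<and> \<eta> p \<noteq> 0 then 1 else 0)"
      and null: "\<And>i r. i < m \<Longrightarrow> r = \<xi> i - (\<Sum>p<m. \<mu> (star (\<eta> p) * \<xi> i) *\<^sub>C \<eta> p) \<Longrightarrow> \<mu> (star r * r) = 0"
      and zero: "\<And>p. p \<ge> m \<Longrightarrow> \<eta> p = 0" by blast
    define r where "r = \<xi> m - (\<Sum>p<m. \<mu> (star (\<eta> p) * \<xi> m) *\<^sub>C \<eta> p)"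
    have proj: "\<mu> (star y * (\<Sum>p<m. c p *\<^sub>C \<eta> p)) = (\<Sum>p<m. c p * \<mu> (star y * \<eta> p))" for y c
      by (simp add: sum_distrib_left mult_scaleC_right state_sum[OF \<mu>] state_scaleC[OF \<mu>])
    have r_orth: "\<mu> (star (\<eta> q) * r) = 0" for q
    proof (cases "\<eta> q = 0")
      case True
      then show ?thesis by (simp add: state_zero[OF \<mu>])
    next
      case False
      then have "q < m" using zero not_le by blast
      have "\<mu> (star (\<eta> q) * (\<Sum>p<m. \<mu> (star (\<eta> p) * \<xi> m) *\<^sub>C \<eta> p))
          = (\<Sum>p<m. if p = q then \<mu> (star (\<eta> q) * \<xi> m) else 0)"
        unfolding proj by (intro sum.cong refl) (use False in \<open>auto simp: orth\<close>)
      then show ?thesis using \<open>q < m\<close> by (simp add: r_def right_diff_distrib state_diff[OF \<mu>])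
    qed
    have r_orth': "\<mu> (star r * \<eta> q) = 0" for q
      using state_star[OF \<mu>, of "star (\<eta> q) * r"] r_orth[of q] by (simp add: star_mult star_star)
    show ?case
    proof (cases "\<mu> (star r * r) = 0")
      case True
      show ?thesis
      proof (rule exI[of _ \<eta>], intro conjI allI impI)
        fix i s assume i: "i < Suc m" and s: "s = \<xi> i - (\<Sum>p<Suc m. \<mu> (star (\<eta> p) * \<xi> i) *\<^sub>C \<eta> p)"
        have s': "s = \<xi> i - (\<Sum>p<m. \<mu> (star (\<eta> p) * \<xi> i) *\<^sub>C \<eta> p)"
          by (simp add: s zero)
        show "\<mu> (star s * s) = 0"
        proof (cases "i = m")
          case eq: True
          then have "s = r" by (simp add: s' r_def)
          then show ?thesis using True by simp
        next
          case False
          then show ?thesis using i null[OF _ s'] by simp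
        qed
      qed (use orth zero in auto)
    next
      case False
      define N where "N = Re (\<mu> (star r * r))"
      have "\<mu> (star r * r) \<in> \<real>\<^sub>\<ge>\<^sub>0" by (rule state_pos[OF \<mu>]) (auto simp: positive_elem_def)
      then have N: "\<mu> (star r * r) = of_real N" "N \<ge> 0"
        by (auto simp: N_def complex_nonneg_Reals_iff complex_eq_iff)
      then have N0: "N > 0" using False by (cases "N = 0") auto
      define e where "e = (1 / sqrt N) *\<^sub>R r"
      have ee: "\<mu> (star e * e) = 1"
        using N0 by (simp add: e_def star_scaleR state_scaleR[OF \<mu>] N flip: of_real_mult)
      then have e0: "e \<noteq> 0" using state_zero[OF \<mu>] by auto
      have eo: "\<mu> (star e * \<eta> q) = 0" "\<mu> (star (\<eta> q) * e) = 0" for q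
        by (simp_all add: e_def star_scaleR state_scaleR[OF \<mu>] r_orth r_orth')
      define \<eta>' where "\<eta>' = \<eta>(m := e)"
      have sum: "(\<Sum>p<Suc m. \<mu> (star (\<eta>' p) * y) *\<^sub>C \<eta>' p)
          = (\<Sum>p<m. \<mu> (star (\<eta> p) * y) *\<^sub>C \<eta> p) + \<mu> (star e * y) *\<^sub>C e" for y
        by (simp add: \<eta>'_def)
      show ?thesis
      proof (rule exI[of _ \<eta>'], intro conjI allI impI)
        fix p q show "\<mu> (star (\<eta>' p) * \<eta>' q) = (if p = q \<and> \<eta>' p \<noteq> 0 then 1 else 0)"
          using e0 by (auto simp: \<eta>'_def ee eo orth state_zero[OF \<mu>])
      next
        fix i s assume i: "i < Suc m" and s: "s = \<xi> i - (\<Sum>p<Suc m. \<mu> (star (\<eta>' p) * \<xi> i) *\<^sub>C \<eta>' p)"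
        define t where "t = \<xi> i - (\<Sum>p<m. \<mu> (star (\<eta> p) * \<xi> i) *\<^sub>C \<eta> p)"
        have st: "s = t - \<mu> (star e * \<xi> i) *\<^sub>C e" unfolding s sum t_def by (simp add: algebra_simps)
        have et: "\<mu> (star e * \<xi> i) = \<mu> (star e * t)"
          by (simp add: t_def right_diff_distrib state_diff[OF \<mu>] proj eo)
        show "\<mu> (star s * s) = 0"
        proof (cases "i = m")
          case True
          then have "t = r" by (simp add: t_def r_def)
          then have "\<mu> (star e * t) = of_real (sqrt N)"
            using N0 by (simp add: e_def star_scaleR state_scaleR[OF \<mu>] N field_simps flip: of_real_mult)
          then have "s = r - sqrt N *\<^sub>R e"
            unfolding st et using \<open>t = r\<close> by (simp add: scaleC_of_real)
          then have "s = 0" using N0 by (simp add: e_def)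
          then show ?thesis by (simp add: state_zero[OF \<mu>])
        next
          case neq: False
          then have t0: "\<mu> (star t * t) = 0" using i null[OF _ t_def] by simp
          have "\<mu> (star e * t) = 0"
            using state_star[OF \<mu>, of "star t * e"] state_null_left[OF \<mu> t0, of e]
            by (simp add: star_mult star_star)
          then have "s = t" unfolding st et by simp
          then show ?thesis using t0 by simp
        qed
      next
        fix p assume "Suc m \<le> p" then show "\<eta>' p = 0" by (auto simp: \<eta>'_def zero)
      qed
    qed
  qed
  from this[of m] show thesis using that by blast
qed

text \<open>If a state is not positive on \<open>\<Sum> \<xi>\<^sub>i\<^sup>* Q\<^sub>i\<^sub>j \<xi>\<^sub>j\<close>, compress its GNS representation to the span of
  the \<open>m\<close> vectors \<open>\<xi>\<^sub>i\<close>. As \<open>m \<le> n\<close>, this gives a u.c.p. map into \<open>M\<^sub>n\<close>, under which the image of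
  \<open>Q\<close> is not positive.\<close>

theorem positive_mat_if_UCP:
  fixes Y :: "'a::unital_cstar_algebra set"
  assumes Y: "operator_system Y" and Q: "Q \<in> mat_over m Y" and mn: "m \<le> n"
    and pos: "\<And>\<psi> v. \<psi> \<in> UCP n Y \<Longrightarrow> block_form m n (\<lambda>i j. \<psi> (Q $$ (i, j))) v \<in> \<real>\<^sub>\<ge>\<^sub>0"
  shows "positive_mat m Q"
proof -
  define q where "q i j = Q $$ (i, j)" for i j
  have "positive_elem (column_ip m \<xi> (mat_app m q \<xi>))" for \<xi>
  proof (rule positive_elem_if_states)
    fix \<mu> :: "'a \<Rightarrow> complex" assume \<mu>: "is_state \<mu>"
    obtain \<eta> where orth: "\<And>p q. \<mu> (star (\<eta> p) * \<eta> q) = (if p = q \<and> \<eta> p \<noteq> 0 then 1 else 0)"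
      and null: "\<And>i r. i < m \<Longrightarrow> r = \<xi> i - (\<Sum>p<m. \<mu> (star (\<eta> p) * \<xi> i) *\<^sub>C \<eta> p) \<Longrightarrow> \<mu> (star r * r) = 0"
      and zero: "\<And>p. p \<ge> m \<Longrightarrow> \<eta> p = 0"
      using state_Gram_Schmidt[OF \<mu>] by blast
    define v where "v i p = \<mu> (star (\<eta> p) * \<xi> i)" for i p
    define \<zeta> where "\<zeta> i = (\<Sum>p\<in>{..<n}. v i p *\<^sub>C \<eta> p)" for i
    define r where "r i = \<xi> i - \<zeta> i" for i
    have \<zeta>: "\<zeta> i = (\<Sum>p<m. \<mu> (star (\<eta> p) * \<xi> i) *\<^sub>C \<eta> p)" for i
      unfolding \<zeta>_def v_def using mn zero by (intro sum.mono_neutral_right) auto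
    have r: "\<mu> (star (r i) * r i) = 0" if "i < m" for i
      using that by (intro null) (simp_all only: r_def \<zeta>)
    have r_left: "\<mu> (star (r i) * c) = 0" if "i < m" for i c
      by (rule state_null_left[OF \<mu> r[OF that]])
    have r_right: "\<mu> (c * r i) = 0" if "i < m" for i c
      using state_star[OF \<mu>, of "star (r i) * star c"] r_left[OF that, of "star c"]
      by (simp add: star_mult star_star)
    have r_right': "\<mu> (c * (d * r i)) = 0" if "i < m" for i c d
      using r_right[OF that, of "c * d"] by (simp add: mult.assoc)
    have \<xi>: "\<xi> i = \<zeta> i + r i" for i by (simp add: r_def)
    define \<psi> where "\<psi> = restrict (\<lambda>x. mat n n (\<lambda>(p, q). \<mu> (star (\<eta> p) * x * \<eta> q) + (if p = q \<and> \<eta> p = 0 then \<mu> x else 0))) Y"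
    have \<psi>: "\<psi> \<in> UCP n Y" unfolding \<psi>_def by (rule vector_state_UCP[OF Y \<mu> orth])
    have v0: "v i p = 0" if "\<eta> p = 0" for i p by (simp add: v_def that state_zero[OF \<mu>])
    have "\<mu> (column_ip m \<xi> (mat_app m q \<xi>)) = (\<Sum>i<m. \<Sum>j<m. \<mu> (star (\<xi> i) * q i j * \<xi> j))"
      by (simp add: column_ip_def mat_app_def sum_distrib_left state_sum[OF \<mu>] mult.assoc)
    also have "\<dots> = (\<Sum>i<m. \<Sum>j<m. \<mu> (star (\<zeta> i) * q i j * \<zeta> j))"
      by (intro sum.cong refl)
        (simp add: \<xi> star_add distrib_left distrib_right state_add[OF \<mu>] r_left r_right r_right' mult.assoc)
    also have "\<dots> = (\<Sum>i<m. \<Sum>j<m. \<Sum>k<n. \<Sum>l<n. cnj (v i k) * \<mu> (star (\<eta> k) * q i j * \<eta> l) * v j l)"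
      unfolding \<zeta>_def by (simp only: state_form_expand[OF \<mu>])
    also have "\<dots> = (\<Sum>i<m. \<Sum>k<n. \<Sum>j<m. \<Sum>l<n. cnj (v i k) * \<mu> (star (\<eta> k) * q i j * \<eta> l) * v j l)"
      by (rule sum.cong[OF refl], rule sum.swap)
    also have "\<dots> = block_form m n (\<lambda>i j. \<psi> (Q $$ (i, j))) v"
      unfolding block_form_def using Q
      by (intro sum.cong refl) (auto simp: \<psi>_def q_def mat_over_iff v0)
    finally show "\<mu> (column_ip m \<xi> (mat_app m q \<xi>)) \<in> \<real>\<^sub>\<ge>\<^sub>0"
      using pos[OF \<psi>] by simp
  qed
  then show ?thesis
    using Q by (simp add: positive_mat_iff_weakly_positive mat_over_iff weakly_positive_def q_def[abs_def])
qed

lemma clinear_on_sum: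
  assumes X: "operator_system X" and \<Phi>: "clinear_on X \<Phi>" and f: "\<And>i. i \<in> I \<Longrightarrow> f i \<in> X"
  shows "\<Phi> (sum f I) = (\<Sum>i\<in>I. \<Phi> (f i))"
proof -
  have "\<Phi> (0 *\<^sub>C 0) = 0 *\<^sub>C \<Phi> 0" using \<Phi> op_sys_zero[OF X] unfolding clinear_on_def by blast
  then have 0: "\<Phi> 0 = 0" by simp
  show ?thesis
    using f
  proof (induction I rule: infinite_finite_induct)
    case (insert i I)
    then have "\<Phi> (f i + sum f I) = \<Phi> (f i) + \<Phi> (sum f I)"
      using \<Phi> op_sys_sum[OF X, of I f] by (simp add: clinear_on_def)
    then show ?case using insert by simp
  qed (simp_all add: 0)
qed

text \<open>The form of the image of an \<open>m \<times> m\<close> matrix \<open>P\<close> at \<open>v\<close> equals the form of the image of the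
  \<open>n \<times> n\<close> matrix \<open>v\<^sup>* P v\<close> at the identity matrix, read as a vector. This is why
  positivity at the single size \<open>n\<close> controls all sizes \<open>m\<close>.\<close>

theorem UCP_comp_n_positive:
  assumes X: "operator_system X" and Y: "operator_system Y" and \<phi>: "\<phi> \<in> UCP n X"
    and \<Psi>: "clinear_on Y \<Psi>" "\<Psi> ` Y \<subseteq> X" "\<Psi> 1 = 1" "n_positive_on n Y \<Psi>" and n: "n \<ge> 1"
  shows "restrict (\<phi> \<circ> \<Psi>) Y \<in> UCP n Y"
  unfolding UCP_iff
proof (intro conjI ballI allI impI)
  have \<Psi>X: "\<Psi> y \<in> X" if "y \<in> Y" for y using \<Psi>(2) that by auto
  show "restrict (\<phi> \<circ> \<Psi>) Y \<in> Y \<rightarrow>\<^sub>E carrier_mat n n"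
    using UCP_carrier[OF X \<phi>] \<Psi>X by auto
  show "restrict (\<phi> \<circ> \<Psi>) Y (x + y) = restrict (\<phi> \<circ> \<Psi>) Y x + restrict (\<phi> \<circ> \<Psi>) Y y"
    if "x \<in> Y" "y \<in> Y" for x y
    using that \<phi> \<Psi>(1) by (simp add: op_sys_add[OF Y] clinear_on_def UCP_iff \<Psi>X)
  show "restrict (\<phi> \<circ> \<Psi>) Y (c *\<^sub>C x) = c \<cdot>\<^sub>m restrict (\<phi> \<circ> \<Psi>) Y x" if "x \<in> Y" for x c
    using that \<phi> \<Psi>(1) by (simp add: op_sys_scaleC[OF Y] clinear_on_def UCP_iff \<Psi>X)
  show "restrict (\<phi> \<circ> \<Psi>) Y 1 = 1\<^sub>m n"
    using \<phi> \<Psi>(3) by (simp add: op_sys_one[OF Y] UCP_iff)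
  fix m P and v :: "nat \<Rightarrow> nat \<Rightarrow> complex" assume P: "P \<in> mat_over m Y" "positive_mat m P"
  define p where "p i j = P $$ (i, j)" for i j
  have pY: "p i j \<in> Y" if "i < m" "j < m" for i j using P(1) that by (simp add: mat_over_iff p_def)
  have wp: "weakly_positive m p" using P by (simp add: positive_mat_iff_weakly_positive p_def[abs_def])
  define R where "R k l = (\<Sum>i<m. \<Sum>j<m. (cnj (v i k) * v j l) *\<^sub>C p i j)" for k l :: nat
  have RY: "R k l \<in> Y" for k l
    unfolding R_def by (intro op_sys_sum[OF Y] op_sys_scaleC[OF Y] pY) auto
  have "positive_elem (column_ip n \<zeta> (mat_app n R \<zeta>))" for \<zeta>
  proof -
    define \<eta> where "\<eta> i = (\<Sum>k<n. v i k *\<^sub>C \<zeta> k)" for i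
    have "column_ip n \<zeta> (mat_app n R \<zeta>)
        = (\<Sum>k<n. \<Sum>l<n. \<Sum>i<m. \<Sum>j<m. star (v i k *\<^sub>C \<zeta> k) * p i j * (v j l *\<^sub>C \<zeta> l))"
      by (simp add: column_ip_def mat_app_def R_def sum_distrib_left sum_distrib_right star_scaleC
          mult_scaleC_left mult_scaleC_right scaleC_scaleC mult.assoc mult.commute[of "v _ _"])
    also have "\<dots> = (\<Sum>k<n. \<Sum>i<m. \<Sum>l<n. \<Sum>j<m. star (v i k *\<^sub>C \<zeta> k) * p i j * (v j l *\<^sub>C \<zeta> l))"
      by (rule sum.cong[OF refl], rule sum.swap)
    also have "\<dots> = (\<Sum>i<m. \<Sum>k<n. \<Sum>l<n. \<Sum>j<m. star (v i k *\<^sub>C \<zeta> k) * p i j * (v j l *\<^sub>C \<zeta> l))"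
      by (rule sum.swap)
    also have "\<dots> = (\<Sum>i<m. \<Sum>k<n. \<Sum>j<m. \<Sum>l<n. star (v i k *\<^sub>C \<zeta> k) * p i j * (v j l *\<^sub>C \<zeta> l))"
      by (rule sum.cong[OF refl], rule sum.cong[OF refl], rule sum.swap)
    also have "\<dots> = (\<Sum>i<m. \<Sum>j<m. \<Sum>k<n. \<Sum>l<n. star (v i k *\<^sub>C \<zeta> k) * p i j * (v j l *\<^sub>C \<zeta> l))"
      by (rule sum.cong[OF refl], rule sum.swap)
    also have "\<dots> = (\<Sum>i<m. \<Sum>j<m. star (\<eta> i) * p i j * \<eta> j)"
    proof (intro sum.cong refl)
      fix i j
      have "star (\<eta> i) * p i j = (\<Sum>k<n. star (v i k *\<^sub>C \<zeta> k) * p i j)"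
        by (simp add: \<eta>_def star_sum sum_distrib_right)
      then show "(\<Sum>k<n. \<Sum>l<n. star (v i k *\<^sub>C \<zeta> k) * p i j * (v j l *\<^sub>C \<zeta> l)) = star (\<eta> i) * p i j * \<eta> j"
        by (simp add: \<eta>_def sum_product)
    qed
    also have "\<dots> = column_ip m \<eta> (mat_app m p \<eta>)"
      by (simp add: column_ip_def mat_app_def sum_distrib_left mult.assoc)
    finally show ?thesis using wp by (simp add: weakly_positive_def)
  qed
  then have "positive_mat n (mat n n (\<lambda>(k, l). R k l))"
    unfolding positive_mat_iff_weakly_positive
    using weakly_positive_cong[of n "\<lambda>i j. mat n n (\<lambda>(k, l). R k l) $$ (i, j)" R]
    by (simp add: weakly_positive_def)
  moreover have "mat n n (\<lambda>(k, l). R k l) \<in> mat_over n Y" by (simp add: mat_over_iff RY)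
  ultimately have pos: "positive_mat n (map_mat \<Psi> (mat n n (\<lambda>(k, l). R k l)))"
    and over: "map_mat \<Psi> (mat n n (\<lambda>(k, l). R k l)) \<in> mat_over n X"
    using \<Psi>(4) RY \<Psi>X by (auto simp: n_positive_on_def mat_over_iff)
  have \<Psi>R: "\<Psi> (R k l) = (\<Sum>i<m. \<Sum>j<m. (cnj (v i k) * v j l) *\<^sub>C \<Psi> (p i j))" for k l
  proof -
    have "\<Psi> (R k l) = (\<Sum>i<m. \<Psi> (\<Sum>j<m. (cnj (v i k) * v j l) *\<^sub>C p i j))"
      unfolding R_def by (intro clinear_on_sum[OF Y \<Psi>(1)] op_sys_sum[OF Y] op_sys_scaleC[OF Y] pY) auto
    also have "\<dots> = (\<Sum>i<m. \<Sum>j<m. \<Psi> ((cnj (v i k) * v j l) *\<^sub>C p i j))"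
      by (intro sum.cong refl clinear_on_sum[OF Y \<Psi>(1)] op_sys_scaleC[OF Y] pY) auto
    also have "\<dots> = (\<Sum>i<m. \<Sum>j<m. (cnj (v i k) * v j l) *\<^sub>C \<Psi> (p i j))"
      using \<Psi>(1) pY by (intro sum.cong refl) (auto simp: clinear_on_def)
    finally show ?thesis .
  qed
  have \<phi>R: "\<phi> (\<Psi> (R k l)) $$ (k, l) = (\<Sum>i<m. \<Sum>j<m. cnj (v i k) * \<phi> (\<Psi> (p i j)) $$ (k, l) * v j l)"
    if kl: "k < n" "l < n" for k l
  proof -
    have "\<phi> (\<Psi> (R k l)) $$ (k, l) = (\<Sum>i<m. \<phi> (\<Sum>j<m. (cnj (v i k) * v j l) *\<^sub>C \<Psi> (p i j)) $$ (k, l))"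
      unfolding \<Psi>R using kl
      by (intro UCP_entry_sum[OF X \<phi>] op_sys_sum[OF X] op_sys_scaleC[OF X] \<Psi>X pY) auto
    also have "\<dots> = (\<Sum>i<m. \<Sum>j<m. \<phi> ((cnj (v i k) * v j l) *\<^sub>C \<Psi> (p i j)) $$ (k, l))"
      using kl by (intro sum.cong refl UCP_entry_sum[OF X \<phi>] op_sys_scaleC[OF X] \<Psi>X pY) auto
    also have "\<dots> = (\<Sum>i<m. \<Sum>j<m. cnj (v i k) * \<phi> (\<Psi> (p i j)) $$ (k, l) * v j l)"
      using kl by (intro sum.cong refl) (auto simp: UCP_entry_scaleC[OF X \<phi>] \<Psi>X pY)
    finally show ?thesis .
  qed
  have "block_form n n (\<lambda>k l. \<phi> (map_mat \<Psi> (mat n n (\<lambda>(k, l). R k l)) $$ (k, l))) (\<lambda>k l. if l = k then 1 else 0)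
      = (\<Sum>k<n. \<Sum>k'<n. \<Sum>l<n. \<Sum>l'<n. if l' = l then (if k' = k then \<phi> (\<Psi> (R k l)) $$ (k, l) else 0) else 0)"
    unfolding block_form_def by (intro sum.cong refl) auto
  also have "\<dots> = (\<Sum>k<n. \<Sum>k'<n. \<Sum>l<n. if k' = k then \<phi> (\<Psi> (R k l)) $$ (k, l) else 0)"
    by (intro sum.cong refl) simp
  also have "\<dots> = (\<Sum>k<n. \<Sum>l<n. \<Sum>k'<n. if k' = k then \<phi> (\<Psi> (R k l)) $$ (k, l) else 0)"
    by (rule sum.cong[OF refl], rule sum.swap)
  also have "\<dots> = (\<Sum>k<n. \<Sum>l<n. \<Sum>i<m. \<Sum>j<m. cnj (v i k) * \<phi> (\<Psi> (p i j)) $$ (k, l) * v j l)"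
    by (rule sum.cong[OF refl], rule sum.cong[OF refl]) (simp add: \<phi>R)
  also have "\<dots> = (\<Sum>k<n. \<Sum>i<m. \<Sum>l<n. \<Sum>j<m. cnj (v i k) * \<phi> (\<Psi> (p i j)) $$ (k, l) * v j l)"
    by (rule sum.cong[OF refl], rule sum.swap)
  also have "\<dots> = (\<Sum>i<m. \<Sum>k<n. \<Sum>l<n. \<Sum>j<m. cnj (v i k) * \<phi> (\<Psi> (p i j)) $$ (k, l) * v j l)"
    by (rule sum.swap)
  also have "\<dots> = (\<Sum>i<m. \<Sum>k<n. \<Sum>j<m. \<Sum>l<n. cnj (v i k) * \<phi> (\<Psi> (p i j)) $$ (k, l) * v j l)"
    by (rule sum.cong[OF refl], rule sum.cong[OF refl], rule sum.swap)
  also have "\<dots> = block_form m n (\<lambda>i j. restrict (\<phi> \<circ> \<Psi>) Y (P $$ (i, j))) v"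
    unfolding block_form_def using pY by (intro sum.cong refl) (auto simp: p_def)
  finally show "block_form m n (\<lambda>i j. restrict (\<phi> \<circ> \<Psi>) Y (P $$ (i, j))) v \<in> \<real>\<^sub>\<ge>\<^sub>0"
    using UCP_positive[OF X \<phi> n over pos] by metis
qed

section \<open>Lip-norms and compactness\<close>

definition lip_domain :: "'a::unital_cstar_algebra set \<Rightarrow> bool"
  where "lip_domain D \<longleftrightarrow> subspace D \<and> 1 \<in> D \<and> (\<forall>a\<in>D. star a = a)"

context
  fixes D :: "'a::unital_cstar_algebra set"
  assumes D: "lip_domain D"
begin

lemma lip_domain_simps:
  "0 \<in> D" "1 \<in> D" "x \<in> D \<Longrightarrow> y \<in> D \<Longrightarrow> x + y \<in> D" "x \<in> D \<Longrightarrow> y \<in> D \<Longrightarrow> x - y \<in> D"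
  "x \<in> D \<Longrightarrow> r *\<^sub>R x \<in> D" "x \<in> D \<Longrightarrow> star x = x"
  using D by (auto simp: lip_domain_def subspace_0 subspace_add subspace_diff subspace_scale)

lemma state_restrict_mem: "is_state \<mu> \<Longrightarrow> restrict (\<lambda>a. Re (\<mu> a)) D \<in> state_space D"
  using lip_domain_simps state_pos[of \<mu>]
  by (auto simp: state_space_def state_add state_scaleR state_one complex_nonneg_Reals_iff)

context
  fixes \<mu> assumes \<mu>: "\<mu> \<in> state_space D"
begin

lemma state_space_add: "a \<in> D \<Longrightarrow> b \<in> D \<Longrightarrow> \<mu> (a + b) = \<mu> a + \<mu> b"
  and state_space_scaleR: "a \<in> D \<Longrightarrow> \<mu> (r *\<^sub>R a) = r * \<mu> a"
  and state_space_one: "\<mu> 1 = 1"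
  and state_space_pos: "a \<in> D \<Longrightarrow> positive_elem a \<Longrightarrow> 0 \<le> \<mu> a"
  using \<mu> by (auto simp: state_space_def)

lemma state_space_diff:
  assumes "a \<in> D" "b \<in> D" shows "\<mu> (a - b) = \<mu> a - \<mu> b"
  using state_space_add[of "a - b" b] assms lip_domain_simps by simp

lemma state_space_scalar: "\<mu> (r *\<^sub>R 1) = r"
  using state_space_scaleR[OF lip_domain_simps(2), of r] state_space_one by simp

lemma state_space_bound:
  assumes "a \<in> D" shows "\<bar>\<mu> a\<bar> \<le> norm a"
proof -
  have "0 \<le> \<mu> (norm a *\<^sub>R 1 + a)" "0 \<le> \<mu> (norm a *\<^sub>R 1 - a)"
    using assms lip_domain_simps
    by (auto intro!: state_space_pos positive_elem_shift positive_elem_shift_minus)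
  then show ?thesis
    using assms lip_domain_simps by (simp add: state_space_add state_space_diff state_space_scalar)
qed

end

lemma norm_le_if_state_space:
  assumes "a \<in> D" "\<And>\<mu>. \<mu> \<in> state_space D \<Longrightarrow> \<bar>\<mu> a\<bar> \<le> c"
  shows "norm a \<le> c"
proof (rule norm_le_if_states)
  show "star a = a" using assms lip_domain_simps by simp
  fix \<mu> :: "'a \<Rightarrow> complex" assume "is_state \<mu>"
  from assms(2)[OF state_restrict_mem[OF this]] show "\<bar>Re (\<mu> a)\<bar> \<le> c" using assms(1) by simp
qed

lemma state_space_nonempty: "state_space D \<noteq> {}"
proof -
  have "\<not> positive_elem (- 1 :: 'a)"
    using positive_elem_scalar[of "- 1", where ?'a='a] by simp
  then obtain \<mu> :: "'a \<Rightarrow> complex" where "is_state \<mu>"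
    using state_separates_sa[of "- 1"] by (auto simp: star_minus)
  then show ?thesis using state_restrict_mem by blast
qed

text \<open>The Banach--Alaoglu theorem: the state space is closed in a product of compact intervals.\<close>

lemma compactin_state_space: "compactin (product_topology (\<lambda>_. euclideanreal) D) (state_space D)"
proof -
  let ?T = "product_topology (\<lambda>_. euclideanreal) D"
  have proj: "continuous_map ?T euclideanreal (\<lambda>\<mu>. \<mu> a)" if "a \<in> D" for a
    using continuous_map_product_projection[OF that, of "\<lambda>_. euclideanreal"] by simp
  have top: "topspace ?T = extensional D" by (simp add: PiE_def)
  let ?C = "\<lambda>f C. {\<mu> \<in> topspace ?T. f \<mu> \<in> C}"
  have closed: "closedin ?T (?C f C)" if "continuous_map ?T euclideanreal f" "closed C" for f and C :: "real set"
    using that by (intro closedin_continuous_map_preimage) auto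
  have "state_space D =
      (\<Inter>a\<in>D. \<Inter>b\<in>D. ?C (\<lambda>\<mu>. \<mu> (a + b) - \<mu> a - \<mu> b) {0}) \<inter>
      (\<Inter>a\<in>D. \<Inter>r. ?C (\<lambda>\<mu>. \<mu> (r *\<^sub>R a) - r * \<mu> a) {0}) \<inter>
      ?C (\<lambda>\<mu>. \<mu> 1) {1} \<inter> (\<Inter>a\<in>{a \<in> D. positive_elem a}. ?C (\<lambda>\<mu>. \<mu> a) {0..})" (is "_ = ?R")
    unfolding set_eq_iff
  proof
    fix \<mu> :: "'a \<Rightarrow> real"
    show "\<mu> \<in> state_space D \<longleftrightarrow> \<mu> \<in> ?R"
      unfolding top state_space_def using lip_domain_simps(1)
      by (simp only: Int_iff INT_iff mem_Collect_eq singleton_iff atLeast_iff)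
        (simp add: algebra_simps, blast)
  qed
  moreover have ne: "D \<noteq> {}" "{a \<in> D. positive_elem a} \<noteq> {}"
    using lip_domain_simps(1) positive_elem_zero by blast+
  have "closedin ?T ?R"
    by (intro closedin_Int closedin_INT closed ne)
      (auto intro!: continuous_map_diff proj continuous_map_real_mult_left simp: lip_domain_simps)
  moreover have "state_space D \<subseteq> PiE D (\<lambda>a. {- norm a..norm a})"
  proof
    fix \<mu> assume \<mu>: "\<mu> \<in> state_space D"
    then have "\<mu> \<in> extensional D" by (simp add: state_space_def)
    moreover have "\<mu> a \<in> {- norm a..norm a}" if "a \<in> D" for a
      using state_space_bound[OF \<mu> that] by auto
    ultimately show "\<mu> \<in> PiE D (\<lambda>a. {- norm a..norm a})" by (simp add: PiE_def)
  qed
  moreover have "compactin ?T (PiE D (\<lambda>a. {- norm a..norm a}))"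
    by (simp add: compactin_PiE)
  ultimately show ?thesis by (metis closed_compactin)
qed

context
  fixes L assumes L: "lip_norm_on D L"
begin

lemma lip_norm_basics:
  "a \<in> D \<Longrightarrow> 0 \<le> L a" "a \<in> D \<Longrightarrow> b \<in> D \<Longrightarrow> L (a + b) \<le> L a + L b"
  "a \<in> D \<Longrightarrow> L (r *\<^sub>R a) = \<bar>r\<bar> * L a" "L (r *\<^sub>R 1) = 0"
  "a \<in> D \<Longrightarrow> L a = 0 \<Longrightarrow> \<exists>r. a = r *\<^sub>R 1"
proof -
  have S: "seminorm_on D L" and K: "\<And>a. a \<in> D \<Longrightarrow> L a = 0 \<longleftrightarrow> a \<in> range (\<lambda>r. r *\<^sub>R 1)"
    using L by (auto simp: lip_norm_on_def)
  show "a \<in> D \<Longrightarrow> 0 \<le> L a" "a \<in> D \<Longrightarrow> b \<in> D \<Longrightarrow> L (a + b) \<le> L a + L b"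
    "a \<in> D \<Longrightarrow> L (r *\<^sub>R a) = \<bar>r\<bar> * L a"
    using S by (auto simp: seminorm_on_def)
  show "L (r *\<^sub>R 1) = 0" using K[of "r *\<^sub>R 1"] lip_domain_simps by blast
  show "a \<in> D \<Longrightarrow> L a = 0 \<Longrightarrow> \<exists>r. a = r *\<^sub>R 1" using K[of a] by blast
qed

lemma lip_norm_diff: "a \<in> D \<Longrightarrow> b \<in> D \<Longrightarrow> L (a - b) \<le> L a + L b"
  using lip_norm_basics(2)[of a "(- 1) *\<^sub>R b"] lip_norm_basics(3)[of b "- 1"] lip_domain_simps(5)[of b "- 1"]
  by simp

text \<open>A Lip-norm metrises the weak* topology, so the state space is totally bounded for its metric;
  a finite net of states then controls the norm on the unit ball of the Lip-norm.\<close>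

lemma lip_norm_state_net:
  assumes "e > 0"
  shows "\<exists>K. finite K \<and> K \<subseteq> state_space D \<and> K \<noteq> {} \<and>
    (\<forall>\<nu>\<in>state_space D. \<exists>\<mu>\<in>K. \<forall>a\<in>unit_lip_ball D L. \<bar>\<nu> a - \<mu> a\<bar> \<le> e)"
proof -
  let ?d = "\<lambda>\<mu> \<nu>. enn2real (lip_dist D L \<mu> \<nu>)"
  have metric: "Metric_space (state_space D) ?d"
    and top: "Metric_space.mtopology (state_space D) ?d = weak_star_topology D"
    using L unfolding lip_norm_on_def by blast+
  interpret M: Metric_space "state_space D" ?d by (rule metric)
  have "compact_space (weak_star_topology D)"
    unfolding weak_star_topology_def by (rule compact_space_subtopology[OF compactin_state_space])
  then have "compact_space M.mtopology" by (simp only: top)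
  then have "M.mtotally_bounded (state_space D)"
    by (intro M.compactin_imp_mtotally_bounded) (simp only: compact_space_def M.topspace_mtopology)
  then have "\<exists>K. finite K \<and> K \<subseteq> state_space D \<and> state_space D \<subseteq> (\<Union>\<mu>\<in>K. M.mball \<mu> e)"
    using assms by (simp only: M.mtotally_bounded_def)
  then obtain K where K: "finite K" "K \<subseteq> state_space D" "state_space D \<subseteq> (\<Union>\<mu>\<in>K. M.mball \<mu> e)"
    by (elim exE conjE)
  have "\<exists>\<mu>\<in>K. \<forall>a\<in>unit_lip_ball D L. \<bar>\<nu> a - \<mu> a\<bar> \<le> e" if \<nu>: "\<nu> \<in> state_space D" for \<nu>
  proof -
    obtain \<mu> where \<mu>: "\<mu> \<in> K" "\<nu> \<in> M.mball \<mu> e" using K \<nu> by blast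
    then have d: "?d \<mu> \<nu> < e" "\<mu> \<in> state_space D" by (auto simp: M.in_mball)
    have fin: "lip_dist D L \<mu> \<nu> < \<infinity>" using L d \<nu> unfolding lip_norm_on_def by blast
    have "\<bar>\<nu> a - \<mu> a\<bar> \<le> e" if "a \<in> unit_lip_ball D L" for a
    proof -
      have "ennreal \<bar>\<mu> a - \<nu> a\<bar> \<le> lip_dist D L \<mu> \<nu>"
        unfolding lip_dist_def using that by (rule SUP_upper)
      then have "enn2real (ennreal \<bar>\<mu> a - \<nu> a\<bar>) \<le> ?d \<mu> \<nu>"
        using fin by (intro enn2real_mono) auto
      then show ?thesis using d by (simp add: abs_minus_commute)
    qed
    then show ?thesis using \<mu> by blast
  qed
  moreover have "K \<noteq> {}" using K(3) state_space_nonempty by fast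
  ultimately show ?thesis using K(1,2) by (intro exI[of _ K] conjI ballI)
qed

text \<open>Any fixed state \<open>\<mu>0\<close> provides the scalar \<open>r = \<mu>0 a\<close>.\<close>

lemma lip_norm_radius:
  obtains R where "\<And>a. a \<in> D \<Longrightarrow> L a \<le> 1 \<Longrightarrow> \<exists>r. norm (a - r *\<^sub>R 1) \<le> R"
proof -
  have one: "(0::real) < 1" by simp
  obtain K where K: "finite K" "K \<subseteq> state_space D" "K \<noteq> {}"
    and net: "\<forall>\<nu>\<in>state_space D. \<exists>\<mu>\<in>K. \<forall>a\<in>unit_lip_ball D L. \<bar>\<nu> a - \<mu> a\<bar> \<le> 1"
    using lip_norm_state_net[of 1, OF one] by (elim exE conjE)
  obtain \<mu>0 where \<mu>0: "\<mu>0 \<in> K" using K by blast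
  let ?d = "\<lambda>\<mu> \<nu>. enn2real (lip_dist D L \<mu> \<nu>)"
  define R where "R = 1 + (\<Sum>\<mu>\<in>K. ?d \<mu> \<mu>0)"
  have "norm (a - \<mu>0 a *\<^sub>R 1) \<le> R" if a: "a \<in> D" "L a \<le> 1" for a
  proof (rule norm_le_if_state_space)
    show "a - \<mu>0 a *\<^sub>R 1 \<in> D" using a lip_domain_simps by simp
    fix \<nu> assume \<nu>: "\<nu> \<in> state_space D"
    have ball: "a \<in> unit_lip_ball D L" using a by (simp add: unit_lip_ball_def)
    obtain \<mu> where \<mu>: "\<mu> \<in> K" "\<bar>\<nu> a - \<mu> a\<bar> \<le> 1" using bspec[OF net \<nu>] ball by blast
    have "lip_dist D L \<mu> \<mu>0 < \<infinity>" using L K \<mu> \<mu>0 unfolding lip_norm_on_def by blast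
    moreover have "ennreal \<bar>\<mu> a - \<mu>0 a\<bar> \<le> lip_dist D L \<mu> \<mu>0"
      unfolding lip_dist_def using ball by (rule SUP_upper)
    ultimately have "enn2real (ennreal \<bar>\<mu> a - \<mu>0 a\<bar>) \<le> ?d \<mu> \<mu>0"
      by (intro enn2real_mono) auto
    then have "\<bar>\<mu> a - \<mu>0 a\<bar> \<le> ?d \<mu> \<mu>0" by simp
    also have "\<dots> \<le> (\<Sum>\<mu>\<in>K. ?d \<mu> \<mu>0)" using K \<mu> by (intro member_le_sum) auto
    finally have "\<bar>\<nu> a - \<mu>0 a\<bar> \<le> R" using \<mu>(2) by (simp add: R_def)
    then show "\<bar>\<nu> (a - \<mu>0 a *\<^sub>R 1)\<bar> \<le> R"
      using a lip_domain_simps by (simp add: state_space_diff[OF \<nu>] state_space_scalar[OF \<nu>])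
  qed
  then show thesis using that by blast
qed

lemma lip_norm_compact:
  assumes closed: "closed (unit_lip_ball D L)"
  shows "compact {a \<in> D. L a \<le> 1 \<and> norm a \<le> C}"
  unfolding compact_eq_totally_bounded
proof (intro conjI allI impI)
  let ?B = "{a \<in> D. L a \<le> 1 \<and> norm a \<le> C}"
  have "?B = unit_lip_ball D L \<inter> cball 0 C" by (auto simp: unit_lip_ball_def)
  then have "closed ?B" using closed by auto
  then show "complete ?B" by (simp add: complete_eq_closed)
  fix e :: real assume e: "e > 0"
  define \<epsilon> where "\<epsilon> = e / 4"
  have \<epsilon>: "\<epsilon> > 0" using e by (simp add: \<epsilon>_def)
  obtain K where K: "finite K" "K \<subseteq> state_space D" "K \<noteq> {}"
    and net: "\<forall>\<nu>\<in>state_space D. \<exists>\<mu>\<in>K. \<forall>a\<in>unit_lip_ball D L. \<bar>\<nu> a - \<mu> a\<bar> \<le> \<epsilon>"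
    using lip_norm_state_net[OF \<epsilon>] by (elim exE conjE)
  \<comment> \<open>The values at the net, rounded to multiples of \<open>\<epsilon>\<close>, sort the ball into finitely many classes
    of small diameter.\<close>
  define g where "g a = (\<lambda>\<mu>\<in>K. \<lfloor>\<mu> a / \<epsilon>\<rfloor>)" for a
  have "g ` ?B \<subseteq> PiE K (\<lambda>_. {\<lfloor>- C / \<epsilon>\<rfloor>..\<lfloor>C / \<epsilon>\<rfloor>})"
  proof (rule image_subsetI, rule PiE_I)
    fix a \<mu> assume a: "a \<in> ?B" and \<mu>: "\<mu> \<in> K"
    then have "\<bar>\<mu> a\<bar> \<le> C" using state_space_bound[of \<mu> a] K by force
    then have "- C \<le> \<mu> a" "\<mu> a \<le> C" by auto
    then have "- C / \<epsilon> \<le> \<mu> a / \<epsilon>" "\<mu> a / \<epsilon> \<le> C / \<epsilon>"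
      using \<epsilon> by (intro divide_right_mono; simp)+
    then show "g a \<mu> \<in> {\<lfloor>- C / \<epsilon>\<rfloor>..\<lfloor>C / \<epsilon>\<rfloor>}" using \<mu> by (simp add: g_def floor_mono)
  qed (simp add: g_def)
  then have fin: "finite (g ` ?B)" by (rule finite_subset) (intro finite_PiE K(1), simp)
  define rep where "rep y = (SOME a. a \<in> ?B \<and> g a = y)" for y
  have rep: "rep (g a) \<in> ?B \<and> g (rep (g a)) = g a" if "a \<in> ?B" for a
    unfolding rep_def by (rule someI[where x=a]) (use that in simp)
  have "a \<in> ball (rep (g a)) e" if a: "a \<in> ?B" for a
  proof -
    define b where "b = rep (g a)"
    have b: "b \<in> ?B" "g b = g a" using rep[OF a] by (auto simp: b_def)
    have close: "\<bar>\<mu> a - \<mu> b\<bar> \<le> \<epsilon>" if "\<mu> \<in> K" for \<mu>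
    proof -
      have "\<lfloor>\<mu> a / \<epsilon>\<rfloor> = \<lfloor>\<mu> b / \<epsilon>\<rfloor>" using fun_cong[OF b(2), of \<mu>] that by (simp add: g_def)
      then have "\<bar>\<mu> a / \<epsilon> - \<mu> b / \<epsilon>\<bar> \<le> 1" by linarith
      then have "\<bar>(\<mu> a - \<mu> b) / \<epsilon>\<bar> \<le> 1" by (simp add: diff_divide_distrib)
      then show ?thesis using \<epsilon> by (simp add: abs_divide)
    qed
    have "norm (a - b) \<le> 3 * \<epsilon>"
    proof (rule norm_le_if_state_space)
      show "a - b \<in> D" using a b lip_domain_simps by auto
      fix \<nu> assume \<nu>: "\<nu> \<in> state_space D"
      obtain \<mu> where \<mu>: "\<mu> \<in> K" and le: "\<forall>a\<in>unit_lip_ball D L. \<bar>\<nu> a - \<mu> a\<bar> \<le> \<epsilon>" using bspec[OF net \<nu>] by blast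
      have "\<bar>\<nu> a - \<mu> a\<bar> \<le> \<epsilon>" "\<bar>\<nu> b - \<mu> b\<bar> \<le> \<epsilon>" using le a b by (auto simp: unit_lip_ball_def)
      then have "\<bar>\<nu> a - \<nu> b\<bar> \<le> 3 * \<epsilon>" using close[OF \<mu>] by linarith
      then show "\<bar>\<nu> (a - b)\<bar> \<le> 3 * \<epsilon>" using a b by (simp add: state_space_diff[OF \<nu>])
    qed
    then show ?thesis using e by (simp add: b_def[symmetric] dist_norm norm_minus_commute \<epsilon>_def)
  qed
  then have "?B \<subseteq> (\<Union>x\<in>rep ` g ` ?B. ball x e)" by blast
  then show "\<exists>k. finite k \<and> ?B \<subseteq> (\<Union>x\<in>k. ball x e)" using fin by blast
qed

end

text \<open>The converse criterion. Differences of two states do not see scalars, so the supremum over the unit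
  ball is at most that over the compact set \<open>K\<close>. A finite net of \<open>K\<close> then shows that every
  ball of the metric contains a weak* neighbourhood of its centre.\<close>

theorem lip_norm_onI:
  assumes seminorm: "seminorm_on D L"
    and kernel: "\<And>a. a \<in> D \<Longrightarrow> L a = 0 \<longleftrightarrow> a \<in> range (\<lambda>r. r *\<^sub>R 1)"
    and K: "compact K" "K \<subseteq> D" and ball: "\<And>a. a \<in> D \<Longrightarrow> L a \<le> 1 \<Longrightarrow> \<exists>r. a - r *\<^sub>R 1 \<in> K"
  shows "lip_norm_on D L"
proof -
  let ?d = "\<lambda>\<mu> \<nu>. enn2real (lip_dist D L \<mu> \<nu>)"
  have split: "\<exists>k\<in>K. \<mu> a - \<nu> a = \<mu> k - \<nu> k"
    if a: "a \<in> unit_lip_ball D L" and \<mu>\<nu>: "\<mu> \<in> state_space D" "\<nu> \<in> state_space D" for a \<mu> \<nu>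
  proof -
    have aD: "a \<in> D" using a by (simp add: unit_lip_ball_def)
    obtain r where r: "a - r *\<^sub>R 1 \<in> K" using ball a by (auto simp: unit_lip_ball_def)
    have shift: "\<mu> (a - r *\<^sub>R 1) = \<mu> a - r" if "\<mu> \<in> state_space D" for \<mu>
      using that aD lip_domain_simps by (simp add: state_space_diff state_space_scalar)
    show ?thesis by (rule bexI[OF _ r]) (simp add: shift \<mu>\<nu>)
  qed
  obtain R where R: "\<And>k. k \<in> K \<Longrightarrow> norm k \<le> R"
    using compact_imp_bounded[OF K(1)] unfolding bounded_iff by meson
  have "lip_dist D L \<mu> \<nu> \<le> ennreal (2 * R)" if "\<mu> \<in> state_space D" "\<nu> \<in> state_space D" for \<mu> \<nu>
    unfolding lip_dist_def
  proof (rule SUP_least)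
    fix a assume "a \<in> unit_lip_ball D L"
    from split[OF this that] obtain k where k: "k \<in> K" "\<mu> a - \<nu> a = \<mu> k - \<nu> k" by (elim bexE)
    have "\<bar>\<mu> k\<bar> \<le> R" "\<bar>\<nu> k\<bar> \<le> R"
      using state_space_bound[OF that(1), of k] state_space_bound[OF that(2), of k] R[OF k(1)] K(2) k(1) by auto
    then show "ennreal \<bar>\<mu> a - \<nu> a\<bar> \<le> ennreal (2 * R)" using k by (intro ennreal_leI) linarith
  qed
  then have fin: "lip_dist D L \<mu> \<nu> < \<infinity>" if "\<mu> \<in> state_space D" "\<nu> \<in> state_space D" for \<mu> \<nu>
    using that by (metis ennreal_less_top infinity_ennreal_def le_less_trans)
  have le_d: "\<bar>\<mu> a - \<nu> a\<bar> \<le> ?d \<mu> \<nu>" if "\<mu> \<in> state_space D" "\<nu> \<in> state_space D" "a \<in> unit_lip_ball D L" for \<mu> \<nu> a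
  proof -
    have "ennreal \<bar>\<mu> a - \<nu> a\<bar> \<le> lip_dist D L \<mu> \<nu>"
      unfolding lip_dist_def using that(3) by (rule SUP_upper)
    then have "enn2real (ennreal \<bar>\<mu> a - \<nu> a\<bar>) \<le> ?d \<mu> \<nu>"
      using fin that by (intro enn2real_mono) auto
    then show ?thesis by simp
  qed
  have d_le: "?d \<mu> \<nu> \<le> r" if "r \<ge> 0" "\<And>a. a \<in> unit_lip_ball D L \<Longrightarrow> \<bar>\<mu> a - \<nu> a\<bar> \<le> r" for \<mu> \<nu> r
    unfolding lip_dist_def by (intro enn2real_leI that(1) SUP_least ennreal_leI that(2))
  have lipschitz: "\<bar>\<mu> a - \<nu> a\<bar> \<le> (L a + 1) * ?d \<mu> \<nu>"
    if \<mu>\<nu>: "\<mu> \<in> state_space D" "\<nu> \<in> state_space D" and a: "a \<in> D" for \<mu> \<nu> a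
  proof -
    have La: "0 \<le> L a" using seminorm a by (simp add: seminorm_on_def)
    define t where "t = inverse (L a + 1)"
    have t: "t > 0" using La by (simp add: t_def)
    have "L (t *\<^sub>R a) = t * L a" using seminorm a t by (simp add: seminorm_on_def)
    also have "\<dots> \<le> 1" using La by (simp add: t_def field_simps)
    finally have "t *\<^sub>R a \<in> unit_lip_ball D L" using a lip_domain_simps by (simp add: unit_lip_ball_def)
    from le_d[OF \<mu>\<nu> this] have "\<bar>t * (\<mu> a - \<nu> a)\<bar> \<le> ?d \<mu> \<nu>"
      using a by (simp add: state_space_scaleR[OF \<mu>\<nu>(1)] state_space_scaleR[OF \<mu>\<nu>(2)] right_diff_distrib)
    then have "t * \<bar>\<mu> a - \<nu> a\<bar> \<le> ?d \<mu> \<nu>" using t by (simp add: abs_mult)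
    then show ?thesis using La by (simp add: t_def field_simps)
  qed
  have metric: "Metric_space (state_space D) ?d"
  proof
    show "0 \<le> ?d x y" for x y by simp
    show "?d x y = ?d y x" for x y by (simp add: lip_dist_def abs_minus_commute)
    show "?d x y = 0 \<longleftrightarrow> x = y" if "x \<in> state_space D" "y \<in> state_space D" for x y
    proof
      assume "?d x y = 0"
      then have "x a = y a" if "a \<in> D" for a
        using lipschitz[OF \<open>x \<in> state_space D\<close> \<open>y \<in> state_space D\<close> that] by simp
      moreover have "x \<in> extensional D" "y \<in> extensional D" using that by (auto simp: state_space_def)
      ultimately show "x = y" by (rule extensionalityI[rotated 2]) auto
    next
      assume "x = y"
      then have "?d x y \<le> 0" by (intro d_le) auto
      then show "?d x y = 0" by (simp add: order.antisym)
    qed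
    show "?d x z \<le> ?d x y + ?d y z"
      if "x \<in> state_space D" "y \<in> state_space D" "z \<in> state_space D" for x y z
    proof (rule d_le)
      fix a assume "a \<in> unit_lip_ball D L"
      then show "\<bar>x a - z a\<bar> \<le> ?d x y + ?d y z"
        using le_d[OF that(1,2)] le_d[OF that(2,3)] by fastforce
    qed simp
  qed
  interpret M: Metric_space "state_space D" ?d by (rule metric)
  let ?T = "product_topology (\<lambda>_. euclideanreal) D"
  have proj: "continuous_map ?T euclideanreal (\<lambda>\<mu>. \<mu> a)" if "a \<in> D" for a
    using continuous_map_product_projection[OF that, of "\<lambda>_. euclideanreal"] by simp
  have topW: "topspace (weak_star_topology D) = state_space D"
    by (auto simp: weak_star_topology_def state_space_def PiE_def)
  have "openin M.mtopology U \<longleftrightarrow> openin (weak_star_topology D) U" for U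
  proof
    assume U: "openin M.mtopology U"
    show "openin (weak_star_topology D) U"
      unfolding openin_subopen[of _ U]
    proof
      fix \<mu> assume \<mu>U: "\<mu> \<in> U"
      then obtain r where r: "r > 0" "M.mball \<mu> r \<subseteq> U" and \<mu>: "\<mu> \<in> state_space D"
        using U unfolding M.openin_mtopology by blast
      have cover: "K \<subseteq> (\<Union>f\<in>K. ball f (r / 8))" using r(1) by (auto intro!: bexI)
      obtain F where F: "finite F" "F \<subseteq> K" "K \<subseteq> (\<Union>f\<in>F. ball f (r / 8))"
        by (rule compactE_image[OF K(1) _ cover]) auto
      define V where "V f = {\<nu> \<in> topspace (weak_star_topology D). \<nu> f \<in> {\<mu> f - r / 4<..<\<mu> f + r / 4}}" for f
      have "openin (weak_star_topology D) (V f)" if "f \<in> F" for f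
        unfolding V_def weak_star_topology_def
        using that F K(2) by (intro openin_continuous_map_preimage[where Y=euclideanreal]
            continuous_map_from_subtopology proj) auto
      then have "openin (weak_star_topology D) (\<Inter> (insert (topspace (weak_star_topology D)) (V ` F)))"
        using F(1) by (intro openin_Inter) auto
      moreover have "\<mu> \<in> \<Inter> (insert (topspace (weak_star_topology D)) (V ` F))"
        using r(1) \<mu> by (auto simp: V_def topW)
      moreover have "\<Inter> (insert (topspace (weak_star_topology D)) (V ` F)) \<subseteq> U"
      proof
        fix \<nu> assume "\<nu> \<in> \<Inter> (insert (topspace (weak_star_topology D)) (V ` F))"
        then have \<nu>: "\<nu> \<in> state_space D" and V: "\<forall>f\<in>F. \<mu> f - r / 4 < \<nu> f \<and> \<nu> f < \<mu> f + r / 4"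
          by (auto simp: topW V_def)
        have close: "\<bar>\<mu> f - \<nu> f\<bar> \<le> r / 4" if "f \<in> F" for f
          using bspec[OF V that] by linarith
        have "?d \<mu> \<nu> \<le> r / 2"
        proof (rule d_le)
          fix a assume "a \<in> unit_lip_ball D L"
          from split[OF this \<mu> \<nu>] obtain k where k: "k \<in> K" "\<mu> a - \<nu> a = \<mu> k - \<nu> k" by (elim bexE)
          then obtain f where f: "f \<in> F" "norm (f - k) < r / 8" using F(3) by (auto simp: dist_norm)
          have fk: "f \<in> D" "k \<in> D" using f k F K by auto
          have "\<bar>\<mu> f - \<mu> k\<bar> \<le> r / 8" "\<bar>\<nu> f - \<nu> k\<bar> \<le> r / 8"
            using state_space_bound[OF \<mu>, of "f - k"] state_space_bound[OF \<nu>, of "f - k"] f(2) fk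
            by (simp_all add: lip_domain_simps state_space_diff[OF \<mu>] state_space_diff[OF \<nu>])
          then show "\<bar>\<mu> a - \<nu> a\<bar> \<le> r / 2" using close[OF f(1)] k(2) by linarith
        qed (use r in simp)
        then have "\<nu> \<in> M.mball \<mu> r" using r \<mu> \<nu> by (simp add: M.in_mball)
        then show "\<nu> \<in> U" using r by blast
      qed
      ultimately show "\<exists>T. openin (weak_star_topology D) T \<and> \<mu> \<in> T \<and> T \<subseteq> U" by blast
    qed
  next
    assume "openin (weak_star_topology D) U"
    then obtain V where V: "openin ?T V" "U = V \<inter> state_space D"
      by (auto simp: weak_star_topology_def openin_subtopology)
    have "continuous_map M.mtopology euclideanreal (\<lambda>\<mu>. \<mu> a)" if a: "a \<in> D" for a
      unfolding continuous_map_def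
    proof (intro conjI allI impI)
      fix S :: "real set" assume S: "openin euclideanreal S"
      show "openin M.mtopology {\<mu> \<in> topspace M.mtopology. \<mu> a \<in> S}"
        unfolding M.openin_mtopology
      proof (intro conjI allI impI)
        fix \<mu> assume \<mu>: "\<mu> \<in> {\<mu> \<in> topspace M.mtopology. \<mu> a \<in> S}"
        have "open S" "\<mu> a \<in> S" using S \<mu> by auto
        then obtain e where e: "e > 0" "ball (\<mu> a) e \<subseteq> S" using openE by blast
        have La: "0 < L a + 1" using seminorm a by (simp add: seminorm_on_def add_nonneg_pos)
        have "\<nu> a \<in> S" if "\<nu> \<in> M.mball \<mu> (e / (L a + 1))" for \<nu>
        proof -
          have "\<bar>\<mu> a - \<nu> a\<bar> \<le> (L a + 1) * ?d \<mu> \<nu>" using that \<mu> a by (intro lipschitz) (auto simp: M.in_mball)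
          also have "\<dots> < e" using that La by (simp add: M.in_mball field_simps)
          finally show ?thesis using e by (auto simp: dist_real_def)
        qed
        then show "\<exists>r>0. M.mball \<mu> r \<subseteq> {\<mu> \<in> topspace M.mtopology. \<mu> a \<in> S}"
          using e La by (intro exI[of _ "e / (L a + 1)"]) (auto simp: M.in_mball)
      qed auto
    qed auto
    then have "continuous_map M.mtopology ?T (\<lambda>\<mu>. \<mu>)"
      by (simp add: continuous_map_componentwise) (auto simp: state_space_def)
    from openin_continuous_map_preimage[OF this V(1)] show "openin M.mtopology U"
      by (simp add: V(2) Int_def conj_commute)
  qed
  then have "M.mtopology = weak_star_topology D" by (simp add: topology_eq)
  then show ?thesis
    unfolding lip_norm_on_def using seminorm kernel fin metric by blast
qed

end

section \<open>From vanishing distance to an order isomorphism\<close>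

text \<open>Passing to a filter along which the sequence converges to its cluster point replaces the choice of
  a convergent subnet.\<close>

lemma cluster_filter:
  fixes g :: "nat \<Rightarrow> 'a::topological_space"
  assumes "compact U" "\<And>k. g k \<in> U"
  obtains z G where "G \<noteq> bot" "G \<le> sequentially" "(g \<longlongrightarrow> z) G"
proof -
  have "filtermap g sequentially \<noteq> bot" by (simp add: filtermap_bot_iff)
  moreover have "eventually (\<lambda>x. x \<in> U) (filtermap g sequentially)"
    using assms(2) by (simp add: eventually_filtermap)
  ultimately obtain z where z: "inf (nhds z) (filtermap g sequentially) \<noteq> bot"
    using assms(1) unfolding compact_filter by blast
  define G where "G = inf (filtercomap g (nhds z)) sequentially"
  have "G \<noteq> bot"
  proof
    assume "G = bot"
    then have "eventually (\<lambda>_. False) G" by simp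
    then obtain Q R where Q: "eventually Q (filtercomap g (nhds z))" and R: "eventually R sequentially"
      and no: "\<And>k. Q k \<Longrightarrow> R k \<Longrightarrow> False"
      unfolding G_def eventually_inf by blast
    obtain Q' where Q': "eventually Q' (nhds z)" "\<And>k. Q' (g k) \<Longrightarrow> Q k"
      using Q unfolding eventually_filtercomap by blast
    have "eventually (\<lambda>w. \<exists>k. R k \<and> g k = w) (filtermap g sequentially)"
      unfolding eventually_filtermap using R by (rule eventually_mono) auto
    with Q'(1) have "eventually (\<lambda>_. False) (inf (nhds z) (filtermap g sequentially))"
      unfolding eventually_inf using no Q'(2) by blast
    then show False using z by (simp add: trivial_limit_def)
  qed
  moreover have "(g \<longlongrightarrow> z) G"
    unfolding G_def by (rule filterlim_mono[OF filterlim_filtercomap order_refl]) simp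
  moreover have "G \<le> sequentially" by (simp add: G_def)
  ultimately show thesis using that by blast
qed

lemma lip_system_basics:
  assumes "lip_normed_operator_system X D L"
  shows "operator_system X" "lip_domain D" "D \<subseteq> X" "D \<subseteq> sa_part X" "lip_norm_on D L"
    "sa_part X \<subseteq> closure D" "closed (sa_part X)" "closed (unit_lip_ball D L)"
proof -
  show 1: "operator_system X" "D \<subseteq> sa_part X" "lip_norm_on D L" "sa_part X \<subseteq> closure D"
    using assms by (auto simp: lip_normed_operator_system_def)
  show "D \<subseteq> X" using 1 by (auto simp: sa_part_def)
  show "lip_domain D" using assms 1 by (auto simp: lip_normed_operator_system_def lip_domain_def sa_part_def)
  have "sa_part X = X \<inter> {x. star x = x}" by (auto simp: sa_part_def)
  then show 2: "closed (sa_part X)"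
    using op_sys_closed[OF 1(1)]
    by (auto intro!: closed_Int closed_Collect_eq continuous_intros bounded_linear.continuous_on[OF bounded_linear_star])
  show "closed (unit_lip_ball D L)"
    using assms 2 by (auto simp: lip_normed_operator_system_def intro: closedin_closed_trans)
qed

lemma lip_ball_closed:
  assumes X: "lip_normed_operator_system X D L" and c: "c > 0"
  shows "closed {a \<in> D. L a \<le> c}" and "compact {a \<in> D. L a \<le> c \<and> norm a \<le> C}"
proof -
  note D = lip_system_basics[OF X]
  have scale: "{a \<in> D. L a \<le> c \<and> P (norm a)} = (\<lambda>a. c *\<^sub>R a) ` {a \<in> D. L a \<le> 1 \<and> P (c * norm a)}" for P
  proof (intro equalityI subsetI)
    fix a assume "a \<in> {a \<in> D. L a \<le> c \<and> P (norm a)}"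
    then have "inverse c *\<^sub>R a \<in> {a \<in> D. L a \<le> 1 \<and> P (c * norm a)}" "a = c *\<^sub>R inverse c *\<^sub>R a"
      using c lip_domain_simps[OF D(2)] lip_norm_basics(3)[OF D(2,5)] by (auto simp: field_simps)
    then show "a \<in> (\<lambda>a. c *\<^sub>R a) ` {a \<in> D. L a \<le> 1 \<and> P (c * norm a)}" by blast
  qed (use c lip_domain_simps[OF D(2)] lip_norm_basics(3)[OF D(2,5)] in \<open>auto simp: mult_left_le\<close>)
  have "{a \<in> D. L a \<le> c} = (\<lambda>a. c *\<^sub>R a) ` unit_lip_ball D L"
    using scale[of "\<lambda>_. True"] by (simp add: unit_lip_ball_def)
  then show "closed {a \<in> D. L a \<le> c}" using D(8) by (simp add: closed_scaling)
  have "{a \<in> D. L a \<le> 1 \<and> c * norm a \<le> C} = {a \<in> D. L a \<le> 1 \<and> norm a \<le> C / c}"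
    using c by (auto simp: field_simps)
  then show "compact {a \<in> D. L a \<le> c \<and> norm a \<le> C}"
    using scale[of "\<lambda>r. r \<le> C"] lip_norm_compact[OF D(2,5,8), of "C / c"] by (simp add: compact_scaling)
qed

lemma lip_domain_dense:
  assumes X: "lip_normed_operator_system X D L" and x: "x \<in> X" and e: "e > 0"
  obtains h k where "h \<in> D" "k \<in> D" "norm (x - (h + \<i> *\<^sub>C k)) < e"
proof -
  note D = lip_system_basics[OF X]
  obtain a b where ab: "a \<in> sa_part X" "b \<in> sa_part X" "x = a + \<i> *\<^sub>C b"
    using op_sys_decomposition[OF D(1) x] by blast
  have e2: "e / 2 > 0" using e by simp
  have "a \<in> closure D" "b \<in> closure D" using ab(1,2) D(6) by blast+
  then obtain h k where hk: "h \<in> D" "dist h a < e / 2" "k \<in> D" "dist k b < e / 2"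
    unfolding closure_approachable using e2 by blast
  have "x - (h + \<i> *\<^sub>C k) = (a - h) + \<i> *\<^sub>C (b - k)" by (simp add: ab scaleC_diff_right)
  then have "norm (x - (h + \<i> *\<^sub>C k)) \<le> norm (a - h) + norm (\<i> *\<^sub>C (b - k))"
    using norm_triangle_ineq by metis
  also have "\<dots> < e / 2 + e / 2"
    using hk(2,4) by (intro add_strict_mono) (simp_all add: norm_scaleC dist_norm norm_minus_commute)
  finally show thesis using that hk by simp
qed

text \<open>\<open>M k x y\<close> stands for \<open>L\<^sub>k (x, y)\<close>, where the Lip-norms \<open>L\<^sub>k\<close> bring the u.c.p. maps within
  \<open>e k\<close> of each other. The elements \<open>y k x\<close> almost realise the quotient norm of \<open>x\<close>, and along the
  filter \<open>G\<close> they converge to \<open>F x\<close>. The locale is used twice, with the two systems exchanged the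
  second time; the two limits are then inverse to each other.\<close>

locale lip_bridge =
  fixes X D :: "'a::unital_cstar_algebra set" and L :: "'a \<Rightarrow> real"
    and Y E :: "'b::unital_cstar_algebra set" and L' :: "'b \<Rightarrow> real"
    and N :: "nat set" and M :: "nat \<Rightarrow> 'a \<Rightarrow> 'b \<Rightarrow> real" and e :: "nat \<Rightarrow> real"
    and G :: "nat filter" and y :: "nat \<Rightarrow> 'a \<Rightarrow> 'b" and F :: "'a \<Rightarrow> 'b"
  assumes X: "lip_normed_operator_system X D L" and Y: "lip_normed_operator_system Y E L'"
    and G: "G \<noteq> bot" and e0: "(e \<longlongrightarrow> 0) G" and e_pos: "\<And>k. 0 < e k" and e_le: "\<And>k. e k \<le> 1"
    and M_add: "\<And>k a b a' b'. \<lbrakk>a \<in> D; b \<in> E; a' \<in> D; b' \<in> E\<rbrakk> \<Longrightarrow> M k (a + a') (b + b') \<le> M k a b + M k a' b'"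
    and M_scaleR: "\<And>k a b r. \<lbrakk>a \<in> D; b \<in> E\<rbrakk> \<Longrightarrow> M k (r *\<^sub>R a) (r *\<^sub>R b) = \<bar>r\<bar> * M k a b"
    and M_one: "\<And>k. M k 1 1 = 0"
    and M_ge: "\<And>k a b. \<lbrakk>a \<in> D; b \<in> E\<rbrakk> \<Longrightarrow> L' b \<le> M k a b"
    and norm_le: "\<And>k a b c. \<lbrakk>a \<in> D; b \<in> E; 0 < c; M k a b \<le> c\<rbrakk> \<Longrightarrow> norm b \<le> norm a + c * e k"
    and norm_ge: "\<And>k a b c. \<lbrakk>a \<in> D; b \<in> E; 0 < c; M k a b \<le> c\<rbrakk> \<Longrightarrow> norm a \<le> norm b + c * e k"
    and y_mem: "\<And>k a. a \<in> D \<Longrightarrow> y k a \<in> E" and y_le: "\<And>k a. a \<in> D \<Longrightarrow> M k a (y k a) \<le> L a + e k"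
    and y_lim: "\<And>a. a \<in> D \<Longrightarrow> ((\<lambda>k. y k a) \<longlongrightarrow> F a) G"
    and UCP_close: "\<And>n k \<psi>. \<lbrakk>n \<in> N; \<psi> \<in> UCP n Y\<rbrakk> \<Longrightarrow> \<exists>\<phi>\<in>UCP n X.
       \<forall>a\<in>D. \<forall>b\<in>E. \<forall>c>0. M k a b \<le> c \<longrightarrow> (\<forall>p<n. \<forall>q<n. cmod (\<phi> a $$ (p, q) - \<psi> b $$ (p, q)) \<le> c * e k)"
begin

lemmas D = lip_system_basics[OF X]
lemmas E = lip_system_basics[OF Y]
lemmas Ds = lip_domain_simps[OF D(2)]
lemmas Es = lip_domain_simps[OF E(2)]

lemma M_diff:
  assumes "a \<in> D" "b \<in> E" "a' \<in> D" "b' \<in> E"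
  shows "M k (a - a') (b - b') \<le> M k a b + M k a' b'"
  using M_add[of a b "(- 1) *\<^sub>R a'" "(- 1) *\<^sub>R b'" k] M_scaleR[of a' b' k "- 1"] assms Ds(5)[of a' "- 1"] Es(5)[of b' "- 1"]
  by simp

text \<open>Two elements matched with the same \<open>x\<close> differ by something matched with \<open>0\<close>, hence small.\<close>

lemma matched_zero:
  assumes b: "\<And>k. b k \<in> E" and c: "0 < c" and le: "\<And>k. M k 0 (b k) \<le> c"
  shows "(b \<longlongrightarrow> 0) G"
proof (rule Lim_null_comparison)
  show "\<forall>\<^sub>F k in G. norm (b k) \<le> c * e k"
    using norm_le[OF Ds(1) b c le] by simp
  show "((\<lambda>k. c * e k) \<longlongrightarrow> 0) G" using tendsto_mult_left[OF e0, of c] by simp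
qed

lemma matched_limit:
  assumes a: "a \<in> D" and b: "\<And>k. b k \<in> E" and le: "\<And>k. M k a (b k) \<le> c"
  shows "(b \<longlongrightarrow> F a) G"
proof -
  have L0: "0 \<le> L a" using lip_norm_basics(1)[OF D(2,5) a] .
  have "M k 0 (b k - y k a) \<le> \<bar>c\<bar> + L a + 1" for k
    using M_diff[OF a b[of k] a y_mem[OF a], of k k] le[of k] y_le[OF a, of k] e_le[of k] by simp
  moreover have "0 < \<bar>c\<bar> + L a + 1" using L0 by simp
  ultimately have "((\<lambda>k. b k - y k a) \<longlongrightarrow> 0) G"
    using b y_mem[OF a] Es by (intro matched_zero) auto
  from tendsto_add[OF this y_lim[OF a]] show ?thesis by simp
qed

lemma F_mem_E: "a \<in> D \<Longrightarrow> F a \<in> E" and F_lip_le: "a \<in> D \<Longrightarrow> L' (F a) \<le> L a"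
proof -
  assume a: "a \<in> D"
  have L0: "0 \<le> L a" using lip_norm_basics(1)[OF D(2,5) a] .
  have mem: "F a \<in> {b \<in> E. L' b \<le> L a + \<delta>}" if \<delta>: "\<delta> > 0" for \<delta>
  proof (rule Lim_in_closed_set[OF _ _ G y_lim[OF a]])
    show "closed {b \<in> E. L' b \<le> L a + \<delta>}" using L0 \<delta> by (intro lip_ball_closed[OF Y]) simp
    have "\<forall>\<^sub>F k in G. e k < \<delta>" using order_tendstoD(2)[OF e0 \<delta>] .
    then show "\<forall>\<^sub>F k in G. y k a \<in> {b \<in> E. L' b \<le> L a + \<delta>}"
    proof eventually_elim
      case (elim k)
      then show ?case using y_mem[OF a, of k] M_ge[OF a y_mem[OF a], of k k] y_le[OF a, of k] by simp
    qed
  qed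
  show "F a \<in> E" using mem[of 1] by simp
  show "L' (F a) \<le> L a"
  proof (rule field_le_epsilon)
    fix \<delta> :: real assume "\<delta> > 0"
    from mem[OF this] show "L' (F a) \<le> L a + \<delta>" by simp
  qed
qed

lemma F_norm: "a \<in> D \<Longrightarrow> norm (F a) = norm a"
proof -
  assume a: "a \<in> D"
  define c where "c = L a + 1"
  have c: "c > 0" using lip_norm_basics(1)[OF D(2,5) a] by (simp add: c_def)
  have le: "M k a (y k a) \<le> c" for k using y_le[OF a, of k] e_le[of k] by (simp add: c_def)
  have "((\<lambda>k. norm (y k a) - norm a) \<longlongrightarrow> 0) G"
  proof (rule Lim_null_comparison)
    show "\<forall>\<^sub>F k in G. norm (norm (y k a) - norm a) \<le> c * e k"
    proof (rule always_eventually, rule allI)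
      fix k
      show "norm (norm (y k a) - norm a) \<le> c * e k"
        using norm_le[OF a y_mem[OF a] c le, of k] norm_ge[OF a y_mem[OF a] c le, of k]
        unfolding real_norm_def abs_le_iff by linarith
    qed
    show "((\<lambda>k. c * e k) \<longlongrightarrow> 0) G" using tendsto_mult_left[OF e0, of c] by simp
  qed
  moreover have "((\<lambda>k. norm (y k a) - norm a) \<longlongrightarrow> norm (F a) - norm a) G"
    by (intro tendsto_intros y_lim[OF a])
  ultimately have "norm (F a) - norm a = 0" using tendsto_unique[OF G] by blast
  then show ?thesis by simp
qed

lemma F_one: "F 1 = 1"
proof -
  have "((\<lambda>k. 1) \<longlongrightarrow> F 1) G"
    by (rule matched_limit[where c=0]) (simp_all add: Ds Es M_one)
  then show ?thesis using tendsto_unique[OF G _ tendsto_const] by blast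
qed

lemma F_add: assumes "a \<in> D" "b \<in> D" shows "F (a + b) = F a + F b"
proof -
  have "((\<lambda>k. y k a + y k b) \<longlongrightarrow> F (a + b)) G"
  proof (rule matched_limit[where c="L a + L b + 2"])
    fix k
    show "M k (a + b) (y k a + y k b) \<le> L a + L b + 2"
      using M_add[OF assms(1) y_mem[OF assms(1)] assms(2) y_mem[OF assms(2)], of k k k]
        y_le[OF assms(1), of k] y_le[OF assms(2), of k] e_le[of k] by linarith
  qed (auto simp: Ds Es assms y_mem)
  moreover have "((\<lambda>k. y k a + y k b) \<longlongrightarrow> F a + F b) G"
    by (intro tendsto_add y_lim assms)
  ultimately show ?thesis using tendsto_unique[OF G] by blast
qed

lemma F_scaleR: assumes "a \<in> D" shows "F (r *\<^sub>R a) = r *\<^sub>R F a"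
proof -
  have "((\<lambda>k. r *\<^sub>R y k a) \<longlongrightarrow> F (r *\<^sub>R a)) G"
  proof (rule matched_limit[where c="\<bar>r\<bar> * (L a + 1)"])
    fix k
    have "M k a (y k a) \<le> L a + 1" using y_le[OF assms, of k] e_le[of k] by linarith
    then show "M k (r *\<^sub>R a) (r *\<^sub>R y k a) \<le> \<bar>r\<bar> * (L a + 1)"
      by (simp add: M_scaleR assms y_mem mult_left_mono)
  qed (auto simp: Ds Es assms y_mem)
  moreover have "((\<lambda>k. r *\<^sub>R y k a) \<longlongrightarrow> r *\<^sub>R F a) G"
    by (intro tendsto_scaleR tendsto_const y_lim assms)
  ultimately show ?thesis using tendsto_unique[OF G] by blast
qed

definition complex_span :: "'a set" where "complex_span = {h + \<i> *\<^sub>C k | h k. h \<in> D \<and> k \<in> D}"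

definition re :: "'a \<Rightarrow> 'a" where "re x = (1/2) *\<^sub>R (x + star x)"

definition im :: "'a \<Rightarrow> 'a" where "im x = (- \<i> / 2) *\<^sub>C (x - star x)"

definition F\<^sub>c :: "'a \<Rightarrow> 'b" where "F\<^sub>c x = F (re x) + \<i> *\<^sub>C F (im x)"

lemma re_im:
  assumes "h \<in> D" "k \<in> D" shows "re (h + \<i> *\<^sub>C k) = h" "im (h + \<i> *\<^sub>C k) = k"
proof -
  have "star (h + \<i> *\<^sub>C k) = h - \<i> *\<^sub>C k"
    using assms by (simp add: Ds star_add star_scaleC scaleC_minus_left)
  moreover have "(1/2) *\<^sub>R (h + h) = h" "(- \<i> / 2) *\<^sub>C (\<i> *\<^sub>C k + \<i> *\<^sub>C k) = k"
  proof -
    show "(1/2) *\<^sub>R (h + h) = h" by (simp flip: scaleR_2)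
    have "(- \<i> / 2) *\<^sub>C (\<i> *\<^sub>C k + \<i> *\<^sub>C k) = ((- \<i> / 2) * \<i> + (- \<i> / 2) * \<i>) *\<^sub>C k"
      by (simp only: scaleC_add_right scaleC_scaleC scaleC_add_left)
    then show "(- \<i> / 2) *\<^sub>C (\<i> *\<^sub>C k + \<i> *\<^sub>C k) = k" by simp
  qed
  ultimately show "re (h + \<i> *\<^sub>C k) = h" "im (h + \<i> *\<^sub>C k) = k"
    unfolding re_def im_def by (simp_all del: scaleR_half_double)
qed

lemma F\<^sub>c_eq: "h \<in> D \<Longrightarrow> k \<in> D \<Longrightarrow> F\<^sub>c (h + \<i> *\<^sub>C k) = F h + \<i> *\<^sub>C F k"
  by (simp add: F\<^sub>c_def re_im)

lemma complex_span_add: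
  assumes "z \<in> complex_span" "w \<in> complex_span"
  shows "z + w \<in> complex_span" "F\<^sub>c (z + w) = F\<^sub>c z + F\<^sub>c w"
proof -
  obtain h k h' k' where hk: "z = h + \<i> *\<^sub>C k" "h \<in> D" "k \<in> D" "w = h' + \<i> *\<^sub>C k'" "h' \<in> D" "k' \<in> D"
    using assms by (auto simp: complex_span_def)
  have eq: "z + w = (h + h') + \<i> *\<^sub>C (k + k')" by (simp add: hk scaleC_add_right)
  show "z + w \<in> complex_span" unfolding complex_span_def eq using hk Ds by blast
  have "F\<^sub>c (z + w) = F (h + h') + \<i> *\<^sub>C F (k + k')" unfolding eq by (rule F\<^sub>c_eq) (simp_all add: Ds hk)
  also have "\<dots> = F\<^sub>c z + F\<^sub>c w" by (simp add: F_add hk F\<^sub>c_eq scaleC_add_right)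
  finally show "F\<^sub>c (z + w) = F\<^sub>c z + F\<^sub>c w" .
qed

lemma complex_scale_parts: "c *\<^sub>C (h + \<i> *\<^sub>C k) = (Re c *\<^sub>R h - Im c *\<^sub>R k) + \<i> *\<^sub>C (Im c *\<^sub>R h + Re c *\<^sub>R k)"
  for h k :: "'c::unital_cstar_algebra"
proof -
  have 1: "c = of_real (Re c) + of_real (Im c) * \<i>" and 2: "c * \<i> = of_real (Re c) * \<i> + of_real (- Im c)"
    by (simp_all add: complex_eq_iff)
  have "c *\<^sub>C h = (of_real (Re c) + of_real (Im c) * \<i>) *\<^sub>C h" using 1 by simp
  also have "\<dots> = Re c *\<^sub>R h + Im c *\<^sub>R \<i> *\<^sub>C h"
    by (simp only: scaleC_add_left scaleC_scaleC[symmetric] scaleC_of_real)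
  finally have h: "c *\<^sub>C h = Re c *\<^sub>R h + Im c *\<^sub>R \<i> *\<^sub>C h" .
  have "c *\<^sub>C \<i> *\<^sub>C k = (of_real (Re c) * \<i> + of_real (- Im c)) *\<^sub>C k" by (simp only: scaleC_scaleC 2)
  also have "\<dots> = Re c *\<^sub>R \<i> *\<^sub>C k - Im c *\<^sub>R k"
    by (simp only: scaleC_add_left scaleC_scaleC[symmetric] scaleC_of_real) simp
  finally have k: "c *\<^sub>C \<i> *\<^sub>C k = Re c *\<^sub>R \<i> *\<^sub>C k - Im c *\<^sub>R k" .
  have comm: "\<i> *\<^sub>C r *\<^sub>R z = r *\<^sub>R \<i> *\<^sub>C z" for r and z :: 'c
    by (simp only: scaleC_of_real[symmetric] scaleC_scaleC mult.commute)
  show ?thesis by (simp only: scaleC_add_right h k comm) simp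
qed

lemma complex_span_scaleC:
  assumes "z \<in> complex_span"
  shows "c *\<^sub>C z \<in> complex_span" "F\<^sub>c (c *\<^sub>C z) = c *\<^sub>C F\<^sub>c z"
proof -
  obtain h k where hk: "z = h + \<i> *\<^sub>C k" "h \<in> D" "k \<in> D"
    using assms by (auto simp: complex_span_def)
  have mem: "Re c *\<^sub>R h - Im c *\<^sub>R k \<in> D" "Im c *\<^sub>R h + Re c *\<^sub>R k \<in> D" using hk Ds by auto
  show "c *\<^sub>C z \<in> complex_span" unfolding complex_span_def hk complex_scale_parts using mem by blast
  have F_diff: "F (a - b) = F a - F b" if "a \<in> D" "b \<in> D" for a b
    using F_add[of a "(- 1) *\<^sub>R b"] F_scaleR[of b "- 1"] that Ds(5)[of b "- 1"] by simp
  have "F\<^sub>c (c *\<^sub>C z) = F (Re c *\<^sub>R h - Im c *\<^sub>R k) + \<i> *\<^sub>C F (Im c *\<^sub>R h + Re c *\<^sub>R k)"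
    unfolding hk complex_scale_parts by (rule F\<^sub>c_eq[OF mem])
  also have "\<dots> = c *\<^sub>C F\<^sub>c z"
    using hk by (simp add: F\<^sub>c_eq complex_scale_parts F_add F_diff F_scaleR Ds)
  finally show "F\<^sub>c (c *\<^sub>C z) = c *\<^sub>C F\<^sub>c z" .
qed

lemma complex_span_diff:
  assumes "z \<in> complex_span" "w \<in> complex_span"
  shows "z - w \<in> complex_span" "F\<^sub>c (z - w) = F\<^sub>c z - F\<^sub>c w"
proof -
  have "(- 1) *\<^sub>C w \<in> complex_span" "F\<^sub>c ((- 1) *\<^sub>C w) = (- 1) *\<^sub>C F\<^sub>c w"
    using complex_span_scaleC[OF assms(2), of "- 1"] by auto
  then show "z - w \<in> complex_span" "F\<^sub>c (z - w) = F\<^sub>c z - F\<^sub>c w"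
    using complex_span_add[OF assms(1), of "(- 1) *\<^sub>C w"] by (simp_all add: scaleC_minus_left)
qed

lemma F\<^sub>c_norm_le: "z \<in> complex_span \<Longrightarrow> norm (F\<^sub>c z) \<le> 2 * norm z"
proof -
  assume "z \<in> complex_span"
  then obtain h k where hk: "z = h + \<i> *\<^sub>C k" "h \<in> D" "k \<in> D" by (auto simp: complex_span_def)
  have "norm (F\<^sub>c z) \<le> norm (F h) + norm (\<i> *\<^sub>C F k)"
    unfolding hk(1) F\<^sub>c_eq[OF hk(2,3)] by (rule norm_triangle_ineq)
  also have "\<dots> = norm h + norm k" by (simp add: norm_scaleC F_norm hk)
  also have "\<dots> \<le> 2 * norm z"
    using norm_sa_part_le[of h k] hk Ds(6) by simp
  finally show ?thesis .
qed

lemma complex_span_dense: "x \<in> X \<Longrightarrow> x \<in> closure complex_span"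
  unfolding closure_approachable
proof (intro allI impI)
  fix \<delta> :: real assume "x \<in> X" "0 < \<delta>"
  then obtain h k where "h \<in> D" "k \<in> D" "norm (x - (h + \<i> *\<^sub>C k)) < \<delta>"
    using lip_domain_dense[OF X] by blast
  then show "\<exists>z\<in>complex_span. dist z x < \<delta>"
    unfolding complex_span_def
    by (intro bexI[of _ "h + \<i> *\<^sub>C k"]) (auto simp: dist_norm norm_minus_commute)
qed

lemma F\<^sub>c_mem: "z \<in> complex_span \<Longrightarrow> F\<^sub>c z \<in> Y"
  unfolding complex_span_def
  using F_mem_E subsetD[OF E(3)] op_sys_add[OF E(1)] op_sys_scaleC[OF E(1)] by (auto simp: F\<^sub>c_eq)

lemma bounded_extension:
  obtains \<Phi> where "\<And>x. x \<in> X \<Longrightarrow> \<Phi> x \<in> Y" "clinear_on X \<Phi>" "\<And>z. z \<in> complex_span \<Longrightarrow> \<Phi> z = F\<^sub>c z"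
    "\<And>x. x \<in> X \<Longrightarrow> norm (\<Phi> x) \<le> 2 * norm x"
proof -
  have "uniformly_continuous_on complex_span F\<^sub>c"
    unfolding uniformly_continuous_on_def
  proof (intro allI impI)
    fix \<delta> :: real assume "0 < \<delta>"
    moreover have "dist (F\<^sub>c w) (F\<^sub>c z) \<le> 2 * dist w z" if "w \<in> complex_span" "z \<in> complex_span" for w z
      using F\<^sub>c_norm_le[OF complex_span_diff(1)[OF that]] complex_span_diff(2)[OF that] by (simp add: dist_norm)
    ultimately show "\<exists>d>0. \<forall>z\<in>complex_span. \<forall>w\<in>complex_span. dist w z < d \<longrightarrow> dist (F\<^sub>c w) (F\<^sub>c z) < \<delta>"
      by (intro exI[of _ "\<delta> / 2"]) fastforce
  qed
  then obtain \<Phi> where uc: "uniformly_continuous_on (closure complex_span) \<Phi>"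
    and \<Phi>: "\<And>z. z \<in> complex_span \<Longrightarrow> F\<^sub>c z = \<Phi> z"
    by (rule uniformly_continuous_on_extension_on_closure) (rule that)
  have cont: "continuous_on (closure complex_span) \<Phi>" using uc by (rule uniformly_continuous_imp_continuous)
  have lim: "(\<lambda>j. F\<^sub>c (z j)) \<longlonglongrightarrow> \<Phi> x" if "x \<in> X" "\<And>j. z j \<in> complex_span" "z \<longlonglongrightarrow> x" for z x
  proof -
    have "(\<lambda>j. \<Phi> (z j)) \<longlonglongrightarrow> \<Phi> x"
      using that closure_subset complex_span_dense
      by (intro continuous_on_tendsto_compose[OF cont]) (auto intro!: always_eventually)
    then show ?thesis using \<Phi> that(2) by simp
  qed
  have seq: "\<exists>z. (\<forall>j. z j \<in> complex_span) \<and> z \<longlonglongrightarrow> x" if "x \<in> X" for x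
    using complex_span_dense[OF that] by (simp add: closure_sequential)
  show thesis
  proof (rule that)
    show "\<Phi> x \<in> Y" if x: "x \<in> X" for x
    proof -
      obtain z where z: "\<forall>j. z j \<in> complex_span" "z \<longlonglongrightarrow> x" using seq[OF x] by blast
      show ?thesis
        by (rule closed_sequentially[OF op_sys_closed[OF E(1)] _ lim[OF x _ z(2)]]) (use z F\<^sub>c_mem in auto)
    qed
    show "norm (\<Phi> x) \<le> 2 * norm x" if x: "x \<in> X" for x
    proof -
      obtain z where z: "\<forall>j. z j \<in> complex_span" "z \<longlonglongrightarrow> x" using seq[OF x] by blast
      have "(\<lambda>j. norm (F\<^sub>c (z j))) \<longlonglongrightarrow> norm (\<Phi> x)" using lim[OF x _ z(2)] z(1) by (intro tendsto_norm) auto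
      moreover have "(\<lambda>j. 2 * norm (z j)) \<longlonglongrightarrow> 2 * norm x" using z(2) by (intro tendsto_intros)
      ultimately show ?thesis by (rule LIMSEQ_le) (use z F\<^sub>c_norm_le in auto)
    qed
    show "\<Phi> z = F\<^sub>c z" if "z \<in> complex_span" for z using \<Phi>[OF that] by simp
    have "\<Phi> (x + w) = \<Phi> x + \<Phi> w" if xw: "x \<in> X" "w \<in> X" for x w
    proof -
      obtain z where z: "\<forall>j. z j \<in> complex_span" "z \<longlonglongrightarrow> x" using seq[OF xw(1)] by blast
      obtain u where u: "\<forall>j. u j \<in> complex_span" "u \<longlonglongrightarrow> w" using seq[OF xw(2)] by blast
      have "(\<lambda>j. F\<^sub>c (z j + u j)) \<longlonglongrightarrow> \<Phi> (x + w)"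
        using z u xw by (intro lim op_sys_add[OF D(1)] tendsto_add complex_span_add) auto
      moreover have "(\<lambda>j. F\<^sub>c (z j + u j)) \<longlonglongrightarrow> \<Phi> x + \<Phi> w"
        using tendsto_add[OF lim[OF xw(1) _ z(2)] lim[OF xw(2) _ u(2)]] z u complex_span_add(2) by simp
      ultimately show ?thesis by (rule LIMSEQ_unique)
    qed
    moreover have "\<Phi> (c *\<^sub>C x) = c *\<^sub>C \<Phi> x" if x: "x \<in> X" for x c
    proof -
      obtain z where z: "\<forall>j. z j \<in> complex_span" "z \<longlonglongrightarrow> x" using seq[OF x] by blast
      have "(\<lambda>j. F\<^sub>c (c *\<^sub>C z j)) \<longlonglongrightarrow> \<Phi> (c *\<^sub>C x)"
        using z x by (intro lim op_sys_scaleC[OF D(1)] complex_span_scaleC bounded_linear.tendsto[OF bounded_linear_scaleC]) auto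
      moreover have "(\<lambda>j. F\<^sub>c (c *\<^sub>C z j)) \<longlonglongrightarrow> c *\<^sub>C \<Phi> x"
        using bounded_linear.tendsto[OF bounded_linear_scaleC lim[OF x _ z(2)], of c] z complex_span_scaleC(2) by simp
      ultimately show ?thesis by (rule LIMSEQ_unique)
    qed
    ultimately show "clinear_on X \<Phi>" by (simp add: clinear_on_def)
  qed
qed

text \<open>Every u.c.p. map \<open>\<psi>\<close> on \<open>Y\<close> is approximated by u.c.p. maps \<open>\<phi> k\<close> on \<open>X\<close>, and \<open>\<phi> k\<close> converges
  to \<open>\<psi> \<circ> \<Phi>\<close>. So \<open>\<psi> \<circ> \<Phi>\<close> is a limit of completely positive maps, and \<open>\<psi>\<close> was arbitrary.\<close>

lemma extension_n_positive:
  assumes \<Phi>Y: "\<And>x. x \<in> X \<Longrightarrow> \<Phi> x \<in> Y" and lin: "clinear_on X \<Phi>" and \<Phi>: "\<And>z. z \<in> complex_span \<Longrightarrow> \<Phi> z = F\<^sub>c z"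
    and bound: "\<And>x. x \<in> X \<Longrightarrow> norm (\<Phi> x) \<le> 2 * norm x"
    and n: "n \<in> N" and m: "1 \<le> m" "m \<le> n"
  shows "n_positive_on m X \<Phi>"
  unfolding n_positive_on_def
proof (intro ballI impI)
  fix P assume P: "P \<in> mat_over m X" "positive_mat m P"
  have \<Phi>_diff: "\<Phi> (x - w) = \<Phi> x - \<Phi> w" if "x \<in> X" "w \<in> X" for x w
  proof -
    have "\<Phi> (x + (- 1) *\<^sub>C w) = \<Phi> x + (- 1) *\<^sub>C \<Phi> w"
      using lin that op_sys_scaleC[OF D(1)] unfolding clinear_on_def by metis
    then show ?thesis by (simp add: scaleC_minus_left)
  qed
  have over: "map_mat \<Phi> P \<in> mat_over m Y" using P(1) \<Phi>Y by (auto simp: mat_over_iff)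
  then show "positive_mat m (map_mat \<Phi> P)"
  proof (rule positive_mat_if_UCP[OF E(1) _ m(2)])
    fix \<psi> v assume \<psi>: "\<psi> \<in> UCP n Y"
    have "\<exists>\<phi>\<in>UCP n X. \<forall>a\<in>D. \<forall>b\<in>E. \<forall>c>0. M k a b \<le> c \<longrightarrow> (\<forall>p<n. \<forall>q<n. cmod (\<phi> a $$ (p, q) - \<psi> b $$ (p, q)) \<le> c * e k)" for k
      by (rule UCP_close[OF n \<psi>])
    then obtain \<phi> where \<phi>: "\<And>k. \<phi> k \<in> UCP n X"
      and close: "\<And>k a b c p q. \<lbrakk>a \<in> D; b \<in> E; c > 0; M k a b \<le> c; p < n; q < n\<rbrakk> \<Longrightarrow> cmod (\<phi> k a $$ (p, q) - \<psi> b $$ (p, q)) \<le> c * e k"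
      by metis
    have lim_D: "((\<lambda>k. \<phi> k a $$ (p, q)) \<longlongrightarrow> \<psi> (F a) $$ (p, q)) G" if a: "a \<in> D" and pq: "p < n" "q < n" for a p q
    proof -
      define c where "c = L a + 1"
      have c: "c > 0" using lip_norm_basics(1)[OF D(2,5) a] by (simp add: c_def)
      have "((\<lambda>k. \<phi> k a $$ (p, q) - \<psi> (F a) $$ (p, q)) \<longlongrightarrow> 0) G"
      proof (rule Lim_null_comparison)
        show "\<forall>\<^sub>F k in G. norm (\<phi> k a $$ (p, q) - \<psi> (F a) $$ (p, q)) \<le> c * e k + norm (y k a - F a)"
        proof (rule always_eventually, rule allI)
          fix k
          have 1: "cmod (\<phi> k a $$ (p, q) - \<psi> (y k a) $$ (p, q)) \<le> c * e k"
            using y_le[OF a, of k] e_le[of k] by (intro close a y_mem c pq) (simp add: c_def)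
          have "y k a - F a \<in> E" using y_mem[OF a] F_mem_E[OF a] Es by blast
          then have 2: "cmod (\<psi> (y k a - F a) $$ (p, q)) \<le> norm (y k a - F a)"
            using E(4) by (intro UCP_entry_le[OF E(1) \<psi> _ pq]) blast
          have "\<psi> (y k a - F a) $$ (p, q) = \<psi> (y k a) $$ (p, q) - \<psi> (F a) $$ (p, q)"
            using y_mem[OF a, of k] F_mem_E[OF a] E(3) by (intro UCP_entry_diff[OF E(1) \<psi> _ _ pq]) auto
          with 2 have "cmod (\<psi> (y k a) $$ (p, q) - \<psi> (F a) $$ (p, q)) \<le> norm (y k a - F a)" by simp
          with 1 show "norm (\<phi> k a $$ (p, q) - \<psi> (F a) $$ (p, q)) \<le> c * e k + norm (y k a - F a)"
            using norm_triangle_ineq[of "\<phi> k a $$ (p, q) - \<psi> (y k a) $$ (p, q)" "\<psi> (y k a) $$ (p, q) - \<psi> (F a) $$ (p, q)"]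
            by simp
        qed
        have "((\<lambda>k. c * e k + norm (y k a - F a)) \<longlongrightarrow> c * 0 + norm (F a - F a)) G"
          by (intro tendsto_intros e0 y_lim a)
        then show "((\<lambda>k. c * e k + norm (y k a - F a)) \<longlongrightarrow> 0) G" by simp
      qed
      then show ?thesis by (simp add: LIM_zero_iff)
    qed
    have lim_span: "((\<lambda>k. \<phi> k z $$ (p, q)) \<longlongrightarrow> \<psi> (\<Phi> z) $$ (p, q)) G" if z: "z \<in> complex_span" and pq: "p < n" "q < n" for z p q
    proof -
      obtain h k where hk: "z = h + \<i> *\<^sub>C k" "h \<in> D" "k \<in> D" using z by (auto simp: complex_span_def)
      have hkX: "h \<in> X" "k \<in> X" "F h \<in> Y" "F k \<in> Y" using hk D(3) E(3) F_mem_E by auto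
      have "\<phi> j z $$ (p, q) = \<phi> j h $$ (p, q) + \<i> * \<phi> j k $$ (p, q)" for j
        by (simp add: hk(1) UCP_entry_add[OF D(1) \<phi>] UCP_entry_scaleC[OF D(1) \<phi>] hkX pq op_sys_scaleC[OF D(1)])
      moreover have "\<psi> (\<Phi> z) $$ (p, q) = \<psi> (F h) $$ (p, q) + \<i> * \<psi> (F k) $$ (p, q)"
        by (simp add: \<Phi>[OF z]) (simp add: hk F\<^sub>c_eq UCP_entry_add[OF E(1) \<psi>] UCP_entry_scaleC[OF E(1) \<psi>] hkX pq op_sys_scaleC[OF E(1)])
      ultimately show ?thesis by (simp add: tendsto_intros lim_D hk pq)
    qed
    have lim: "((\<lambda>k. \<phi> k x $$ (p, q)) \<longlongrightarrow> \<psi> (\<Phi> x) $$ (p, q)) G" if x: "x \<in> X" and pq: "p < n" "q < n" for x p q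
      unfolding tendsto_iff
    proof (intro allI impI)
      fix \<delta> :: real assume \<delta>: "\<delta> > 0"
      have "\<delta> / 8 > 0" using \<delta> by simp
      then obtain h k where "h \<in> D" "k \<in> D" and near: "norm (x - (h + \<i> *\<^sub>C k)) < \<delta> / 8"
        using lip_domain_dense[OF X x] by blast
      then obtain z where z: "z \<in> complex_span" "norm (x - z) < \<delta> / 8" unfolding complex_span_def by blast
      have zX: "z \<in> X" using z(1) D(3) op_sys_add[OF D(1)] op_sys_scaleC[OF D(1)] unfolding complex_span_def by blast
      have xz: "x - z \<in> X" using x zX op_sys_diff[OF D(1)] by blast
      have "\<forall>\<^sub>F k in G. dist (\<phi> k z $$ (p, q)) (\<psi> (\<Phi> z) $$ (p, q)) < \<delta> / 8"
        using lim_span[OF z(1) pq] \<open>\<delta> / 8 > 0\<close> unfolding tendsto_iff by blast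
      then show "\<forall>\<^sub>F k in G. dist (\<phi> k x $$ (p, q)) (\<psi> (\<Phi> x) $$ (p, q)) < \<delta>"
      proof eventually_elim
        case (elim k)
        have "dist (\<phi> k x $$ (p, q)) (\<phi> k z $$ (p, q)) \<le> 2 * norm (x - z)"
          unfolding dist_norm using UCP_entry_le2[OF D(1) \<phi> xz pq, of k] UCP_entry_diff[OF D(1) \<phi> x zX pq, of k] by simp
        moreover have "dist (\<psi> (\<Phi> x) $$ (p, q)) (\<psi> (\<Phi> z) $$ (p, q)) \<le> 4 * norm (x - z)"
          unfolding dist_norm using UCP_entry_le2[OF E(1) \<psi> \<Phi>Y[OF xz] pq] UCP_entry_diff[OF E(1) \<psi> \<Phi>Y[OF x] \<Phi>Y[OF zX] pq]
            bound[OF xz] by (simp add: \<Phi>_diff[OF x zX])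
        ultimately show ?case
          using \<delta> elim z(2)
            dist_triangle[of "\<phi> k x $$ (p, q)" "\<psi> (\<Phi> x) $$ (p, q)" "\<phi> k z $$ (p, q)"]
            dist_triangle[of "\<phi> k z $$ (p, q)" "\<psi> (\<Phi> x) $$ (p, q)" "\<psi> (\<Phi> z) $$ (p, q)"]
          unfolding dist_commute[of "\<psi> (\<Phi> z) $$ (p, q)" "\<psi> (\<Phi> x) $$ (p, q)"] by linarith
      qed
    qed
    show "block_form m n (\<lambda>i j. \<psi> (map_mat \<Phi> P $$ (i, j))) v \<in> \<real>\<^sub>\<ge>\<^sub>0"
    proof (rule Lim_in_closed_set[OF closed_nonneg_Reals_complex _ G])
      show "\<forall>\<^sub>F k in G. block_form m n (\<lambda>i j. \<phi> k (P $$ (i, j))) v \<in> \<real>\<^sub>\<ge>\<^sub>0"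
        by (intro always_eventually allI UCP_positive[OF D(1) \<phi> m(1) P])
      show "((\<lambda>k. block_form m n (\<lambda>i j. \<phi> k (P $$ (i, j))) v) \<longlongrightarrow> block_form m n (\<lambda>i j. \<psi> (map_mat \<Phi> P $$ (i, j))) v) G"
        unfolding block_form_def
      proof (intro tendsto_sum tendsto_mult tendsto_const)
        fix i p j q assume "i \<in> {..<m}" "p \<in> {..<n}" "j \<in> {..<m}" "q \<in> {..<n}"
        then show "((\<lambda>k. \<phi> k (P $$ (i, j)) $$ (p, q)) \<longlongrightarrow> \<psi> (map_mat \<Phi> P $$ (i, j)) $$ (p, q)) G"
          using lim[of "P $$ (i, j)" p q] P(1) by (auto simp: mat_over_iff)
      qed
    qed
  qed
qed

theorem extension:
  obtains \<Phi> where "\<And>x. x \<in> X \<Longrightarrow> \<Phi> x \<in> Y" "clinear_on X \<Phi>" "\<Phi> 1 = 1" "\<And>a. a \<in> D \<Longrightarrow> \<Phi> a = F a"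
    "\<And>x. x \<in> X \<Longrightarrow> norm (\<Phi> x) \<le> 2 * norm x"
    "\<And>n m. n \<in> N \<Longrightarrow> m \<in> {1..n} \<Longrightarrow> n_positive_on m X \<Phi>"
proof -
  obtain \<Phi> where \<Phi>: "\<And>x. x \<in> X \<Longrightarrow> \<Phi> x \<in> Y" "clinear_on X \<Phi>" "\<And>z. z \<in> complex_span \<Longrightarrow> \<Phi> z = F\<^sub>c z"
    "\<And>x. x \<in> X \<Longrightarrow> norm (\<Phi> x) \<le> 2 * norm x"
    using bounded_extension by blast
  have F0: "F 0 = 0" using F_scaleR[OF Ds(1), of 0] by simp
  have D_span: "a \<in> complex_span" "F\<^sub>c a = F a" if "a \<in> D" for a
  proof -
    have "a = a + \<i> *\<^sub>C 0" by simp
    then show "a \<in> complex_span" unfolding complex_span_def using that Ds(1) by blast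
    show "F\<^sub>c a = F a" using F\<^sub>c_eq[OF that Ds(1)] by (simp add: F0)
  qed
  have "\<Phi> a = F a" if "a \<in> D" for a using D_span[OF that] \<Phi>(3) by simp
  moreover from this[OF Ds(2)] have "\<Phi> 1 = 1" by (simp add: F_one)
  moreover have "n_positive_on m X \<Phi>" if "n \<in> N" "m \<in> {1..n}" for n m
    using that by (intro extension_n_positive[OF \<Phi>]) auto
  ultimately show thesis using that \<Phi> by blast
qed

end

section \<open>Admissible Lip-norms on the direct sum\<close>

lemma dsum_ops [simp]:
  "DSum a b + DSum c d = DSum (a + c) (b + d)" "DSum a b - DSum c d = DSum (a - c) (b - d)"
  "r *\<^sub>R DSum a b = DSum (r *\<^sub>R a) (r *\<^sub>R b)"
  by (simp_all add: plus_dsum_def minus_dsum_def scaleR_dsum_def)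

lemma dsum_fields [simp]:
  "dfst (u + v) = dfst u + dfst v" "dsnd (u + v) = dsnd u + dsnd v"
  "dfst (u - v) = dfst u - dfst v" "dsnd (u - v) = dsnd u - dsnd v"
  "dfst (r *\<^sub>R u) = r *\<^sub>R dfst u" "dsnd (r *\<^sub>R u) = r *\<^sub>R dsnd u"
  by (simp_all add: plus_dsum_def minus_dsum_def scaleR_dsum_def)

lemma dsum_set_iff: "u \<in> S \<oplus>\<^sub>d T \<longleftrightarrow> dfst u \<in> S \<and> dsnd u \<in> T"
  by (cases u) (auto simp: dsum_set_def)

lemma lip_domain_dsum:
  assumes "lip_domain D" "lip_domain E" shows "lip_domain (D \<oplus>\<^sub>d E)"
  unfolding lip_domain_def
proof (intro conjI ballI)
  note D = lip_domain_simps[OF assms(1)] and E = lip_domain_simps[OF assms(2)]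
  show "subspace (D \<oplus>\<^sub>d E)"
    by (rule subspaceI) (auto simp: dsum_set_iff D E zero_dsum_def)
  show "1 \<in> D \<oplus>\<^sub>d E" by (simp add: dsum_set_iff one_dsum_def D E)
  fix u assume "u \<in> D \<oplus>\<^sub>d E"
  then show "star u = u" by (cases u) (simp add: star_dsum_def dsum_set_iff D E)
qed

context
  fixes X D :: "'a::unital_cstar_algebra set" and L :: "'a \<Rightarrow> real"
    and Y E :: "'b::unital_cstar_algebra set" and L' :: "'b \<Rightarrow> real"
  assumes X: "lip_normed_operator_system X D L" and Y: "lip_normed_operator_system Y E L'"
begin

lemmas X_facts = lip_system_basics[OF X]
lemmas Y_facts = lip_system_basics[OF Y]
lemmas D_simps = lip_domain_simps[OF X_facts(2)]
lemmas E_simps = lip_domain_simps[OF Y_facts(2)]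

context
  fixes \<Lambda> assumes \<Lambda>: "\<Lambda> \<in> admissible_lip_norms X D L Y E L'"
begin

lemma admissible_seminorm:
  "\<lbrakk>a \<in> D; b \<in> E\<rbrakk> \<Longrightarrow> 0 \<le> \<Lambda> (DSum a b)"
  "\<lbrakk>a \<in> D; b \<in> E; a' \<in> D; b' \<in> E\<rbrakk> \<Longrightarrow> \<Lambda> (DSum (a + a') (b + b')) \<le> \<Lambda> (DSum a b) + \<Lambda> (DSum a' b')"
  "\<lbrakk>a \<in> D; b \<in> E\<rbrakk> \<Longrightarrow> \<Lambda> (DSum (r *\<^sub>R a) (r *\<^sub>R b)) = \<bar>r\<bar> * \<Lambda> (DSum a b)"
  "\<Lambda> (DSum 1 1) = 0"
proof -
  have lip: "lip_norm_on (D \<oplus>\<^sub>d E) \<Lambda>" using \<Lambda> by (simp add: admissible_lip_norms_def)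
  note basics = lip_norm_basics[OF lip_domain_dsum[OF X_facts(2) Y_facts(2)] lip]
  show "\<lbrakk>a \<in> D; b \<in> E\<rbrakk> \<Longrightarrow> 0 \<le> \<Lambda> (DSum a b)" using basics(1)[of "DSum a b"] by (simp add: dsum_set_iff)
  show "\<lbrakk>a \<in> D; b \<in> E; a' \<in> D; b' \<in> E\<rbrakk> \<Longrightarrow> \<Lambda> (DSum (a + a') (b + b')) \<le> \<Lambda> (DSum a b) + \<Lambda> (DSum a' b')"
    using basics(2)[of "DSum a b" "DSum a' b'"] by (simp add: dsum_set_iff)
  show "\<lbrakk>a \<in> D; b \<in> E\<rbrakk> \<Longrightarrow> \<Lambda> (DSum (r *\<^sub>R a) (r *\<^sub>R b)) = \<bar>r\<bar> * \<Lambda> (DSum a b)"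
    using basics(3)[of "DSum a b" r] by (simp add: dsum_set_iff)
  show "\<Lambda> (DSum 1 1) = 0" using basics(4)[of 1] by (simp add: one_dsum_def)
qed

lemma admissible_quotient:
  assumes "a \<in> D" "b \<in> E"
  shows "L a \<le> \<Lambda> (DSum a b)" "L' b \<le> \<Lambda> (DSum a b)"
    "\<delta> > 0 \<Longrightarrow> \<exists>b\<in>E. \<Lambda> (DSum a b) \<le> L a + \<delta>" "\<delta> > 0 \<Longrightarrow> \<exists>a\<in>D. \<Lambda> (DSum a b) \<le> L' b + \<delta>"
proof -
  have La: "L a = (INF b\<in>E. \<Lambda> (DSum a b))" and Lb: "L' b = (INF a\<in>D. \<Lambda> (DSum a b))"
    using \<Lambda> assms by (auto simp: admissible_lip_norms_def)
  have bdd: "bdd_below ((\<lambda>b. \<Lambda> (DSum a b)) ` E)" "bdd_below ((\<lambda>a. \<Lambda> (DSum a b)) ` D)"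
    using assms by (auto intro!: bdd_belowI2[where m=0] admissible_seminorm(1))
  show "L a \<le> \<Lambda> (DSum a b)" unfolding La by (rule cINF_lower[OF bdd(1) assms(2)])
  show "L' b \<le> \<Lambda> (DSum a b)" unfolding Lb by (rule cINF_lower[OF bdd(2) assms(1)])
  show "\<exists>b\<in>E. \<Lambda> (DSum a b) \<le> L a + \<delta>" if "\<delta> > 0"
  proof -
    have "(INF b\<in>E. \<Lambda> (DSum a b)) < L a + \<delta>" using that by (simp flip: La)
    then show ?thesis using cINF_less_iff[OF _ bdd(1)] assms(2) by (auto intro: less_imp_le)
  qed
  show "\<exists>a\<in>D. \<Lambda> (DSum a b) \<le> L' b + \<delta>" if "\<delta> > 0"
  proof -
    have "(INF a\<in>D. \<Lambda> (DSum a b)) < L' b + \<delta>" using that by (simp flip: Lb)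
    then show ?thesis using cINF_less_iff[OF _ bdd(2)] assms(1) by (auto intro: less_imp_le)
  qed
qed

lemma ucp_dist_entry_bound:
  assumes \<phi>: "\<phi> \<in> UCP n X" and \<psi>: "\<psi> \<in> UCP n Y"
    and less: "ucp_dist (D \<oplus>\<^sub>d E) \<Lambda> (restrict (\<phi> \<circ> dfst) (X \<oplus>\<^sub>d Y)) (restrict (\<psi> \<circ> dsnd) (X \<oplus>\<^sub>d Y)) < ennreal e"
    and ab: "a \<in> D" "b \<in> E" and c: "c > 0" "\<Lambda> (DSum a b) \<le> c" and pq: "p < n" "q < n"
  shows "cmod (\<phi> a $$ (p, q) - \<psi> b $$ (p, q)) \<le> c * e"
proof -
  define a' where "a' = inverse c *\<^sub>R a"
  define b' where "b' = inverse c *\<^sub>R b"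
  have mem: "a' \<in> D" "b' \<in> E" by (simp_all add: a'_def b'_def D_simps E_simps ab)
  have memX: "a' \<in> X" "b' \<in> Y" "a \<in> X" "b \<in> Y" using mem ab X_facts(3) Y_facts(3) by auto
  have "\<Lambda> (DSum a' b') = inverse c * \<Lambda> (DSum a b)"
    unfolding a'_def b'_def using admissible_seminorm(3)[OF ab, of "inverse c"] c by simp
  also have "\<dots> \<le> 1" using c by (simp add: field_simps)
  finally have "DSum a' b' \<in> unit_lip_ball (D \<oplus>\<^sub>d E) \<Lambda>" using mem by (simp add: unit_lip_ball_def dsum_set_iff)
  then have "ennreal (op_norm (restrict (\<phi> \<circ> dfst) (X \<oplus>\<^sub>d Y) (DSum a' b') - restrict (\<psi> \<circ> dsnd) (X \<oplus>\<^sub>d Y) (DSum a' b')))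
      \<le> ucp_dist (D \<oplus>\<^sub>d E) \<Lambda> (restrict (\<phi> \<circ> dfst) (X \<oplus>\<^sub>d Y)) (restrict (\<psi> \<circ> dsnd) (X \<oplus>\<^sub>d Y))"
    unfolding ucp_dist_def by (rule SUP_upper)
  then have "ennreal (op_norm (\<phi> a' - \<psi> b')) < ennreal e"
    using less memX by (simp add: dsum_set_iff le_less_trans)
  then have "op_norm (\<phi> a' - \<psi> b') \<le> e"
    by (meson ennreal_leI leD not_le_imp_less less_imp_le)
  moreover have car: "\<phi> a' \<in> carrier_mat n n" "\<psi> b' \<in> carrier_mat n n"
    using UCP_carrier[OF X_facts(1) \<phi>] UCP_carrier[OF Y_facts(1) \<psi>] memX by auto
  then have "cmod ((\<phi> a' - \<psi> b') $$ (p, q)) \<le> op_norm (\<phi> a' - \<psi> b')"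
    using pq by (intro entry_le_op_norm) auto
  moreover have "(\<phi> a' - \<psi> b') $$ (p, q) = inverse c *\<^sub>R (\<phi> a $$ (p, q) - \<psi> b $$ (p, q))"
  proof -
    have "\<phi> a' $$ (p, q) = inverse c *\<^sub>R \<phi> a $$ (p, q)"
      unfolding a'_def using pq memX(3) by (simp add: UCP_entry_scaleR[OF X_facts(1) \<phi>] scaleR_conv_of_real[where ?'a=complex])
    moreover have "\<psi> b' $$ (p, q) = inverse c *\<^sub>R \<psi> b $$ (p, q)"
      unfolding b'_def using pq memX(4) by (simp add: UCP_entry_scaleR[OF Y_facts(1) \<psi>] scaleR_conv_of_real[where ?'a=complex])
    ultimately show ?thesis using car pq by (simp add: scaleR_diff_right)
  qed
  ultimately have "inverse c * cmod (\<phi> a $$ (p, q) - \<psi> b $$ (p, q)) \<le> e" using c by simp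
  then show ?thesis using c by (simp add: field_simps)
qed

text \<open>A single partner \<open>\<psi>\<close> of \<open>\<phi>\<close> works for all pairs \<open>(a, b)\<close>, with an error proportional to the
  Lip-norm. This uniformity lets one filter treat all elements at the same time.\<close>

lemma hausdorff_dist_UCP_close:
  assumes less: "hausdorff_dist (ucp_dist (D \<oplus>\<^sub>d E) \<Lambda>) (UCP_fst n X Y) (UCP_snd n X Y) < ennreal e"
  shows "\<phi> \<in> UCP n X \<Longrightarrow> \<exists>\<psi>\<in>UCP n Y. \<forall>a\<in>D. \<forall>b\<in>E. \<forall>c>0. \<Lambda> (DSum a b) \<le> c \<longrightarrow>
      (\<forall>p<n. \<forall>q<n. cmod (\<phi> a $$ (p, q) - \<psi> b $$ (p, q)) \<le> c * e)"
    and "\<psi> \<in> UCP n Y \<Longrightarrow> \<exists>\<phi>\<in>UCP n X. \<forall>a\<in>D. \<forall>b\<in>E. \<forall>c>0. \<Lambda> (DSum a b) \<le> c \<longrightarrow>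
      (\<forall>p<n. \<forall>q<n. cmod (\<phi> a $$ (p, q) - \<psi> b $$ (p, q)) \<le> c * e)"
proof -
  let ?\<rho> = "ucp_dist (D \<oplus>\<^sub>d E) \<Lambda>"
  have 1: "(SUP f\<in>UCP_fst n X Y. INF g\<in>UCP_snd n X Y. ?\<rho> f g) < ennreal e"
    and 2: "(SUP g\<in>UCP_snd n X Y. INF f\<in>UCP_fst n X Y. ?\<rho> f g) < ennreal e"
    using less by (simp_all add: hausdorff_dist_def)
  show "\<exists>\<psi>\<in>UCP n Y. \<forall>a\<in>D. \<forall>b\<in>E. \<forall>c>0. \<Lambda> (DSum a b) \<le> c \<longrightarrow>
      (\<forall>p<n. \<forall>q<n. cmod (\<phi> a $$ (p, q) - \<psi> b $$ (p, q)) \<le> c * e)" if \<phi>: "\<phi> \<in> UCP n X"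
  proof -
    have "restrict (\<phi> \<circ> dfst) (X \<oplus>\<^sub>d Y) \<in> UCP_fst n X Y" using \<phi> by (simp add: UCP_fst_def)
    then have "(INF g\<in>UCP_snd n X Y. ?\<rho> (restrict (\<phi> \<circ> dfst) (X \<oplus>\<^sub>d Y)) g) < ennreal e"
      using 1 by (rule le_less_trans[OF SUP_upper])
    then obtain \<psi> where \<psi>: "\<psi> \<in> UCP n Y" "?\<rho> (restrict (\<phi> \<circ> dfst) (X \<oplus>\<^sub>d Y)) (restrict (\<psi> \<circ> dsnd) (X \<oplus>\<^sub>d Y)) < ennreal e"
      unfolding INF_less_iff UCP_snd_def by blast
    show ?thesis
      by (intro bexI[OF _ \<psi>(1)] ballI allI impI) (rule ucp_dist_entry_bound[OF \<phi> \<psi>])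
  qed
  show "\<exists>\<phi>\<in>UCP n X. \<forall>a\<in>D. \<forall>b\<in>E. \<forall>c>0. \<Lambda> (DSum a b) \<le> c \<longrightarrow>
      (\<forall>p<n. \<forall>q<n. cmod (\<phi> a $$ (p, q) - \<psi> b $$ (p, q)) \<le> c * e)" if \<psi>: "\<psi> \<in> UCP n Y"
  proof -
    have "restrict (\<psi> \<circ> dsnd) (X \<oplus>\<^sub>d Y) \<in> UCP_snd n X Y" using \<psi> by (simp add: UCP_snd_def)
    then have "(INF f\<in>UCP_fst n X Y. ?\<rho> f (restrict (\<psi> \<circ> dsnd) (X \<oplus>\<^sub>d Y))) < ennreal e"
      using 2 by (rule le_less_trans[OF SUP_upper])
    then obtain \<phi> where \<phi>: "\<phi> \<in> UCP n X" "?\<rho> (restrict (\<phi> \<circ> dfst) (X \<oplus>\<^sub>d Y)) (restrict (\<psi> \<circ> dsnd) (X \<oplus>\<^sub>d Y)) < ennreal e"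
      unfolding INF_less_iff UCP_fst_def by blast
    show ?thesis
      by (intro bexI[OF _ \<phi>(1)] ballI allI impI) (rule ucp_dist_entry_bound[OF \<phi>(1) \<psi> \<phi>(2)])
  qed
qed

end

end

text \<open>States, viewed as u.c.p. maps with scalar values, compute norms; so closeness of u.c.p. maps
  controls norms.\<close>

lemma norm_le_if_UCP_close:
  fixes a :: "'a::unital_cstar_algebra" and b :: "'b::unital_cstar_algebra"
  assumes X: "operator_system X" and Y: "operator_system Y"
    and a: "a \<in> sa_part X" and b: "b \<in> sa_part Y" and n: "n \<ge> 1"
    and close: "\<And>\<psi>. \<psi> \<in> UCP n Y \<Longrightarrow> \<exists>\<phi>\<in>UCP n X. cmod (\<phi> a $$ (0, 0) - \<psi> b $$ (0, 0)) \<le> r"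
  shows "norm b \<le> norm a + r"
proof (rule norm_le_if_states)
  show "star b = b" using b by (simp add: sa_part_def)
  fix \<mu> :: "'b \<Rightarrow> complex" assume \<mu>: "is_state \<mu>"
  have bY: "b \<in> Y" using b by (simp add: sa_part_def)
  obtain \<phi> where \<phi>: "\<phi> \<in> UCP n X"
    and "cmod (\<phi> a $$ (0, 0) - restrict (\<lambda>x. mat n n (\<lambda>(p, q). if p = q then \<mu> x else 0)) Y b $$ (0, 0)) \<le> r"
    using close[OF state_UCP[OF Y \<mu>]] by blast
  then have "cmod (\<phi> a $$ (0, 0) - \<mu> b) \<le> r" using n bY by simp
  moreover have "cmod (\<phi> a $$ (0, 0)) \<le> norm a" using n by (intro UCP_entry_le[OF X \<phi> a]) auto
  ultimately have "cmod (\<mu> b) \<le> norm a + r"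
    using norm_triangle_sub[of "\<mu> b" "\<phi> a $$ (0, 0)"] by (simp add: norm_minus_commute)
  then show "\<bar>Re (\<mu> b)\<bar> \<le> norm a + r" using abs_Re_le_cmod[of "\<mu> b"] by linarith
qed

text \<open>The pairs \<open>(a, y k a)\<close> and \<open>(x k (F a), F a)\<close> are both matched, so their difference is, and
  \<open>y k a\<close> tends to \<open>F a\<close>.\<close>

lemma lip_bridge_inverse:
  assumes "lip_bridge X D L Y E L' N M e G y F"
    and "lip_bridge Y E L' X D L N (\<lambda>k b a. M k a b) e G x H" and a: "a \<in> D"
  shows "H (F a) = a"
proof -
  interpret B: lip_bridge X D L Y E L' N M e G y F by (rule assms(1))
  interpret C: lip_bridge Y E L' X D L N "\<lambda>k b a. M k a b" e G x H by (rule assms(2))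
  note Fa = B.F_mem_E[OF a]
  define c where "c = (L' (F a) + 1) + (L a + 1)"
  have c: "c > 0"
    using lip_norm_basics(1)[OF B.D(2,5) a] lip_norm_basics(1)[OF C.D(2,5) Fa] by (simp add: c_def)
  have "((\<lambda>k. x k (F a) - a) \<longlongrightarrow> 0) G"
  proof (rule Lim_null_comparison)
    show "\<forall>\<^sub>F k in G. norm (x k (F a) - a) \<le> norm (F a - y k a) + c * e k"
    proof (rule always_eventually, rule allI)
      fix k
      have "M k (x k (F a) - a) (F a - y k a) \<le> M k (x k (F a)) (F a) + M k a (y k a)"
        by (intro B.M_diff C.y_mem Fa a B.y_mem)
      also have "\<dots> \<le> c"
        using C.y_le[OF Fa, of k] B.y_le[OF a, of k] B.e_le[of k] by (simp add: c_def)
      finally show "norm (x k (F a) - a) \<le> norm (F a - y k a) + c * e k"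
        using C.y_mem[OF Fa] B.y_mem[OF a] Fa a c by (intro B.norm_ge B.Ds B.Es) auto
    qed
    have "((\<lambda>k. norm (F a - y k a) + c * e k) \<longlongrightarrow> norm (F a - F a) + c * 0) G"
      by (intro tendsto_intros B.e0 B.y_lim a)
    then show "((\<lambda>k. norm (F a - y k a) + c * e k) \<longlongrightarrow> 0) G" by simp
  qed
  from tendsto_add[OF this tendsto_const[of a]] have "((\<lambda>k. x k (F a)) \<longlongrightarrow> a) G" by simp
  then show ?thesis using C.y_lim[OF Fa] tendsto_unique[OF B.G] by blast
qed

lemma identity_from_dense:
  assumes X: "lip_normed_operator_system X D L" and lin: "clinear_on X \<Theta>"
    and bound: "\<And>x. x \<in> X \<Longrightarrow> norm (\<Theta> x) \<le> C * norm x" and id: "\<And>a. a \<in> D \<Longrightarrow> \<Theta> a = a" and x: "x \<in> X"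
  shows "\<Theta> x = x"
proof (rule ccontr)
  note D = lip_system_basics[OF X]
  assume "\<Theta> x \<noteq> x"
  then have d: "norm (\<Theta> x - x) > 0" by simp
  define \<delta> where "\<delta> = norm (\<Theta> x - x) / (\<bar>C\<bar> + 1)"
  have \<delta>: "\<delta> > 0" using d by (simp add: \<delta>_def add_nonneg_pos)
  obtain h k where hk: "h \<in> D" "k \<in> D" and near: "norm (x - (h + \<i> *\<^sub>C k)) < \<delta>"
    using lip_domain_dense[OF X x \<delta>] by blast
  define z where "z = h + \<i> *\<^sub>C k"
  have hkX: "h \<in> X" "k \<in> X" using hk D(3) by auto
  have zX: "z \<in> X" unfolding z_def using hkX by (intro op_sys_add[OF D(1)] op_sys_scaleC[OF D(1)])
  have "\<Theta> z = z"
    using lin hkX op_sys_scaleC[OF D(1) hkX(2)] unfolding z_def clinear_on_def by (simp add: id hk)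
  moreover have "\<Theta> (x - z + z) = \<Theta> (x - z) + \<Theta> z"
    using lin op_sys_diff[OF D(1) x zX] zX unfolding clinear_on_def by blast
  ultimately have "\<Theta> x - x = \<Theta> (x - z) - (x - z)" by simp
  then have "norm (\<Theta> x - x) \<le> norm (\<Theta> (x - z)) + norm (x - z)" using norm_triangle_ineq4 by metis
  also have "\<dots> \<le> (\<bar>C\<bar> + 1) * norm (x - z)"
  proof -
    have "norm (\<Theta> (x - z)) \<le> C * norm (x - z)" by (rule bound[OF op_sys_diff[OF D(1) x zX]])
    also have "\<dots> \<le> \<bar>C\<bar> * norm (x - z)" by (intro mult_right_mono) auto
    finally show ?thesis by (simp add: distrib_right)
  qed
  also have "\<dots> < (\<bar>C\<bar> + 1) * \<delta>"
    using near unfolding z_def by (intro mult_strict_left_mono) auto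
  also have "\<dots> = norm (\<Theta> x - x)" by (simp add: \<delta>_def)
  finally show False by simp
qed

lemma n_positive_on_cong:
  assumes "\<And>x. x \<in> X \<Longrightarrow> f x = g x"
  shows "n_positive_on m X f \<longleftrightarrow> n_positive_on m X g"
proof -
  have "map_mat f P = map_mat g P" if "P \<in> mat_over m X" for P
    using that assms by (intro eq_matI) (auto simp: mat_over_iff)
  then show ?thesis by (simp add: n_positive_on_def)
qed

lemma tendsto_apply:
  fixes f :: "'k \<Rightarrow> 'i \<Rightarrow> 'c::topological_space"
  assumes "(f \<longlongrightarrow> g) G" shows "((\<lambda>k. f k i) \<longlongrightarrow> g i) G"
proof (rule topological_tendstoI)
  fix S :: "'c set" assume S: "open S" "g i \<in> S"
  have "open ((\<lambda>h :: 'i \<Rightarrow> 'c. h i) -` S)"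
    by (rule open_vimage[OF S(1) continuous_on_product_coordinates])
  from topological_tendstoD[OF assms this] show "\<forall>\<^sub>F k in G. f k i \<in> S" using S(2) by simp
qed

theorem order_iso_if_small_distances:
  fixes X D :: "'a::unital_cstar_algebra set" and L :: "'a \<Rightarrow> real"
    and Y E :: "'b::unital_cstar_algebra set" and L' :: "'b \<Rightarrow> real"
  assumes X: "lip_normed_operator_system X D L" and Y: "lip_normed_operator_system Y E L'"
    and N: "N \<noteq> {}" "N \<subseteq> {1..}"
    and small: "\<And>e. e > 0 \<Longrightarrow> \<exists>\<Lambda>\<in>admissible_lip_norms X D L Y E L'. \<forall>n\<in>N.
      hausdorff_dist (ucp_dist (D \<oplus>\<^sub>d E) \<Lambda>) (UCP_fst n X Y) (UCP_snd n X Y) < ennreal e"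
  obtains \<Phi> where "bij_betw \<Phi> X Y" "clinear_on X \<Phi>" "\<Phi> 1 = 1" "bi_lip_isometric X D L E L' \<Phi>"
    "\<And>n m. n \<in> N \<Longrightarrow> m \<in> {1..n} \<Longrightarrow> n_positive_on m X \<Phi> \<and> n_positive_on m Y (inv_into X \<Phi>)"
proof -
  note D = lip_system_basics[OF X] and E = lip_system_basics[OF Y]
  note Ds = lip_domain_simps[OF D(2)] and Es = lip_domain_simps[OF E(2)]
  define e where "e k = inverse (real (Suc k))" for k
  have e_pos: "e k > 0" and e_le: "e k \<le> 1" for k by (simp_all add: e_def field_simps)
  have "\<exists>\<Lambda>\<in>admissible_lip_norms X D L Y E L'. \<forall>n\<in>N.
      hausdorff_dist (ucp_dist (D \<oplus>\<^sub>d E) \<Lambda>) (UCP_fst n X Y) (UCP_snd n X Y) < ennreal (e k)" for k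
    by (rule small[OF e_pos])
  then obtain \<Lambda> where \<Lambda>: "\<And>k. \<Lambda> k \<in> admissible_lip_norms X D L Y E L'"
    and dist: "\<And>k n. n \<in> N \<Longrightarrow> hausdorff_dist (ucp_dist (D \<oplus>\<^sub>d E) (\<Lambda> k)) (UCP_fst n X Y) (UCP_snd n X Y) < ennreal (e k)"
    by metis
  define M where "M k a b = \<Lambda> k (DSum a b)" for k a b
  define y where "y k a = (if a \<in> D then SOME b. b \<in> E \<and> M k a b \<le> L a + e k else 0)" for k a
  define x where "x k b = (if b \<in> E then SOME a. a \<in> D \<and> M k a b \<le> L' b + e k else 0)" for k b
  have y: "y k a \<in> E \<and> M k a (y k a) \<le> L a + e k" if "a \<in> D" for k a
    unfolding y_def if_P[OF that]
    by (rule someI_ex) (use admissible_quotient(3)[OF X Y \<Lambda> that Es(1) e_pos] in \<open>auto simp: M_def\<close>)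
  have x: "x k b \<in> D \<and> M k (x k b) b \<le> L' b + e k" if "b \<in> E" for k b
    unfolding x_def if_P[OF that]
    by (rule someI_ex) (use admissible_quotient(4)[OF X Y \<Lambda> Ds(1) that e_pos] in \<open>auto simp: M_def\<close>)
  have close1: "\<exists>\<phi>\<in>UCP n X. \<forall>a\<in>D. \<forall>b\<in>E. \<forall>c>0. M k a b \<le> c \<longrightarrow> (\<forall>p<n. \<forall>q<n. cmod (\<phi> a $$ (p, q) - \<psi> b $$ (p, q)) \<le> c * e k)"
    if "n \<in> N" "\<psi> \<in> UCP n Y" for n k \<psi>
    unfolding M_def by (rule hausdorff_dist_UCP_close(2)[OF X Y \<Lambda> dist[OF that(1)] that(2)])
  have close2: "\<exists>\<psi>\<in>UCP n Y. \<forall>b\<in>E. \<forall>a\<in>D. \<forall>c>0. M k a b \<le> c \<longrightarrow> (\<forall>p<n. \<forall>q<n. cmod (\<psi> b $$ (p, q) - \<phi> a $$ (p, q)) \<le> c * e k)"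
    if "n \<in> N" "\<phi> \<in> UCP n X" for n k \<phi>
    using hausdorff_dist_UCP_close(1)[OF X Y \<Lambda> dist[OF that(1)] that(2), of k]
    unfolding M_def by (subst norm_minus_commute) blast
  obtain n0 where n0: "n0 \<in> N" "n0 \<ge> 1" using N by auto
  have norm1: "norm b \<le> norm a + c * e k" and norm2: "norm a \<le> norm b + c * e k"
    if ab: "a \<in> D" "b \<in> E" "0 < c" "M k a b \<le> c" for k a b c
  proof -
    have sa: "a \<in> sa_part X" "b \<in> sa_part Y" using ab D(4) E(4) by auto
    show "norm b \<le> norm a + c * e k"
    proof (rule norm_le_if_UCP_close[OF D(1) E(1) sa n0(2)])
      fix \<psi> assume "\<psi> \<in> UCP n0 Y"
      from close1[OF n0(1) this, of k] show "\<exists>\<phi>\<in>UCP n0 X. cmod (\<phi> a $$ (0, 0) - \<psi> b $$ (0, 0)) \<le> c * e k"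
        using ab n0(2) by fastforce
    qed
    show "norm a \<le> norm b + c * e k"
    proof (rule norm_le_if_UCP_close[OF E(1) D(1) sa(2,1) n0(2)])
      fix \<psi> assume "\<psi> \<in> UCP n0 X"
      from close2[OF n0(1) this, of k] show "\<exists>\<phi>\<in>UCP n0 Y. cmod (\<phi> b $$ (0, 0) - \<psi> a $$ (0, 0)) \<le> c * e k"
        using ab n0(2) by fastforce
    qed
  qed
  \<comment> \<open>All the choices \<open>y k a\<close> and \<open>x k b\<close> lie in compact sets that do not depend on \<open>k\<close>, so by
    Tychonoff's theorem both families have a common cluster point.\<close>
  define KY where "KY a = (if a \<in> D then {b \<in> E. L' b \<le> L a + 1 \<and> norm b \<le> norm a + (L a + 1)} else {0})" for a
  define KX where "KX b = (if b \<in> E then {a \<in> D. L a \<le> L' b + 1 \<and> norm a \<le> norm b + (L' b + 1)} else {0})" for b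
  have "y k a \<in> KY a" for k a
  proof (cases "a \<in> D")
    case True
    have 0: "0 < L a + 1" using lip_norm_basics(1)[OF D(2,5) True] by simp
    have le: "M k a (y k a) \<le> L a + 1" using y[OF True, of k] e_le[of k] by linarith
    have "norm (y k a) \<le> norm a + (L a + 1) * e k" using norm1[OF True _ 0 le] y[OF True] by blast
    also have "\<dots> \<le> norm a + (L a + 1)" using 0 e_le[of k] by (simp add: mult_left_le)
    finally show ?thesis
      using True y[OF True, of k] le admissible_quotient(2)[OF X Y \<Lambda> True, of "y k a" k] by (simp add: KY_def M_def)
  qed (simp add: KY_def y_def)
  moreover have "x k b \<in> KX b" for k b
  proof (cases "b \<in> E")
    case True
    have 0: "0 < L' b + 1" using lip_norm_basics(1)[OF E(2,5) True] by simp
    have le: "M k (x k b) b \<le> L' b + 1" using x[OF True, of k] e_le[of k] by linarith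
    have "norm (x k b) \<le> norm b + (L' b + 1) * e k" using norm2[OF _ True 0 le] x[OF True] by blast
    also have "\<dots> \<le> norm b + (L' b + 1)" using 0 e_le[of k] by (simp add: mult_left_le)
    finally show ?thesis
      using True x[OF True, of k] le admissible_quotient(1)[OF X Y \<Lambda> _ True, of "x k b" k] by (simp add: KX_def M_def)
  qed (simp add: KX_def x_def)
  ultimately have mem: "(y k, x k) \<in> PiE UNIV KY \<times> PiE UNIV KX" for k by (simp add: PiE_UNIV_domain)
  have "compact (KY a)" for a
    using lip_ball_closed(2)[OF Y, of "L a + 1"] lip_norm_basics(1)[OF D(2,5), of a]
    by (cases "a \<in> D") (auto simp: KY_def add_nonneg_pos)
  then have cY: "compact (PiE UNIV KY)"
    using compactin_PiE[of "\<lambda>_. euclidean" UNIV KY] by (simp add: euclidean_product_topology)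
  have "compact (KX b)" for b
    using lip_ball_closed(2)[OF X, of "L' b + 1"] lip_norm_basics(1)[OF E(2,5), of b]
    by (cases "b \<in> E") (auto simp: KX_def add_nonneg_pos)
  then have cX: "compact (PiE UNIV KX)"
    using compactin_PiE[of "\<lambda>_. euclidean" UNIV KX] by (simp add: euclidean_product_topology)
  obtain z G where G: "G \<noteq> bot" "G \<le> sequentially" and z: "((\<lambda>k. (y k, x k)) \<longlongrightarrow> z) G"
    by (rule cluster_filter[OF compact_Times[OF cY cX] mem]) (rule that)
  define F where "F = fst z"
  define H where "H = snd z"
  have F: "((\<lambda>k. y k a) \<longlongrightarrow> F a) G" for a
    unfolding F_def using tendsto_apply[OF tendsto_fst[OF z], of a] by simp
  have H: "((\<lambda>k. x k b) \<longlongrightarrow> H b) G" for b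
    unfolding H_def using tendsto_apply[OF tendsto_snd[OF z], of b] by simp
  have e0: "(e \<longlongrightarrow> 0) G"
    using LIMSEQ_inverse_real_of_nat unfolding e_def[abs_def] by (rule tendsto_mono[OF G(2)])
  have B: "lip_bridge X D L Y E L' N M e G y F"
  proof
    show "\<And>k a b a' b'. \<lbrakk>a \<in> D; b \<in> E; a' \<in> D; b' \<in> E\<rbrakk> \<Longrightarrow> M k (a + a') (b + b') \<le> M k a b + M k a' b'"
      unfolding M_def by (rule admissible_seminorm(2)[OF X Y \<Lambda>])
    show "\<And>k a b r. \<lbrakk>a \<in> D; b \<in> E\<rbrakk> \<Longrightarrow> M k (r *\<^sub>R a) (r *\<^sub>R b) = \<bar>r\<bar> * M k a b"
      unfolding M_def by (rule admissible_seminorm(3)[OF X Y \<Lambda>])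
    show "\<And>k. M k 1 1 = 0" unfolding M_def by (rule admissible_seminorm(4)[OF X Y \<Lambda>])
    show "\<And>k a b. \<lbrakk>a \<in> D; b \<in> E\<rbrakk> \<Longrightarrow> L' b \<le> M k a b"
      unfolding M_def by (rule admissible_quotient(2)[OF X Y \<Lambda>])
  qed (use X Y G(1) e0 e_pos e_le norm1 norm2 y F close1 in blast)+
  have C: "lip_bridge Y E L' X D L N (\<lambda>k b a. M k a b) e G x H"
  proof
    show "\<And>k b a b' a'. \<lbrakk>b \<in> E; a \<in> D; b' \<in> E; a' \<in> D\<rbrakk> \<Longrightarrow> M k (a + a') (b + b') \<le> M k a b + M k a' b'"
      unfolding M_def by (rule admissible_seminorm(2)[OF X Y \<Lambda>])
    show "\<And>k b a r. \<lbrakk>b \<in> E; a \<in> D\<rbrakk> \<Longrightarrow> M k (r *\<^sub>R a) (r *\<^sub>R b) = \<bar>r\<bar> * M k a b"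
      unfolding M_def by (rule admissible_seminorm(3)[OF X Y \<Lambda>])
    show "\<And>k. M k 1 1 = 0" unfolding M_def by (rule admissible_seminorm(4)[OF X Y \<Lambda>])
    show "\<And>k b a. \<lbrakk>b \<in> E; a \<in> D\<rbrakk> \<Longrightarrow> L a \<le> M k a b"
      unfolding M_def by (rule admissible_quotient(1)[OF X Y \<Lambda>])
  qed (use X Y G(1) e0 e_pos e_le norm1 norm2 x H close2 in blast)+
  interpret B: lip_bridge X D L Y E L' N M e G y F by (rule B)
  interpret C: lip_bridge Y E L' X D L N "\<lambda>k b a. M k a b" e G x H by (rule C)
  have HF: "H (F a) = a" if "a \<in> D" for a by (rule lip_bridge_inverse[OF B C that])
  have FH: "F (H b) = b" if "b \<in> E" for b by (rule lip_bridge_inverse[OF C B that])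
  obtain \<Phi> where \<Phi>: "\<And>x. x \<in> X \<Longrightarrow> \<Phi> x \<in> Y" "clinear_on X \<Phi>" "\<Phi> 1 = 1" "\<And>a. a \<in> D \<Longrightarrow> \<Phi> a = F a"
    "\<And>x. x \<in> X \<Longrightarrow> norm (\<Phi> x) \<le> 2 * norm x" "\<And>n m. n \<in> N \<Longrightarrow> m \<in> {1..n} \<Longrightarrow> n_positive_on m X \<Phi>"
    using B.extension by blast
  obtain \<Psi> where \<Psi>: "\<And>x. x \<in> Y \<Longrightarrow> \<Psi> x \<in> X" "clinear_on Y \<Psi>" "\<Psi> 1 = 1" "\<And>b. b \<in> E \<Longrightarrow> \<Psi> b = H b"
    "\<And>x. x \<in> Y \<Longrightarrow> norm (\<Psi> x) \<le> 2 * norm x" "\<And>n m. n \<in> N \<Longrightarrow> m \<in> {1..n} \<Longrightarrow> n_positive_on m Y \<Psi>"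
    using C.extension by blast
  have \<Psi>\<Phi>: "\<Psi> (\<Phi> u) = u" if "u \<in> X" for u
  proof (rule identity_from_dense[OF X _ _ _ that, where \<Theta>="\<lambda>x. \<Psi> (\<Phi> x)" and C=4])
    show "clinear_on X (\<lambda>x. \<Psi> (\<Phi> x))" using \<Phi>(1,2) \<Psi>(2) by (simp add: clinear_on_def)
    show "norm (\<Psi> (\<Phi> x)) \<le> 4 * norm x" if "x \<in> X" for x
      using \<Psi>(5)[OF \<Phi>(1)[OF that]] \<Phi>(5)[OF that] by linarith
    show "\<Psi> (\<Phi> a) = a" if "a \<in> D" for a using that by (simp add: \<Phi>(4) \<Psi>(4) B.F_mem_E HF)
  qed
  have \<Phi>\<Psi>: "\<Phi> (\<Psi> u) = u" if "u \<in> Y" for u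
  proof (rule identity_from_dense[OF Y _ _ _ that, where \<Theta>="\<lambda>x. \<Phi> (\<Psi> x)" and C=4])
    show "clinear_on Y (\<lambda>x. \<Phi> (\<Psi> x))" using \<Psi>(1,2) \<Phi>(2) by (simp add: clinear_on_def)
    show "norm (\<Phi> (\<Psi> x)) \<le> 4 * norm x" if "x \<in> Y" for x
      using \<Phi>(5)[OF \<Psi>(1)[OF that]] \<Psi>(5)[OF that] by linarith
    show "\<Phi> (\<Psi> a) = a" if "a \<in> E" for a using that by (simp add: \<Phi>(4) \<Psi>(4) C.F_mem_E FH)
  qed
  have bij: "bij_betw \<Phi> X Y"
    by (rule bij_betw_byWitness[where f'=\<Psi>]) (use \<Psi>\<Phi> \<Phi>\<Psi> \<Phi>(1) \<Psi>(1) in auto)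
  have inv: "inv_into X \<Phi> b = \<Psi> b" if "b \<in> Y" for b
    by (rule inv_into_f_eq) (use bij \<Phi>\<Psi>[OF that] \<Psi>(1)[OF that] in \<open>auto simp: bij_betw_def\<close>)
  show thesis
  proof (rule that[OF bij \<Phi>(2,3)])
    have "L' (F a) = L a" if "a \<in> D" for a
      using B.F_lip_le[OF that] C.F_lip_le[OF B.F_mem_E[OF that]] HF[OF that] by simp
    moreover have "L (H b) = L' b" if "b \<in> E" for b
      using C.F_lip_le[OF that] B.F_lip_le[OF C.F_mem_E[OF that]] FH[OF that] by simp
    moreover have "inv_into X \<Phi> b = H b" if "b \<in> E" for b using that E(3) inv \<Psi>(4) by auto
    ultimately show "bi_lip_isometric X D L E L' \<Phi>"
      using B.F_mem_E C.F_mem_E by (auto simp: bi_lip_isometric_def lip_isometric_def \<Phi>(4))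
    fix n m assume "n \<in> N" "m \<in> {1..n}"
    then show "n_positive_on m X \<Phi> \<and> n_positive_on m Y (inv_into X \<Phi>)"
      using \<Phi>(6) \<Psi>(6) n_positive_on_cong[of Y "inv_into X \<Phi>" \<Psi> m] inv by blast
  qed
qed

section \<open>From an order isomorphism to vanishing distance\<close>

lemma positive_elem_if_1_positive:
  assumes "n_positive_on 1 X \<Phi>" "x \<in> X" "positive_elem x"
  shows "positive_elem (\<Phi> x)"
proof -
  have "positive_mat 1 (map_mat \<Phi> (mat 1 1 (\<lambda>_. x)))"
    using assms(1)[unfolded n_positive_on_def, THEN bspec, OF mat_over_one[OF assms(2)]] assms(3)
    by (simp only: positive_mat_one_iff)
  moreover have "map_mat \<Phi> (mat 1 1 (\<lambda>_. x)) = mat 1 1 (\<lambda>_. \<Phi> x)" by (rule eq_matI) auto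
  ultimately show ?thesis by (simp only: positive_mat_one_iff)
qed

text \<open>Apply \<open>\<Phi>\<close> to the positive elements \<open>\<parallel>x\<parallel> \<plusminus> x\<close>.\<close>

lemma unital_positive_contraction:
  assumes X: "operator_system X" and \<Phi>: "clinear_on X \<Phi>" "\<Phi> 1 = 1" "n_positive_on 1 X \<Phi>" and x: "x \<in> sa_part X"
  shows "star (\<Phi> x) = \<Phi> x" "norm (\<Phi> x) \<le> norm x"
proof -
  have xX: "x \<in> X" and sx: "star x = x" using x by (auto simp: sa_part_def)
  have scale: "\<Phi> (r *\<^sub>R 1) = r *\<^sub>R 1" for r
    using \<Phi>(1,2) op_sys_one[OF X] by (simp add: clinear_on_def flip: scaleC_of_real)
  have one: "r *\<^sub>R 1 \<in> X" for r by (intro op_sys_scaleR[OF X] op_sys_one[OF X])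
  have plus: "\<Phi> (norm x *\<^sub>R 1 + x) = norm x *\<^sub>R 1 + \<Phi> x"
    using \<Phi>(1) one xX by (simp add: clinear_on_def scale)
  have "\<Phi> (norm x *\<^sub>R 1 + (- 1) *\<^sub>C x) = norm x *\<^sub>R 1 + (- 1) *\<^sub>C \<Phi> x"
    using \<Phi>(1) one xX op_sys_scaleC[OF X xX, of "- 1"] unfolding clinear_on_def by (metis scale)
  then have minus: "\<Phi> (norm x *\<^sub>R 1 - x) = norm x *\<^sub>R 1 - \<Phi> x" by (simp add: scaleC_minus_left)
  have 1: "positive_elem (norm x *\<^sub>R 1 + \<Phi> x)"
    unfolding plus[symmetric]
    by (intro positive_elem_if_1_positive[OF \<Phi>(3)] op_sys_add[OF X] one xX positive_elem_shift sx order_refl)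
  have 2: "positive_elem (norm x *\<^sub>R 1 - \<Phi> x)"
    unfolding minus[symmetric]
    by (intro positive_elem_if_1_positive[OF \<Phi>(3)] op_sys_diff[OF X] one xX positive_elem_shift_minus sx order_refl)
  show "star (\<Phi> x) = \<Phi> x" using positive_elem_sa[OF 1] by (simp add: star_add star_scaleR)
  show "norm (\<Phi> x) \<le> norm x" by (rule norm_le_if_positive_elem[OF 2 1])
qed

lemma clinear_on_diff:
  assumes X: "operator_system X" and \<Phi>: "clinear_on X \<Phi>" and xy: "x \<in> X" "y \<in> X"
  shows "\<Phi> (x - y) = \<Phi> x - \<Phi> y"
proof -
  have "\<Phi> (x + (- 1) *\<^sub>C y) = \<Phi> x + (- 1) *\<^sub>C \<Phi> y"
    using \<Phi> xy op_sys_scaleC[OF X xy(2), of "- 1"] unfolding clinear_on_def by metis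
  then show ?thesis by (simp add: scaleC_minus_left)
qed

lemma clinear_on_scaleR: "clinear_on X \<Phi> \<Longrightarrow> x \<in> X \<Longrightarrow> \<Phi> (r *\<^sub>R x) = r *\<^sub>R \<Phi> x"
  by (simp add: clinear_on_def flip: scaleC_of_real)

lemma clinear_on_inv_into:
  assumes X: "operator_system X" and bij: "bij_betw \<Phi> X Y" and lin: "clinear_on X \<Phi>"
  shows "clinear_on Y (inv_into X \<Phi>)"
  unfolding clinear_on_def
proof (intro conjI ballI allI)
  let ?\<Psi> = "inv_into X \<Phi>"
  have inj: "inj_on \<Phi> X" and mem: "\<And>y. y \<in> Y \<Longrightarrow> ?\<Psi> y \<in> X" and right: "\<And>y. y \<in> Y \<Longrightarrow> \<Phi> (?\<Psi> y) = y"
    using bij by (auto simp: bij_betw_def inv_into_into f_inv_into_f)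
  show "?\<Psi> (x + y) = ?\<Psi> x + ?\<Psi> y" if "x \<in> Y" "y \<in> Y" for x y
    using lin mem right that by (intro inv_into_f_eq[OF inj]) (auto simp: clinear_on_def op_sys_add[OF X])
  show "?\<Psi> (c *\<^sub>C x) = c *\<^sub>C ?\<Psi> x" if "x \<in> Y" for c x
    using lin mem right that by (intro inv_into_f_eq[OF inj]) (auto simp: clinear_on_def op_sys_scaleC[OF X])
qed

lemma UCP_diff:
  assumes X: "operator_system X" and \<phi>: "\<phi> \<in> UCP n X" and ab: "a \<in> X" "b \<in> X"
  shows "\<phi> a - \<phi> b = \<phi> (a - b)"
proof (rule eq_matI)
  note car = UCP_carrier[OF X \<phi> ab(1)] UCP_carrier[OF X \<phi> ab(2)] UCP_carrier[OF X \<phi> op_sys_diff[OF X ab]]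
  show "dim_row (\<phi> a - \<phi> b) = dim_row (\<phi> (a - b))" "dim_col (\<phi> a - \<phi> b) = dim_col (\<phi> (a - b))"
    using car by auto
  fix i j assume "i < dim_row (\<phi> (a - b))" "j < dim_col (\<phi> (a - b))"
  then have "i < n" "j < n" using car(3) by auto
  then show "(\<phi> a - \<phi> b) $$ (i, j) = \<phi> (a - b) $$ (i, j)"
    using car by (simp add: UCP_entry_diff[OF X \<phi> ab])
qed

text \<open>The isomorphism is used as a bridge: \<open>max (L x) (L' y) (\<parallel>\<Phi> x - y\<parallel> / e)\<close> has the right quotients,
  because \<open>y = \<Phi> x\<close> attains the infimum, and it forces matched elements within \<open>e\<close>.\<close>

theorem small_distances_if_order_iso:
  fixes X D :: "'a::unital_cstar_algebra set" and L :: "'a \<Rightarrow> real"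
    and Y E :: "'b::unital_cstar_algebra set" and L' :: "'b \<Rightarrow> real"
  assumes X: "lip_normed_operator_system X D L" and Y: "lip_normed_operator_system Y E L'"
    and bij: "bij_betw \<Phi> X Y" and lin: "clinear_on X \<Phi>" and one: "\<Phi> 1 = 1"
    and iso: "bi_lip_isometric X D L E L' \<Phi>"
    and pos1: "n_positive_on 1 X \<Phi>" "n_positive_on 1 Y (inv_into X \<Phi>)"
    and N: "N \<subseteq> {1..}" and pos: "\<And>n. n \<in> N \<Longrightarrow> n_positive_on n X \<Phi> \<and> n_positive_on n Y (inv_into X \<Phi>)"
    and e: "e > 0"
  shows "\<exists>\<Lambda>\<in>admissible_lip_norms X D L Y E L'. \<forall>n\<in>N.
      hausdorff_dist (ucp_dist (D \<oplus>\<^sub>d E) \<Lambda>) (UCP_fst n X Y) (UCP_snd n X Y) \<le> ennreal e"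
proof -
  note D = lip_system_basics[OF X] and E = lip_system_basics[OF Y]
  note Ds = lip_domain_simps[OF D(2)] and Es = lip_domain_simps[OF E(2)]
  note L = lip_norm_basics[OF D(2,5)] and L' = lip_norm_basics[OF E(2,5)]
  define \<Psi> where "\<Psi> = inv_into X \<Phi>"
  have \<Phi>Y: "\<Phi> x \<in> Y" if "x \<in> X" for x using bij that by (auto simp: bij_betw_def)
  have \<Psi>X: "\<Psi> y \<in> X" and \<Phi>\<Psi>: "\<Phi> (\<Psi> y) = y" if "y \<in> Y" for y
    using bij that by (auto simp: bij_betw_def \<Psi>_def inv_into_into f_inv_into_f)
  have \<Psi>\<Phi>: "\<Psi> (\<Phi> x) = x" if "x \<in> X" for x using bij that by (simp add: bij_betw_def \<Psi>_def)
  have lin': "clinear_on Y \<Psi>" unfolding \<Psi>_def by (rule clinear_on_inv_into[OF D(1) bij lin])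
  have one': "\<Psi> 1 = 1" using \<Psi>\<Phi>[OF op_sys_one[OF D(1)]] one by simp
  have \<Phi>E: "\<Phi> a \<in> E" "L' (\<Phi> a) = L a" if "a \<in> D" for a using iso that by (auto simp: bi_lip_isometric_def lip_isometric_def)
  have \<Psi>D: "\<Psi> b \<in> D" "L (\<Psi> b) = L' b" if "b \<in> E" for b using iso that by (auto simp: bi_lip_isometric_def lip_isometric_def \<Psi>_def)
  have pos1': "n_positive_on 1 Y \<Psi>" using pos1(2) by (simp add: \<Psi>_def)
  have con: "norm (\<Phi> x) \<le> norm x" if "x \<in> sa_part X" for x by (rule unital_positive_contraction(2)[OF D(1) lin one pos1(1) that])
  have con': "norm (\<Psi> y) \<le> norm y" if "y \<in> sa_part Y" for y by (rule unital_positive_contraction(2)[OF E(1) lin' one' pos1' that])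
  have DX: "a \<in> X" "a \<in> sa_part X" if "a \<in> D" for a using D(3,4) that by auto
  have EY: "b \<in> Y" "b \<in> sa_part Y" if "b \<in> E" for b using E(3,4) that by auto
  have \<Phi>_diff: "\<Phi> (a - a') = \<Phi> a - \<Phi> a'" if "a \<in> D" "a' \<in> D" for a a'
    using clinear_on_diff[OF D(1) lin] DX that by blast
  have \<Phi>_scale: "\<Phi> (r *\<^sub>R a) = r *\<^sub>R \<Phi> a" if "a \<in> D" for a r using clinear_on_scaleR[OF lin] DX that by blast
  have \<Phi>_add: "\<Phi> (a + a') = \<Phi> a + \<Phi> a'" if "a \<in> D" "a' \<in> D" for a a'
    using lin DX that by (simp add: clinear_on_def)
  define \<Lambda> where "\<Lambda> u = max (max (L (dfst u)) (L' (dsnd u))) (norm (\<Phi> (dfst u) - dsnd u) / e)" for u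
  have \<Lambda>_le: "\<Lambda> u \<le> c \<longleftrightarrow> L (dfst u) \<le> c \<and> L' (dsnd u) \<le> c \<and> norm (\<Phi> (dfst u) - dsnd u) \<le> c * e" for u c
    using e by (simp add: \<Lambda>_def divide_le_eq)
  have \<Lambda>_ge: "L (dfst u) \<le> \<Lambda> u" "L' (dsnd u) \<le> \<Lambda> u" "norm (\<Phi> (dfst u) - dsnd u) \<le> \<Lambda> u * e" for u
    using \<Lambda>_le[of u "\<Lambda> u"] by auto
  have dom: "lip_domain (D \<oplus>\<^sub>d E)" by (rule lip_domain_dsum[OF D(2) E(2)])
  have semi: "seminorm_on (D \<oplus>\<^sub>d E) \<Lambda>"
    unfolding seminorm_on_def
  proof (intro conjI ballI allI)
    fix u assume u: "u \<in> D \<oplus>\<^sub>d E"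
    show "0 \<le> \<Lambda> u" using u L(1)[of "dfst u"] \<Lambda>_ge(1)[of u] by (simp add: dsum_set_iff)
    show "\<Lambda> (r *\<^sub>R u) = \<bar>r\<bar> * \<Lambda> u" for r
    proof -
      have "norm (\<Phi> (r *\<^sub>R dfst u) - r *\<^sub>R dsnd u) = \<bar>r\<bar> * norm (\<Phi> (dfst u) - dsnd u)"
        using u by (simp add: dsum_set_iff \<Phi>_scale flip: scaleR_diff_right)
      then show ?thesis
        using u by (simp add: \<Lambda>_def dsum_set_iff L(3) L'(3) max_mult_distrib_left)
    qed
    fix w assume w: "w \<in> D \<oplus>\<^sub>d E"
    show "\<Lambda> (u + w) \<le> \<Lambda> u + \<Lambda> w"
      unfolding \<Lambda>_le
    proof (intro conjI)
      show "L (dfst (u + w)) \<le> \<Lambda> u + \<Lambda> w"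
        using L(2)[of "dfst u" "dfst w"] u w \<Lambda>_ge(1)[of u] \<Lambda>_ge(1)[of w] by (simp add: dsum_set_iff)
      show "L' (dsnd (u + w)) \<le> \<Lambda> u + \<Lambda> w"
        using L'(2)[of "dsnd u" "dsnd w"] u w \<Lambda>_ge(2)[of u] \<Lambda>_ge(2)[of w] by (simp add: dsum_set_iff)
      have "\<Phi> (dfst (u + w)) - dsnd (u + w) = (\<Phi> (dfst u) - dsnd u) + (\<Phi> (dfst w) - dsnd w)"
        using u w by (simp add: dsum_set_iff \<Phi>_add)
      then have "norm (\<Phi> (dfst (u + w)) - dsnd (u + w)) \<le> norm (\<Phi> (dfst u) - dsnd u) + norm (\<Phi> (dfst w) - dsnd w)"
        by (simp only: norm_triangle_ineq)
      also have "\<dots> \<le> (\<Lambda> u + \<Lambda> w) * e"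
        using \<Lambda>_ge(3)[of u] \<Lambda>_ge(3)[of w] by (simp add: distrib_right)
      finally show "norm (\<Phi> (dfst (u + w)) - dsnd (u + w)) \<le> (\<Lambda> u + \<Lambda> w) * e" .
    qed
  qed
  have kernel: "\<Lambda> u = 0 \<longleftrightarrow> u \<in> range (\<lambda>r. r *\<^sub>R 1)" if u: "u \<in> D \<oplus>\<^sub>d E" for u
  proof
    assume 0: "\<Lambda> u = 0"
    have "L (dfst u) = 0" using \<Lambda>_ge(1)[of u] L(1)[of "dfst u"] 0 u by (simp add: dsum_set_iff)
    then obtain r where r: "dfst u = r *\<^sub>R 1" using L(5)[of "dfst u"] u by (auto simp: dsum_set_iff)
    have "\<Phi> (dfst u) = dsnd u" using \<Lambda>_ge(3)[of u] 0 by simp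
    then have "dsnd u = r *\<^sub>R 1" by (simp add: r \<Phi>_scale[OF Ds(2)] one)
    with r have "u = r *\<^sub>R 1" by (cases u) (simp add: one_dsum_def)
    then show "u \<in> range (\<lambda>r. r *\<^sub>R 1)" by blast
  next
    assume "u \<in> range (\<lambda>r. r *\<^sub>R 1)"
    then obtain r where r: "u = DSum (r *\<^sub>R 1) (r *\<^sub>R 1)" by (auto simp: one_dsum_def)
    show "\<Lambda> u = 0" by (simp add: \<Lambda>_def r L(4) L'(4) \<Phi>_scale[OF Ds(2)] one)
  qed
  obtain R where R: "\<And>a. a \<in> D \<Longrightarrow> L a \<le> 1 \<Longrightarrow> \<exists>r. norm (a - r *\<^sub>R 1) \<le> R"
    by (rule lip_norm_radius[OF D(2,5)]) (rule that)
  define KX where "KX = {a \<in> D. L a \<le> 1 \<and> norm a \<le> R}"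
  define KY where "KY = {b \<in> E. L' b \<le> 1 \<and> norm b \<le> R + e}"
  define K where "K = (\<lambda>p. DSum (fst p) (snd p)) ` (KX \<times> KY)"
  have "bounded_linear (\<lambda>p :: 'a \<times> 'b. DSum (fst p) (snd p))"
    by (rule bounded_linear_intro[where K=1])
      (auto simp: norm_dsum_def intro: norm_fst_le norm_snd_le)
  then have "compact K"
    unfolding K_def KX_def KY_def
    by (intro compact_continuous_image linear_continuous_on compact_Times
        lip_norm_compact[OF D(2,5,8)] lip_norm_compact[OF E(2,5,8)])
  moreover have "K \<subseteq> D \<oplus>\<^sub>d E" by (auto simp: K_def KX_def KY_def dsum_set_iff)
  moreover have "\<exists>r. u - r *\<^sub>R 1 \<in> K" if u: "u \<in> D \<oplus>\<^sub>d E" and le: "\<Lambda> u \<le> 1" for u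
  proof -
    have ab: "dfst u \<in> D" "dsnd u \<in> E" using u by (auto simp: dsum_set_iff)
    have le: "L (dfst u) \<le> 1" "L' (dsnd u) \<le> 1" "norm (\<Phi> (dfst u) - dsnd u) \<le> e"
      using le \<Lambda>_le[of u 1] by auto
    obtain r where r: "norm (dfst u - r *\<^sub>R 1) \<le> R" using R[OF ab(1) le(1)] by blast
    have D1: "r *\<^sub>R 1 \<in> D" and E1: "r *\<^sub>R 1 \<in> E" by (simp_all add: Ds Es)
    have "L (dfst u - r *\<^sub>R 1) \<le> 1" using lip_norm_diff[OF D(2,5) ab(1) D1] le(1) L(4) by simp
    then have 1: "dfst u - r *\<^sub>R 1 \<in> KX" using r ab D1 by (simp add: KX_def Ds)
    have "dsnd u - r *\<^sub>R 1 = \<Phi> (dfst u - r *\<^sub>R 1) - (\<Phi> (dfst u) - dsnd u)"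
      by (simp add: \<Phi>_diff[OF ab(1) D1] \<Phi>_scale[OF Ds(2)] one)
    then have "norm (dsnd u - r *\<^sub>R 1) \<le> norm (\<Phi> (dfst u - r *\<^sub>R 1)) + norm (\<Phi> (dfst u) - dsnd u)"
      using norm_triangle_ineq4 by metis
    also have "\<dots> \<le> R + e"
      using con[of "dfst u - r *\<^sub>R 1"] DX(2)[of "dfst u - r *\<^sub>R 1"] ab(1) D1 r le(3) by (simp add: Ds)
    finally have "norm (dsnd u - r *\<^sub>R 1) \<le> R + e" .
    moreover have "L' (dsnd u - r *\<^sub>R 1) \<le> 1" using lip_norm_diff[OF E(2,5) ab(2) E1] le(2) L'(4) by simp
    ultimately have 2: "dsnd u - r *\<^sub>R 1 \<in> KY" using ab E1 by (simp add: KY_def Es)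
    have "u - r *\<^sub>R 1 = DSum (dfst u - r *\<^sub>R 1) (dsnd u - r *\<^sub>R 1)"
      by (cases u) (simp add: one_dsum_def)
    then have "u - r *\<^sub>R 1 \<in> K" unfolding K_def using 1 2 by (intro image_eqI[where x="(dfst u - r *\<^sub>R 1, dsnd u - r *\<^sub>R 1)"]) auto
    then show ?thesis by blast
  qed
  ultimately have lip: "lip_norm_on (D \<oplus>\<^sub>d E) \<Lambda>"
    using lip_norm_onI[OF dom semi kernel] by blast
  have fst_lim: "(\<lambda>k. dfst (w k)) \<longlonglongrightarrow> dfst u" and snd_lim: "(\<lambda>k. dsnd (w k)) \<longlonglongrightarrow> dsnd u"
    if "w \<longlonglongrightarrow> u" for w :: "nat \<Rightarrow> ('a, 'b) dsum" and u
  proof -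
    have "bounded_linear (dfst :: ('a, 'b) dsum \<Rightarrow> 'a)" "bounded_linear (dsnd :: ('a, 'b) dsum \<Rightarrow> 'b)"
      by (rule bounded_linear_intro[where K=1]; simp add: norm_dsum_def)+
    then show "(\<lambda>k. dfst (w k)) \<longlonglongrightarrow> dfst u" "(\<lambda>k. dsnd (w k)) \<longlonglongrightarrow> dsnd u"
      using that by (auto intro: bounded_linear.tendsto)
  qed
  have "closed (unit_lip_ball (D \<oplus>\<^sub>d E) \<Lambda>)"
    unfolding closed_sequential_limits
  proof (intro allI impI, elim conjE)
    fix w u assume w: "\<forall>k. w k \<in> unit_lip_ball (D \<oplus>\<^sub>d E) \<Lambda>" and lim: "w \<longlonglongrightarrow> u"
    have wk: "dfst (w k) \<in> unit_lip_ball D L" "dsnd (w k) \<in> unit_lip_ball E L'"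
      "norm (\<Phi> (dfst (w k)) - dsnd (w k)) \<le> e" for k
      using w[rule_format, of k] \<Lambda>_le[of "w k" 1] by (auto simp: unit_lip_ball_def dsum_set_iff)
    have u: "dfst u \<in> unit_lip_ball D L" "dsnd u \<in> unit_lip_ball E L'"
      using closed_sequentially[OF D(8) wk(1) fst_lim[OF lim]] closed_sequentially[OF E(8) wk(2) snd_lim[OF lim]] by auto
    have "(\<lambda>k. \<Phi> (dfst (w k)) - \<Phi> (dfst u)) \<longlonglongrightarrow> 0"
    proof (rule Lim_null_comparison)
      show "\<forall>\<^sub>F k in sequentially. norm (\<Phi> (dfst (w k)) - \<Phi> (dfst u)) \<le> norm (dfst (w k) - dfst u)"
      proof (rule always_eventually, rule allI)
        fix k
        have mem: "dfst (w k) \<in> D" "dfst u \<in> D" using wk(1)[of k] u(1) by (auto simp: unit_lip_ball_def)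
        show "norm (\<Phi> (dfst (w k)) - \<Phi> (dfst u)) \<le> norm (dfst (w k) - dfst u)"
          using con[OF DX(2)[OF Ds(4)[OF mem]]] by (simp add: \<Phi>_diff[OF mem])
      qed
      show "(\<lambda>k. norm (dfst (w k) - dfst u)) \<longlonglongrightarrow> 0"
        using tendsto_norm[OF tendsto_diff[OF fst_lim[OF lim] tendsto_const[of "dfst u"]]] by simp
    qed
    then have "(\<lambda>k. \<Phi> (dfst (w k))) \<longlonglongrightarrow> \<Phi> (dfst u)" by (simp add: LIM_zero_iff)
    then have "(\<lambda>k. norm (\<Phi> (dfst (w k)) - dsnd (w k))) \<longlonglongrightarrow> norm (\<Phi> (dfst u) - dsnd u)"
      by (intro tendsto_norm tendsto_diff snd_lim lim)
    then have "norm (\<Phi> (dfst u) - dsnd u) \<le> e" by (rule LIMSEQ_le_const2) (use wk(3) in auto)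
    then show "u \<in> unit_lip_ball (D \<oplus>\<^sub>d E) \<Lambda>"
      using u \<Lambda>_le[of u 1] by (auto simp: unit_lip_ball_def dsum_set_iff)
  qed
  moreover have "unit_lip_ball (D \<oplus>\<^sub>d E) \<Lambda> \<subseteq> sa_part (X \<oplus>\<^sub>d Y)"
  proof
    fix u assume "u \<in> unit_lip_ball (D \<oplus>\<^sub>d E) \<Lambda>"
    then have "dfst u \<in> sa_part X" "dsnd u \<in> sa_part Y" using DX EY by (auto simp: unit_lip_ball_def dsum_set_iff)
    then show "u \<in> sa_part (X \<oplus>\<^sub>d Y)" by (cases u) (auto simp: sa_part_def dsum_set_iff star_dsum_def)
  qed
  ultimately have closed: "closedin (top_of_set (sa_part (X \<oplus>\<^sub>d Y))) (unit_lip_ball (D \<oplus>\<^sub>d E) \<Lambda>)"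
    by (rule closed_subset[rotated])
  have quot: "L x = (INF y\<in>E. \<Lambda> (DSum x y))" if x: "x \<in> D" for x
  proof (rule antisym)
    show "L x \<le> (INF y\<in>E. \<Lambda> (DSum x y))"
      using Es(1) \<Lambda>_ge(1)[of "DSum x _"] by (intro cINF_greatest) auto
    have "(INF y\<in>E. \<Lambda> (DSum x y)) \<le> \<Lambda> (DSum x (\<Phi> x))"
      using \<Lambda>_ge(1)[of "DSum x _"] by (intro cINF_lower \<Phi>E[OF x] bdd_belowI2[where m="L x"]) auto
    also have "\<dots> = L x" using L(1)[OF x] by (simp add: \<Lambda>_def \<Phi>E[OF x])
    finally show "(INF y\<in>E. \<Lambda> (DSum x y)) \<le> L x" .
  qed
  have quot': "L' y = (INF x\<in>D. \<Lambda> (DSum x y))" if y: "y \<in> E" for y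
  proof (rule antisym)
    show "L' y \<le> (INF x\<in>D. \<Lambda> (DSum x y))"
      using Ds(1) \<Lambda>_ge(2)[of "DSum _ y"] by (intro cINF_greatest) auto
    have "(INF x\<in>D. \<Lambda> (DSum x y)) \<le> \<Lambda> (DSum (\<Psi> y) y)"
      using \<Lambda>_ge(2)[of "DSum _ y"] by (intro cINF_lower \<Psi>D[OF y] bdd_belowI2[where m="L' y"]) auto
    also have "\<dots> = L' y" using L'(1)[OF y] by (simp add: \<Lambda>_def \<Psi>D[OF y] \<Phi>\<Psi>[OF EY(1)[OF y]])
    finally show "(INF x\<in>D. \<Lambda> (DSum x y)) \<le> L' y" .
  qed
  have adm: "\<Lambda> \<in> admissible_lip_norms X D L Y E L'"
    unfolding admissible_lip_norms_def using lip closed quot quot' by blast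
  have "hausdorff_dist (ucp_dist (D \<oplus>\<^sub>d E) \<Lambda>) (UCP_fst n X Y) (UCP_snd n X Y) \<le> ennreal e" if n: "n \<in> N" for n
  proof -
    have n1: "n \<ge> 1" using n N by auto
    have dist: "ucp_dist (D \<oplus>\<^sub>d E) \<Lambda> (restrict (\<phi> \<circ> dfst) (X \<oplus>\<^sub>d Y)) (restrict (\<psi> \<circ> dsnd) (X \<oplus>\<^sub>d Y)) \<le> ennreal e"
      if "\<And>a b. \<lbrakk>a \<in> D; b \<in> E; norm (\<Phi> a - b) \<le> e\<rbrakk> \<Longrightarrow> op_norm (\<phi> a - \<psi> b) \<le> e" for \<phi> \<psi> :: "_ \<Rightarrow> complex mat"
      unfolding ucp_dist_def
    proof (rule SUP_least)
      fix u assume "u \<in> unit_lip_ball (D \<oplus>\<^sub>d E) \<Lambda>"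
      then have "dfst u \<in> D" "dsnd u \<in> E" "norm (\<Phi> (dfst u) - dsnd u) \<le> e"
        using \<Lambda>_le[of u 1] by (auto simp: unit_lip_ball_def dsum_set_iff)
      then show "ennreal (op_norm (restrict (\<phi> \<circ> dfst) (X \<oplus>\<^sub>d Y) u - restrict (\<psi> \<circ> dsnd) (X \<oplus>\<^sub>d Y) u)) \<le> ennreal e"
        using that DX(1) EY(1) by (intro ennreal_leI) (simp add: dsum_set_iff)
    qed
    have "(SUP f\<in>UCP_fst n X Y. INF g\<in>UCP_snd n X Y. ucp_dist (D \<oplus>\<^sub>d E) \<Lambda> f g) \<le> ennreal e"
    proof (rule SUP_least)
      fix f assume "f \<in> UCP_fst n X Y"
      then obtain \<phi> where \<phi>: "\<phi> \<in> UCP n X" and f: "f = restrict (\<phi> \<circ> dfst) (X \<oplus>\<^sub>d Y)" by (auto simp: UCP_fst_def)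
      have \<psi>: "restrict (\<phi> \<circ> \<Psi>) Y \<in> UCP n Y"
        using \<Psi>X pos[OF n] n1 by (intro UCP_comp_n_positive[OF D(1) E(1) \<phi> lin' _ one']) (auto simp: \<Psi>_def)
      show "(INF g\<in>UCP_snd n X Y. ucp_dist (D \<oplus>\<^sub>d E) \<Lambda> f g) \<le> ennreal e"
      proof (rule INF_lower2)
        show "restrict (restrict (\<phi> \<circ> \<Psi>) Y \<circ> dsnd) (X \<oplus>\<^sub>d Y) \<in> UCP_snd n X Y" using \<psi> by (simp add: UCP_snd_def)
        show "ucp_dist (D \<oplus>\<^sub>d E) \<Lambda> f (restrict (restrict (\<phi> \<circ> \<Psi>) Y \<circ> dsnd) (X \<oplus>\<^sub>d Y)) \<le> ennreal e"
          unfolding f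
        proof (rule dist)
          fix a b assume ab: "a \<in> D" "b \<in> E" "norm (\<Phi> a - b) \<le> e"
          have diff: "\<phi> a - restrict (\<phi> \<circ> \<Psi>) Y b = \<phi> (a - \<Psi> b)"
            using ab DX EY \<Psi>X by (simp add: UCP_diff[OF D(1) \<phi>])
          have "op_norm (\<phi> (a - \<Psi> b)) \<le> norm (a - \<Psi> b)"
            using ab \<Psi>D by (intro UCP_op_norm_le[OF D(1) \<phi>] DX Ds) auto
          also have "norm (a - \<Psi> b) = norm (\<Psi> (\<Phi> a - b))"
            using ab DX EY \<Phi>Y by (simp add: clinear_on_diff[OF E(1) lin'] \<Psi>\<Phi>)
          also have "\<dots> \<le> norm (\<Phi> a - b)" using ab \<Phi>E by (intro con' EY Es) auto
          finally show "op_norm (\<phi> a - restrict (\<phi> \<circ> \<Psi>) Y b) \<le> e" using ab(3) unfolding diff by simp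
        qed
      qed
    qed
    moreover have "(SUP g\<in>UCP_snd n X Y. INF f\<in>UCP_fst n X Y. ucp_dist (D \<oplus>\<^sub>d E) \<Lambda> f g) \<le> ennreal e"
    proof (rule SUP_least)
      fix g assume "g \<in> UCP_snd n X Y"
      then obtain \<psi> where \<psi>: "\<psi> \<in> UCP n Y" and g: "g = restrict (\<psi> \<circ> dsnd) (X \<oplus>\<^sub>d Y)" by (auto simp: UCP_snd_def)
      have \<phi>: "restrict (\<psi> \<circ> \<Phi>) X \<in> UCP n X"
        using \<Phi>Y pos[OF n] n1 by (intro UCP_comp_n_positive[OF E(1) D(1) \<psi> lin _ one]) auto
      show "(INF f\<in>UCP_fst n X Y. ucp_dist (D \<oplus>\<^sub>d E) \<Lambda> f g) \<le> ennreal e"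
      proof (rule INF_lower2)
        show "restrict (restrict (\<psi> \<circ> \<Phi>) X \<circ> dfst) (X \<oplus>\<^sub>d Y) \<in> UCP_fst n X Y" using \<phi> by (simp add: UCP_fst_def)
        show "ucp_dist (D \<oplus>\<^sub>d E) \<Lambda> (restrict (restrict (\<psi> \<circ> \<Phi>) X \<circ> dfst) (X \<oplus>\<^sub>d Y)) g \<le> ennreal e"
          unfolding g
        proof (rule dist)
          fix a b assume ab: "a \<in> D" "b \<in> E" "norm (\<Phi> a - b) \<le> e"
          have "restrict (\<psi> \<circ> \<Phi>) X a - \<psi> b = \<psi> (\<Phi> a - b)"
            using ab DX EY \<Phi>Y by (simp add: UCP_diff[OF E(1) \<psi>])
          moreover have "op_norm (\<psi> (\<Phi> a - b)) \<le> norm (\<Phi> a - b)"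
            using ab \<Phi>E by (intro UCP_op_norm_le[OF E(1) \<psi>] EY Es) auto
          ultimately show "op_norm (restrict (\<psi> \<circ> \<Phi>) X a - \<psi> b) \<le> e" using ab(3) by simp
        qed
      qed
    qed
    ultimately show ?thesis by (simp add: hausdorff_dist_def)
  qed
  then show ?thesis using adm by blast
qed

section \<open>Vanishing of the distances\<close>

lemma ennreal_eq_0_if_le_all:
  assumes "\<And>e. e > 0 \<Longrightarrow> d \<le> ennreal e" shows "d = 0"
proof (rule ccontr)
  assume "d \<noteq> 0"
  moreover have "d < \<infinity>" using assms[of 1] by (simp add: le_less_trans)
  ultimately obtain r where r: "d = ennreal r" "r > 0"
    by (cases d) (auto simp: ennreal_eq_0_iff less_le)
  have "ennreal r \<le> ennreal (r / 2)" using assms[of "r / 2"] r by simp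
  then show False using r(2) by (simp add: ennreal_le_iff)
qed

theorem theorem4p11:
  fixes X D\<^sub>X :: "'a::unital_cstar_algebra set" and L\<^sub>X :: "'a \<Rightarrow> real"
    and Y D\<^sub>Y :: "'b::unital_cstar_algebra set" and L\<^sub>Y :: "'b \<Rightarrow> real"
  assumes "lip_normed_operator_system X D\<^sub>X L\<^sub>X"
    and "lip_normed_operator_system Y D\<^sub>Y L\<^sub>Y"
  shows "(\<forall>n\<ge>1. dist_s_n n X D\<^sub>X L\<^sub>X Y D\<^sub>Y L\<^sub>Y = 0 \<longleftrightarrow>
            (\<exists>\<Phi>. unital_n_order_iso n X Y \<Phi> \<and> bi_lip_isometric X D\<^sub>X L\<^sub>X D\<^sub>Y L\<^sub>Y \<Phi>)) \<and>
         (dist_s X D\<^sub>X L\<^sub>X Y D\<^sub>Y L\<^sub>Y = 0 \<longleftrightarrow>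
            (\<exists>\<Phi>. unital_complete_order_iso X Y \<Phi> \<and> bi_lip_isometric X D\<^sub>X L\<^sub>X D\<^sub>Y L\<^sub>Y \<Phi>))"
proof (intro conjI allI impI)
  let ?A = "admissible_lip_norms X D\<^sub>X L\<^sub>X Y D\<^sub>Y L\<^sub>Y"
  let ?h = "\<lambda>n \<Lambda>. hausdorff_dist (ucp_dist (D\<^sub>X \<oplus>\<^sub>d D\<^sub>Y) \<Lambda>) (UCP_fst n X Y) (UCP_snd n X Y)"
  fix n :: nat assume n: "n \<ge> 1"
  show "dist_s_n n X D\<^sub>X L\<^sub>X Y D\<^sub>Y L\<^sub>Y = 0 \<longleftrightarrow>
      (\<exists>\<Phi>. unital_n_order_iso n X Y \<Phi> \<and> bi_lip_isometric X D\<^sub>X L\<^sub>X D\<^sub>Y L\<^sub>Y \<Phi>)"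
  proof
    assume 0: "dist_s_n n X D\<^sub>X L\<^sub>X Y D\<^sub>Y L\<^sub>Y = 0"
    have small: "\<exists>\<Lambda>\<in>?A. \<forall>m\<in>{n}. ?h m \<Lambda> < ennreal e" if "e > 0" for e
    proof -
      have "(INF \<Lambda>\<in>?A. ?h n \<Lambda>) < ennreal e" using 0 that by (simp add: dist_s_n_def)
      then show ?thesis by (simp add: INF_less_iff)
    qed
    obtain \<Phi> where "bij_betw \<Phi> X Y" "clinear_on X \<Phi>" "\<Phi> 1 = 1" "bi_lip_isometric X D\<^sub>X L\<^sub>X D\<^sub>Y L\<^sub>Y \<Phi>"
      "\<And>k m. k \<in> {n} \<Longrightarrow> m \<in> {1..k} \<Longrightarrow> n_positive_on m X \<Phi> \<and> n_positive_on m Y (inv_into X \<Phi>)"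
      by (rule order_iso_if_small_distances[OF assms, where N="{n}"]) (use small n in \<open>auto intro: that\<close>)
    then show "\<exists>\<Phi>. unital_n_order_iso n X Y \<Phi> \<and> bi_lip_isometric X D\<^sub>X L\<^sub>X D\<^sub>Y L\<^sub>Y \<Phi>"
      by (auto simp: unital_n_order_iso_def)
  next
    assume "\<exists>\<Phi>. unital_n_order_iso n X Y \<Phi> \<and> bi_lip_isometric X D\<^sub>X L\<^sub>X D\<^sub>Y L\<^sub>Y \<Phi>"
    then obtain \<Phi> where \<Phi>: "bij_betw \<Phi> X Y" "clinear_on X \<Phi>" "\<Phi> 1 = 1" "bi_lip_isometric X D\<^sub>X L\<^sub>X D\<^sub>Y L\<^sub>Y \<Phi>"
      and pos: "\<And>m. m \<in> {1..n} \<Longrightarrow> n_positive_on m X \<Phi> \<and> n_positive_on m Y (inv_into X \<Phi>)"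
      by (auto simp: unital_n_order_iso_def)
    show "dist_s_n n X D\<^sub>X L\<^sub>X Y D\<^sub>Y L\<^sub>Y = 0"
    proof (rule ennreal_eq_0_if_le_all)
      fix e :: real assume e: "e > 0"
      have "\<exists>\<Lambda>\<in>?A. \<forall>m\<in>{n}. ?h m \<Lambda> \<le> ennreal e"
        using pos n by (intro small_distances_if_order_iso[OF assms \<Phi> _ _ _ _ e]) auto
      then show "dist_s_n n X D\<^sub>X L\<^sub>X Y D\<^sub>Y L\<^sub>Y \<le> ennreal e"
        unfolding dist_s_n_def by (auto intro: INF_lower2)
    qed
  qed
next
  let ?A = "admissible_lip_norms X D\<^sub>X L\<^sub>X Y D\<^sub>Y L\<^sub>Y"
  let ?h = "\<lambda>n \<Lambda>. hausdorff_dist (ucp_dist (D\<^sub>X \<oplus>\<^sub>d D\<^sub>Y) \<Lambda>) (UCP_fst n X Y) (UCP_snd n X Y)"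
  show "dist_s X D\<^sub>X L\<^sub>X Y D\<^sub>Y L\<^sub>Y = 0 \<longleftrightarrow>
      (\<exists>\<Phi>. unital_complete_order_iso X Y \<Phi> \<and> bi_lip_isometric X D\<^sub>X L\<^sub>X D\<^sub>Y L\<^sub>Y \<Phi>)"
  proof
    assume 0: "dist_s X D\<^sub>X L\<^sub>X Y D\<^sub>Y L\<^sub>Y = 0"
    have small: "\<exists>\<Lambda>\<in>?A. \<forall>n\<in>{1..}. ?h n \<Lambda> < ennreal e" if "e > 0" for e
    proof -
      have "(INF \<Lambda>\<in>?A. SUP n\<in>{1..}. ?h n \<Lambda>) < ennreal e" using 0 that by (simp add: dist_s_def)
      then obtain \<Lambda> where "\<Lambda> \<in> ?A" "(SUP n\<in>{1..}. ?h n \<Lambda>) < ennreal e" unfolding INF_less_iff by blast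
      then show ?thesis by (intro bexI[of _ \<Lambda>] ballI) (rule le_less_trans[OF SUP_upper])
    qed
    obtain \<Phi> where "bij_betw \<Phi> X Y" "clinear_on X \<Phi>" "\<Phi> 1 = 1" "bi_lip_isometric X D\<^sub>X L\<^sub>X D\<^sub>Y L\<^sub>Y \<Phi>"
      and pos: "\<And>k m. k \<in> {1..} \<Longrightarrow> m \<in> {1..k} \<Longrightarrow> n_positive_on m X \<Phi> \<and> n_positive_on m Y (inv_into X \<Phi>)"
      by (rule order_iso_if_small_distances[OF assms, where N="{1..}"]) (use small in \<open>auto intro: that\<close>)
    moreover have "n_positive_on m X \<Phi> \<and> n_positive_on m Y (inv_into X \<Phi>)" if "m \<ge> 1" for m
      using pos[of m m] that by simp
    ultimately show "\<exists>\<Phi>. unital_complete_order_iso X Y \<Phi> \<and> bi_lip_isometric X D\<^sub>X L\<^sub>X D\<^sub>Y L\<^sub>Y \<Phi>"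
      by (auto simp: unital_complete_order_iso_def completely_positive_on_def)
  next
    assume "\<exists>\<Phi>. unital_complete_order_iso X Y \<Phi> \<and> bi_lip_isometric X D\<^sub>X L\<^sub>X D\<^sub>Y L\<^sub>Y \<Phi>"
    then obtain \<Phi> where \<Phi>: "bij_betw \<Phi> X Y" "clinear_on X \<Phi>" "\<Phi> 1 = 1" "bi_lip_isometric X D\<^sub>X L\<^sub>X D\<^sub>Y L\<^sub>Y \<Phi>"
      and pos: "\<And>m. m \<ge> 1 \<Longrightarrow> n_positive_on m X \<Phi> \<and> n_positive_on m Y (inv_into X \<Phi>)"
      by (auto simp: unital_complete_order_iso_def completely_positive_on_def)
    show "dist_s X D\<^sub>X L\<^sub>X Y D\<^sub>Y L\<^sub>Y = 0"
    proof (rule ennreal_eq_0_if_le_all)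
      fix e :: real assume e: "e > 0"
      have "\<exists>\<Lambda>\<in>?A. \<forall>n\<in>{1..}. ?h n \<Lambda> \<le> ennreal e"
        using pos by (intro small_distances_if_order_iso[OF assms \<Phi> _ _ _ _ e]) auto
      then obtain \<Lambda> where "\<Lambda> \<in> ?A" "\<And>n. n \<in> {1..} \<Longrightarrow> ?h n \<Lambda> \<le> ennreal e" by blast
      then show "dist_s X D\<^sub>X L\<^sub>X Y D\<^sub>Y L\<^sub>Y \<le> ennreal e"
        unfolding dist_s_def by (intro INF_lower2[of \<Lambda>] SUP_least)
    qed
  qed
qed

end
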